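(* Let $\mathscr G^{\mathbb L}$ be a contragredient local Lie superalgebra (with element $L$ and bilinear map $\langle-|-\rangle$), let $a,b,c\in\mathbb K$, and let $\mathscr G^{\ell}$ be the local superalgebra constructed from these data in the context. Then the local algebra $\mathscr G^\ell$ is focally associative.
   Context: Base field $\mathbb K$: algebraically closed, characteristic $0$. In exponents of $-1$, a product such as $xy$ means the product of the $\mathbb Z_2$-degrees; subscripts denote $\mathbb Z$-degrees. A local algebra is a $\mathbb Z$-graded vector space $U=U_{-1}\oplus U_0\oplus U_1$ with a degree-preserving bilinear product defined on pairs in $U_i\times U_j$ with $i,j,i+j\in\{-1,0,1\}$. A local superalgebra has in addition a $\mathbb Z_2$-grading respected by the product. A local algebra is focally associative if $(u_iv_j)w_k=u_i(v_jw_k)$ for all $u_i\in U_i$, $v_j\in U_j$, $w_k\in U_k$ whenever all involved products are defined and at least one of $i,j,k$ is zero. A local Lie superalgebra is a local superalgebra with product (bracket) $[\![-,-]\!]$ satisfying $[\![x,y]\!]=-(-1)^{xy}[\![y,x]\!]$ and $[\![[\![x,y]\!],z]\!]=[\![x,[\![y,z]\!]]\!]-(-1)^{xy}[\![y,[\![x,z]\!]]\!]$ for homogeneous elements whenever all involved brackets are defined. A local Lie superalgebra $\mathscr G^{\mathbb L}=\mathscr G^{\mathbb L}_{-1}\oplus\mathscr G^{\mathbb L}_0\oplus\mathscr G^{\mathbb L}_1$ is contragredient if there are an element $L\in\mathscr G^{\mathbb L}_0$ with $[\![L,x_k]\!]=kx_k$ for all $x_k\in\mathscr G^{\mathbb L}_k$,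 $k=-1,0,1$, and a bilinear map $\mathscr G^{\mathbb L}_{-1}\times\mathscr G^{\mathbb L}_1\to\mathbb K$, $(x,y)\mapsto\langle x|y\rangle$, that is invariant ($\langle[\![x_{-1},y_0]\!]|z_1\rangle=\langle x_{-1}|[\![y_0,z_1]\!]\rangle$) and homogeneous ($\langle x|y\rangle=0$ if $x,y$ are homogeneous of different $\mathbb Z_2$-degrees). One also defines $\langle x|y\rangle=(-1)^{xy}\langle y|x\rangle$ for $x\in\mathscr G^{\mathbb L}_1$, $y\in\mathscr G^{\mathbb L}_{-1}$. Construction of $\mathscr G^\ell$: let $\mathscr G^\ell_0$ be the universal enveloping algebra of $\mathscr G^{\mathbb L}_0$ and $\mathscr G^\ell_{\pm1}=\mathscr G^{\mathbb L}_{\pm1}\otimes\mathscr G^\ell_0$; identify $x\in\mathscr G^{\mathbb L}_{\pm1}$ with $x\otimes1$, and for $x\in\mathbb K$, $u\in\mathscr G^\ell_0$ let $x\otimes u$ mean $xu$. For $x_{\pm1},y_{\pm1}\in\mathscr G^{\mathbb L}_{\pm1}$ set $$x_{-1}y_1=-a[\![x_{-1},y_1]\!]+b\langle x_{-1}|y_1\rangle L,\qquad x_1y_{-1}=a[\![x_1,y_{-1}]\!]+b\langle x_1|y_{-1}\rangle L+c\langle x_1|y_{-1}\rangle,$$ and let $x_0y_{\pm1}=y_{\pm1}x_0$ be scalar multiplication for $x_0\in\mathbb K$. Let $(\mathscr G^\ell_0)^0=\mathbb K$ and let $(\mathscr G^\ell_0)^{k+1}$ be spanned by all $ux$ with $u\in(\mathscr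 G^\ell_0)^k$, $x\in\mathscr G^{\mathbb L}_0$. The product on $\mathscr G^\ell=\mathscr G^\ell_{-1}\oplus\mathscr G^\ell_0\oplus\mathscr G^\ell_1$ is defined recursively by $$x(y\otimes v)=(xy)v,\qquad (x\otimes(uz))(y\otimes v)=(x\otimes u)([\![z,y]\!]\otimes v)+(-1)^{yz}(x\otimes u)(y\otimes(zv))$$ for $x\in\mathbb K\oplus\mathscr G^{\mathbb L}_{\pm1}$, $y\in\mathbb K\oplus\mathscr G^{\mathbb L}_{\mp1}$, $z\in\mathscr G^{\mathbb L}_0$, $u\in(\mathscr G^\ell_0)^i$, $v\in(\mathscr G^\ell_0)^j$, $i,j\geq0$, where $[\![z,y]\!]=0$ for $y\in\mathbb K$, and $(xy)v$ means $(xy)\otimes v$ if $xy\in\mathscr G^{\mathbb L}_{\pm1}$. On $\mathscr G^\ell_0$ this is the product of the universal enveloping algebra.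
   Formalization: The element L is additionally assumed to be even; without this the product need not respect the Z_2-grading and focal associativity can fail, e.g. when L has a central odd part and another independent central odd element exists. *)

theory Defs
  imports
    "HOL-Algebra.Algebra"
    "HOL-Algebra.Algebraic_Closure_Type"
    "HOL-Library.Poly_Mapping"
    "HOL-Library.Z2"
begin

text \<open>
  The base field is a type of class \<open>field\<close>, regarded as a HOL-Algebra ring; vector spaces are
  HOL-Algebra modules over it. As usual for \<open>module\<close> records, the fields \<open>mult\<close> and \<open>one\<close> are
  meaningless unless said otherwise. In a (super)algebra, \<open>mult\<close> is the (not necessarily
  associative) product.
\<close>

abbreviation scalars :: "'k::field ring"
  where "scalars \<equiv> ring_of_type_algebra"

definition vspan :: "('k::field, 'a, 'm) module_scheme \<Rightarrow> 'a set \<Rightarrow> 'a set"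
  where "vspan V S = \<Inter>{N. submodule N scalars V \<and> S \<subseteq> N}"

definition is_direct_sum ::
    "('k::field, 'a, 'm) module_scheme \<Rightarrow> 'i set \<Rightarrow> ('i \<Rightarrow> 'a set) \<Rightarrow> bool"
  where "is_direct_sum V I W \<longleftrightarrow>
    (\<forall>i\<in>I. submodule (W i) scalars V) \<and>
    (\<forall>x\<in>carrier V. \<exists>!f. f \<in> (\<Pi>\<^sub>E i\<in>I. W i) \<and> x = finsum V f I)"


section \<open>Local algebras and local superalgebras\<close>

text \<open>
  \<open>deg U i\<close> is the component of \<open>\<int>\<close>-degree \<open>i\<close> (relevant for \<open>i = -1, 0, 1\<close> only), and
  \<open>par U p\<close> the component of \<open>\<int>\<^sub>2\<close>-degree \<open>p\<close>. The product is a total function, but only its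
  values on \<open>deg U i \<times> deg U j\<close> with \<open>i, j, i + j \<in> {-1, 0, 1}\<close> have a meaning.
\<close>

record ('k, 'a) local_algebra = "('k, 'a) module" +
  deg :: "int \<Rightarrow> 'a set"

record ('k, 'a) local_superalgebra = "('k, 'a) local_algebra" +
  par :: "bit \<Rightarrow> 'a set"

definition local_degs :: "int set"
  where "local_degs = {-1, 0, 1}"

locale local_algebra = module "scalars :: 'k::field ring" U
  for U :: "('k::field, 'a, 'm) local_algebra_scheme" (structure) +
  assumes Z_grading: "is_direct_sum U local_degs (deg U)"
    and mult_deg: "\<lbrakk>i \<in> local_degs; j \<in> local_degs; i + j \<in> local_degs; x \<in> deg U i; y \<in> deg U j\<rbrakk>
      \<Longrightarrow> x \<otimes> y \<in> deg U (i + j)"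
    and mult_add_left: "\<lbrakk>i \<in> local_degs; j \<in> local_degs; i + j \<in> local_degs;
        x \<in> deg U i; x' \<in> deg U i; y \<in> deg U j\<rbrakk>
      \<Longrightarrow> (x \<oplus> x') \<otimes> y = x \<otimes> y \<oplus> x' \<otimes> y"
    and mult_add_right: "\<lbrakk>i \<in> local_degs; j \<in> local_degs; i + j \<in> local_degs;
        x \<in> deg U i; y \<in> deg U j; y' \<in> deg U j\<rbrakk>
      \<Longrightarrow> x \<otimes> (y \<oplus> y') = x \<otimes> y \<oplus> x \<otimes> y'"
    and mult_smult_left: "\<lbrakk>i \<in> local_degs; j \<in> local_degs; i + j \<in> local_degs;
        x \<in> deg U i; y \<in> deg U j\<rbrakk>
      \<Longrightarrow> (s \<odot> x) \<otimes> y = s \<odot> (x \<otimes> y)"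
    and mult_smult_right: "\<lbrakk>i \<in> local_degs; j \<in> local_degs; i + j \<in> local_degs;
        x \<in> deg U i; y \<in> deg U j\<rbrakk>
      \<Longrightarrow> x \<otimes> (s \<odot> y) = s \<odot> (x \<otimes> y)"

locale focally_associative = local_algebra +
  assumes focal_assoc: "\<lbrakk>i \<in> local_degs; j \<in> local_degs; k \<in> local_degs;
      i + j \<in> local_degs; j + k \<in> local_degs; i + j + k \<in> local_degs;
      i = 0 \<or> j = 0 \<or> k = 0;
      u \<in> deg U i; v \<in> deg U j; w \<in> deg U k\<rbrakk>
    \<Longrightarrow> (u \<otimes> v) \<otimes> w = u \<otimes> (v \<otimes> w)"

locale local_superalgebra = local_algebra U
  for U :: "('k::field, 'a, 'm) local_superalgebra_scheme" (structure) +
  assumes Z2_grading: "is_direct_sum U UNIV (par U)"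
    and gradings_compatible: "\<lbrakk>i \<in> local_degs; x \<in> deg U i\<rbrakk>
      \<Longrightarrow> \<exists>x0 \<in> deg U i \<inter> par U 0. \<exists>x1 \<in> deg U i \<inter> par U 1. x = x0 \<oplus> x1"
    and mult_par: "\<lbrakk>i \<in> local_degs; j \<in> local_degs; i + j \<in> local_degs;
        x \<in> deg U i \<inter> par U p; y \<in> deg U j \<inter> par U q\<rbrakk>
      \<Longrightarrow> x \<otimes> y \<in> par U (p + q)"

definition parity_sign :: "bit \<Rightarrow> 'k::field"
  where "parity_sign p = (if p = 0 then 1 else - 1)"

locale local_Lie_superalgebra = local_superalgebra U
  for U :: "('k::field, 'a, 'm) local_superalgebra_scheme" (structure) +
  assumes super_antisym: "\<lbrakk>i \<in> local_degs; j \<in> local_degs; i + j \<in> local_degs;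
      x \<in> deg U i \<inter> par U p; y \<in> deg U j \<inter> par U q\<rbrakk>
      \<Longrightarrow> x \<otimes> y = \<ominus> (parity_sign (p * q) \<odot> (y \<otimes> x))"
    and super_Jacobi: "\<lbrakk>i \<in> local_degs; j \<in> local_degs; k \<in> local_degs;
      i + j \<in> local_degs; j + k \<in> local_degs; i + k \<in> local_degs; i + j + k \<in> local_degs;
      x \<in> deg U i \<inter> par U p; y \<in> deg U j \<inter> par U q; z \<in> deg U k \<inter> par U r\<rbrakk>
      \<Longrightarrow> (x \<otimes> y) \<otimes> z = x \<otimes> (y \<otimes> z) \<ominus> parity_sign (p * q) \<odot> (y \<otimes> (x \<otimes> z))"

text \<open>
  \<open>form x y\<close> is \<open>\<langle>x|y\<rangle>\<close> for \<open>x\<close> of degree \<open>-1\<close> and \<open>y\<close> of degree \<open>1\<close>.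
  The assumption that \<open>L\<close> is even is needed for the products \<open>x\<^sub>-\<^sub>1y\<^sub>1\<close> and \<open>x\<^sub>1y\<^sub>-\<^sub>1\<close> below
  to respect the \<open>\<int>\<^sub>2\<close>-grading.
\<close>

locale contragredient = local_Lie_superalgebra G
  for G :: "('k::field, 'g, 'm) local_superalgebra_scheme" (structure) +
  fixes L :: 'g and form :: "'g \<Rightarrow> 'g \<Rightarrow> 'k"
  assumes L_deg: "L \<in> deg G 0"
    and L_even: "L \<in> par G 0"
    and L_bracket: "\<lbrakk>k \<in> local_degs; x \<in> deg G k\<rbrakk> \<Longrightarrow> L \<otimes> x = of_int k \<odot> x"
    and form_add_left: "\<lbrakk>x \<in> deg G (- 1); x' \<in> deg G (- 1); y \<in> deg G 1\<rbrakk>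
      \<Longrightarrow> form (x \<oplus> x') y = form x y + form x' y"
    and form_add_right: "\<lbrakk>x \<in> deg G (- 1); y \<in> deg G 1; y' \<in> deg G 1\<rbrakk>
      \<Longrightarrow> form x (y \<oplus> y') = form x y + form x y'"
    and form_smult_left: "\<lbrakk>x \<in> deg G (- 1); y \<in> deg G 1\<rbrakk> \<Longrightarrow> form (s \<odot> x) y = s * form x y"
    and form_smult_right: "\<lbrakk>x \<in> deg G (- 1); y \<in> deg G 1\<rbrakk> \<Longrightarrow> form x (s \<odot> y) = s * form x y"
    and form_invariant: "\<lbrakk>x \<in> deg G (- 1); y \<in> deg G 0; z \<in> deg G 1\<rbrakk>
      \<Longrightarrow> form (x \<otimes> y) z = form x (y \<otimes> z)"
    and form_homogeneous: "\<lbrakk>x \<in> deg G (- 1) \<inter> par G p; y \<in> deg G 1 \<inter> par G q; p \<noteq> q\<rbrakk>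
      \<Longrightarrow> form x y = 0"


section \<open>Quotients, tensor products and the enveloping algebra\<close>

text \<open>
  The quotient of a vector space by a subspace, or of an associative algebra by an ideal; in the
  former case the multiplicative part provided by \<open>Quot\<close> is irrelevant.
\<close>

definition quot_space ::
    "('k::field, 'a, 'm) module_scheme \<Rightarrow> 'a set \<Rightarrow> ('k, 'a set) module"
  where "quot_space V N =
    ring.extend (V Quot N) (module.fields (\<lambda>c C. \<Union>x\<in>C. N +>\<^bsub>V\<^esub> (c \<odot>\<^bsub>V\<^esub> x)))"

definition free_space :: "'x set \<Rightarrow> ('k::field, 'x \<Rightarrow>\<^sub>0 'k) module"
  where "free_space B =
    \<lparr>carrier = {f. Poly_Mapping.keys f \<subseteq> B}, monoid.mult = undefined, one = undefined,
     ring.zero = 0, add = (+), module.smult = (\<lambda>c. Poly_Mapping.map ((*) c))\<rparr>"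

text \<open>The free associative algebra: its basis consists of the words over \<open>B\<close>.\<close>

definition free_algebra :: "'x set \<Rightarrow> ('k::field, 'x list \<Rightarrow>\<^sub>0 'k) module"
  where "free_algebra B = (free_space (lists B))
    \<lparr>monoid.mult := (\<lambda>f g. \<Sum>v\<in>Poly_Mapping.keys f. \<Sum>w\<in>Poly_Mapping.keys g.
       Poly_Mapping.single (v @ w) (Poly_Mapping.lookup f v * Poly_Mapping.lookup g w)),
     one := Poly_Mapping.single [] 1\<rparr>"

definition tensor_rels ::
    "('k::field, 'a, 'm) module_scheme \<Rightarrow> ('k, 'b, 'n) module_scheme \<Rightarrow> ('a \<times> 'b \<Rightarrow>\<^sub>0 'k) set"
  where "tensor_rels V W =
    {Poly_Mapping.single (x \<oplus>\<^bsub>V\<^esub> x', y) 1 - Poly_Mapping.single (x, y) 1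
       - Poly_Mapping.single (x', y) 1 | x x' y. x \<in> carrier V \<and> x' \<in> carrier V \<and> y \<in> carrier W}
    \<union> {Poly_Mapping.single (x, y \<oplus>\<^bsub>W\<^esub> y') 1 - Poly_Mapping.single (x, y) 1
       - Poly_Mapping.single (x, y') 1 | x y y'. x \<in> carrier V \<and> y \<in> carrier W \<and> y' \<in> carrier W}
    \<union> {Poly_Mapping.single (s \<odot>\<^bsub>V\<^esub> x, y) 1 - Poly_Mapping.single (x, y) s
       | s x y. x \<in> carrier V \<and> y \<in> carrier W}
    \<union> {Poly_Mapping.single (x, s \<odot>\<^bsub>W\<^esub> y) 1 - Poly_Mapping.single (x, y) s
       | s x y. x \<in> carrier V \<and> y \<in> carrier W}"

definition tensor_null ::
    "('k::field, 'a, 'm) module_scheme \<Rightarrow> ('k, 'b, 'n) module_scheme \<Rightarrow> ('a \<times> 'b \<Rightarrow>\<^sub>0 'k) set"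
  where "tensor_null V W = vspan (free_space (carrier V \<times> carrier W)) (tensor_rels V W)"

definition tensor_space ::
    "('k::field, 'a, 'm) module_scheme \<Rightarrow> ('k, 'b, 'n) module_scheme
      \<Rightarrow> ('k, ('a \<times> 'b \<Rightarrow>\<^sub>0 'k) set) module"
  where "tensor_space V W =
    quot_space (free_space (carrier V \<times> carrier W)) (tensor_null V W)"

definition pure_tensor ::
    "('k::field, 'a, 'm) module_scheme \<Rightarrow> ('k, 'b, 'n) module_scheme
      \<Rightarrow> 'a \<Rightarrow> 'b \<Rightarrow> ('a \<times> 'b \<Rightarrow>\<^sub>0 'k) set"
  where "pure_tensor V W x y =
    tensor_null V W +>\<^bsub>free_space (carrier V \<times> carrier W)\<^esub> Poly_Mapping.single (x, y) 1"

text \<open>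
  The universal enveloping algebra of the Lie superalgebra \<open>deg G 0\<close>. The first two families of
  relations turn the free algebra on the set \<open>deg G 0\<close> into the tensor algebra of the vector space
  \<open>deg G 0\<close>.
\<close>

type_synonym ('k, 'g) env = "('g list \<Rightarrow>\<^sub>0 'k) set"

definition env_rels ::
    "('k::field, 'g, 'm) local_superalgebra_scheme \<Rightarrow> ('g list \<Rightarrow>\<^sub>0 'k) set"
  where "env_rels G =
    {Poly_Mapping.single [x \<oplus>\<^bsub>G\<^esub> y] 1 - Poly_Mapping.single [x] 1 - Poly_Mapping.single [y] 1
       | x y. x \<in> deg G 0 \<and> y \<in> deg G 0}
    \<union> {Poly_Mapping.single [s \<odot>\<^bsub>G\<^esub> x] 1 - Poly_Mapping.single [x] s | s x. x \<in> deg G 0}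
    \<union> {Poly_Mapping.single [x, y] 1 - Poly_Mapping.single [y, x] (parity_sign (p * q))
       - Poly_Mapping.single [x \<otimes>\<^bsub>G\<^esub> y] 1
       | x y p q. x \<in> deg G 0 \<inter> par G p \<and> y \<in> deg G 0 \<inter> par G q}"

definition env_ideal ::
    "('k::field, 'g, 'm) local_superalgebra_scheme \<Rightarrow> ('g list \<Rightarrow>\<^sub>0 'k) set"
  where "env_ideal G = genideal (free_algebra (deg G 0)) (env_rels G)"

definition env_alg ::
    "('k::field, 'g, 'm) local_superalgebra_scheme \<Rightarrow> ('k, ('k, 'g) env) module"
  where "env_alg G = quot_space (free_algebra (deg G 0)) (env_ideal G)"

definition env_incl ::
    "('k::field, 'g, 'm) local_superalgebra_scheme \<Rightarrow> 'g \<Rightarrow> ('k, 'g) env"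
  where "env_incl G x =
    env_ideal G +>\<^bsub>free_algebra (deg G 0)\<^esub> Poly_Mapping.single [x] (1::'k)"

primrec env_pow ::
    "('k::field, 'g, 'm) local_superalgebra_scheme \<Rightarrow> nat \<Rightarrow> ('k, 'g) env set"
  where
    "env_pow G 0 = vspan (env_alg G) {\<one>\<^bsub>env_alg G\<^esub>}"
  | "env_pow G (Suc k) = vspan (env_alg G)
      {u \<otimes>\<^bsub>env_alg G\<^esub> env_incl G x | u x. u \<in> env_pow G k \<and> x \<in> deg G 0}"

inductive_set env_monomials ::
    "('k::field, 'g, 'm) local_superalgebra_scheme \<Rightarrow> (bit \<times> ('k, 'g) env) set"
  for G :: "('k::field, 'g, 'm) local_superalgebra_scheme"
  where
    one: "(0, \<one>\<^bsub>env_alg G\<^esub>) \<in> env_monomials G"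
  | mult: "\<lbrakk>(p, u) \<in> env_monomials G; x \<in> deg G 0 \<inter> par G q\<rbrakk>
      \<Longrightarrow> (p + q, u \<otimes>\<^bsub>env_alg G\<^esub> env_incl G x) \<in> env_monomials G"

definition env_par ::
    "('k::field, 'g, 'm) local_superalgebra_scheme \<Rightarrow> bit \<Rightarrow> ('k, 'g) env set"
  where "env_par G p = vspan (env_alg G) {u. (p, u) \<in> env_monomials G}"


section \<open>The local superalgebra \<open>\<G>\<^sup>\<ell>\<close>\<close>

text \<open>
  \<open>tens_mod G i\<close> is \<open>deg G i \<otimes> env_alg G\<close>, for \<open>i = -1, 1\<close>. An element of the constructed local
  superalgebra is a triple, consisting of its components in degrees \<open>-1, 0, 1\<close>.
\<close>

type_synonym ('k, 'g) tens = "('g \<times> ('k, 'g) env \<Rightarrow>\<^sub>0 'k) set"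
type_synonym ('k, 'g) gl = "('k, 'g) tens \<times> ('k, 'g) env \<times> ('k, 'g) tens"

definition tens_mod ::
    "('k::field, 'g, 'm) local_superalgebra_scheme \<Rightarrow> int \<Rightarrow> ('k, ('k, 'g) tens) module"
  where "tens_mod G i = tensor_space (G\<lparr>carrier := deg G i\<rparr>) (env_alg G)"

definition tens_pure ::
    "('k::field, 'g, 'm) local_superalgebra_scheme \<Rightarrow> int \<Rightarrow> 'g \<Rightarrow> ('k, 'g) env \<Rightarrow> ('k, 'g) tens"
  where "tens_pure G i x u = pure_tensor (G\<lparr>carrier := deg G i\<rparr>) (env_alg G) x u"

definition tens_par ::
    "('k::field, 'g, 'm) local_superalgebra_scheme \<Rightarrow> int \<Rightarrow> bit \<Rightarrow> ('k, 'g) tens set"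
  where "tens_par G i p = vspan (tens_mod G i)
    {tens_pure G i x u | x u q r. x \<in> deg G i \<inter> par G q \<and> u \<in> env_par G r \<and> p = q + r}"

definition Gl_space ::
    "('k::field, 'g, 'm) local_superalgebra_scheme \<Rightarrow> ('k, ('k, 'g) gl) local_superalgebra"
  where "Gl_space G =
    (let M = tens_mod G (- 1); U = env_alg G; P = tens_mod G 1 in
     \<lparr>carrier = carrier M \<times> carrier U \<times> carrier P,
      monoid.mult = undefined,
      one = undefined,
      ring.zero = (\<zero>\<^bsub>M\<^esub>, \<zero>\<^bsub>U\<^esub>, \<zero>\<^bsub>P\<^esub>),
      add = (\<lambda>(x, u, y) (x', u', y'). (x \<oplus>\<^bsub>M\<^esub> x', u \<oplus>\<^bsub>U\<^esub> u', y \<oplus>\<^bsub>P\<^esub> y')),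
      module.smult = (\<lambda>s (x, u, y). (s \<odot>\<^bsub>M\<^esub> x, s \<odot>\<^bsub>U\<^esub> u, s \<odot>\<^bsub>P\<^esub> y)),
      deg = (\<lambda>i. if i = - 1 then carrier M \<times> {\<zero>\<^bsub>U\<^esub>} \<times> {\<zero>\<^bsub>P\<^esub>}
                 else if i = 0 then {\<zero>\<^bsub>M\<^esub>} \<times> carrier U \<times> {\<zero>\<^bsub>P\<^esub>}
                 else if i = 1 then {\<zero>\<^bsub>M\<^esub>} \<times> {\<zero>\<^bsub>U\<^esub>} \<times> carrier P
                 else {(\<zero>\<^bsub>M\<^esub>, \<zero>\<^bsub>U\<^esub>, \<zero>\<^bsub>P\<^esub>)}),
      par = (\<lambda>p. tens_par G (- 1) p \<times> env_par G p \<times> tens_par G 1 p)\<rparr>)"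

text \<open>
  Homogeneous elements of \<open>\<bbbK> \<oplus> deg G i\<close>, of parity \<open>p\<close>: a scalar is tagged with \<open>Inl\<close>, an
  element of \<open>deg G i\<close> with \<open>Inr\<close>. By bilinearity it suffices to impose the defining equations
  of the product on such elements.
\<close>

definition gens ::
    "('k::field, 'g, 'm) local_superalgebra_scheme \<Rightarrow> int \<Rightarrow> bit \<Rightarrow> ('k + 'g) set"
  where "gens G i p = {Inl s | s. p = 0} \<union> {Inr x | x. x \<in> deg G i \<inter> par G p}"

text \<open>\<open>x \<otimes> u\<close> for \<open>x \<in> \<bbbK> \<oplus> deg G i\<close>, where \<open>i = -1, 1\<close>\<close>

definition tens ::
    "('k::field, 'g, 'm) local_superalgebra_scheme \<Rightarrow> int \<Rightarrow> 'k + 'g \<Rightarrow> ('k, 'g) env \<Rightarrow> ('k, 'g) gl"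
  where "tens G i x u =
    (let M = tens_mod G (- 1); U = env_alg G; P = tens_mod G 1 in
     case x of
       Inl s \<Rightarrow> (\<zero>\<^bsub>M\<^esub>, s \<odot>\<^bsub>U\<^esub> u, \<zero>\<^bsub>P\<^esub>)
     | Inr y \<Rightarrow> (if i = - 1 then (tens_pure G i y u, \<zero>\<^bsub>U\<^esub>, \<zero>\<^bsub>P\<^esub>)
                 else (\<zero>\<^bsub>M\<^esub>, \<zero>\<^bsub>U\<^esub>, tens_pure G i y u)))"

text \<open>\<open>[z, y]\<close> for \<open>z \<in> deg G 0\<close>, with the convention that it vanishes if \<open>y\<close> is a scalar\<close>

definition gen_bracket ::
    "('k::field, 'g, 'm) local_superalgebra_scheme \<Rightarrow> 'g \<Rightarrow> 'k + 'g \<Rightarrow> 'k + 'g"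
  where "gen_bracket G z y = (case y of Inl s \<Rightarrow> Inl 0 | Inr y' \<Rightarrow> Inr (z \<otimes>\<^bsub>G\<^esub> y'))"

text \<open>
  The products \<open>x\<^sub>-\<^sub>1y\<^sub>1\<close> (for \<open>i = -1\<close>) and \<open>x\<^sub>1y\<^sub>-\<^sub>1\<close> (for \<open>i = 1\<close>) in the enveloping algebra, where
  \<open>x\<close> and \<open>y\<close> have parities \<open>p\<close> and \<open>q\<close>; in the latter case \<open>\<langle>x|y\<rangle>\<close> is \<open>parity_sign (p * q) * form y x\<close>.
\<close>

definition opposite_prod ::
    "('k::field, 'g, 'm) local_superalgebra_scheme \<Rightarrow> 'g \<Rightarrow> ('g \<Rightarrow> 'g \<Rightarrow> 'k) \<Rightarrow> 'k \<Rightarrow> 'k \<Rightarrow> 'k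
      \<Rightarrow> int \<Rightarrow> bit \<Rightarrow> bit \<Rightarrow> 'g \<Rightarrow> 'g \<Rightarrow> ('k, 'g) env"
  where "opposite_prod G L form a b c i p q x y =
    (let U = env_alg G; \<iota> = env_incl G in
     if i = - 1
     then (- a) \<odot>\<^bsub>U\<^esub> \<iota> (x \<otimes>\<^bsub>G\<^esub> y) \<oplus>\<^bsub>U\<^esub> (b * form x y) \<odot>\<^bsub>U\<^esub> \<iota> L
     else a \<odot>\<^bsub>U\<^esub> \<iota> (x \<otimes>\<^bsub>G\<^esub> y)
          \<oplus>\<^bsub>U\<^esub> (b * (parity_sign (p * q) * form y x)) \<odot>\<^bsub>U\<^esub> \<iota> L
          \<oplus>\<^bsub>U\<^esub> (c * (parity_sign (p * q) * form y x)) \<odot>\<^bsub>U\<^esub> \<one>\<^bsub>U\<^esub>)"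

text \<open>
  \<open>(xy)v\<close> for \<open>x \<in> \<bbbK> \<oplus> deg G i\<close> and \<open>y \<in> \<bbbK> \<oplus> deg G (-i)\<close> of parities \<open>p\<close> and \<open>q\<close>, where \<open>i = -1, 1\<close>
\<close>

definition base_prod ::
    "('k::field, 'g, 'm) local_superalgebra_scheme \<Rightarrow> 'g \<Rightarrow> ('g \<Rightarrow> 'g \<Rightarrow> 'k) \<Rightarrow> 'k \<Rightarrow> 'k \<Rightarrow> 'k
      \<Rightarrow> int \<Rightarrow> bit \<Rightarrow> bit \<Rightarrow> 'k + 'g \<Rightarrow> 'k + 'g \<Rightarrow> ('k, 'g) env \<Rightarrow> ('k, 'g) gl"
  where "base_prod G L form a b c i p q x y v =
    (case (x, y) of
       (Inl s, Inl t) \<Rightarrow> tens G i (Inl (s * t)) v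
     | (Inl s, Inr y') \<Rightarrow> tens G (- i) (Inr (s \<odot>\<^bsub>G\<^esub> y')) v
     | (Inr x', Inl t) \<Rightarrow> tens G i (Inr (t \<odot>\<^bsub>G\<^esub> x')) v
     | (Inr x', Inr y') \<Rightarrow>
         tens G i (Inl 1) (opposite_prod G L form a b c i p q x' y' \<otimes>\<^bsub>env_alg G\<^esub> v))"

text \<open>
  The two equations defining the product recursively. They determine \<open>m\<close> on all pairs of elements
  for which the product is defined, because the spaces \<open>env_pow G k\<close> span the enveloping algebra.
\<close>

definition is_Gl_prod ::
    "('k::field, 'g, 'm) local_superalgebra_scheme \<Rightarrow> 'g \<Rightarrow> ('g \<Rightarrow> 'g \<Rightarrow> 'k) \<Rightarrow> 'k \<Rightarrow> 'k \<Rightarrow> 'k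
      \<Rightarrow> (('k, 'g) gl \<Rightarrow> ('k, 'g) gl \<Rightarrow> ('k, 'g) gl) \<Rightarrow> bool"
  where "is_Gl_prod G L form a b c m \<longleftrightarrow>
    local_algebra ((Gl_space G)\<lparr>monoid.mult := m\<rparr>) \<and>
    (\<forall>i \<in> {-1, 1}. \<forall>p q. \<forall>x \<in> gens G i p. \<forall>y \<in> gens G (- i) q. \<forall>k. \<forall>v \<in> env_pow G k.
       m (tens G i x \<one>\<^bsub>env_alg G\<^esub>) (tens G (- i) y v) = base_prod G L form a b c i p q x y v) \<and>
    (\<forall>i \<in> {-1, 1}. \<forall>p q r. \<forall>x \<in> gens G i p. \<forall>y \<in> gens G (- i) q. \<forall>z \<in> deg G 0 \<inter> par G r.
     \<forall>j k. \<forall>u \<in> env_pow G j. \<forall>v \<in> env_pow G k.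
       m (tens G i x (u \<otimes>\<^bsub>env_alg G\<^esub> env_incl G z)) (tens G (- i) y v) =
         m (tens G i x u) (tens G (- i) (gen_bracket G z y) v)
         \<oplus>\<^bsub>Gl_space G\<^esub> parity_sign (q * r) \<odot>\<^bsub>Gl_space G\<^esub>
           m (tens G i x u) (tens G (- i) y (env_incl G z \<otimes>\<^bsub>env_alg G\<^esub> v)))"

definition Gl ::
    "('k::field, 'g, 'm) local_superalgebra_scheme \<Rightarrow> 'g \<Rightarrow> ('g \<Rightarrow> 'g \<Rightarrow> 'k) \<Rightarrow> 'k \<Rightarrow> 'k \<Rightarrow> 'k
      \<Rightarrow> ('k, ('k, 'g) gl) local_superalgebra"
  where "Gl G L form a b c = (Gl_space G)\<lparr>monoid.mult := (SOME m. is_Gl_prod G L form a b c m)\<rparr>"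

end

theory Submission
  imports Defs
begin

text \<open>
  Write \<open>g = deg G 0\<close>, let \<open>U\<close> be its enveloping algebra and \<open>T i = deg G i \<otimes> U\<close> for \<open>i = -1, 1\<close>. The
  recursive equation for the product hides an action: an element \<open>z\<close> of \<open>g\<close> acts on \<open>T i\<close> by
  \<open>z (y \<otimes> v) = [z, y] \<otimes> v + (-1)^(yz) y \<otimes> z v\<close>, the tensor product of the two representations
  \<open>deg G i\<close> and \<open>U\<close>, and this extends to an action of \<open>U\<close>. The recursion then says that
  \<open>(x \<otimes> u) w = x (u w)\<close>, where \<open>x (y \<otimes> v) = (x y) v\<close>.

  Read as a definition, this formula shows that a product satisfying the equations exists. It is well
  defined by the universal properties of tensor products (\<open>tensor_lift\<close>) and of the enveloping algebra
  (\<open>env_module\<close>); the latter applies since the operators of \<open>g\<close> satisfy the commutation relations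
  of \<open>g\<close> (\<open>lie_act_bracket\<close>). The outcome is \<open>gl_mult_is_Gl_prod\<close>.

  Since \<open>Gl\<close> uses an arbitrary product that satisfies the equations, associativity is derived from the
  equations alone. Their case \<open>x = 1\<close>, \<open>u = 1\<close> describes left multiplication by \<open>z\<close>, and induction along
  the words in \<open>g\<close> gives \<open>(x \<otimes> uv) w = (x \<otimes> u) (v w)\<close> (\<open>star_env\<close>). There remain three cases, according
  to the position of the factor of degree \<open>0\<close>.

  \<^item> In the middle (\<open>assoc_middle\<close>), associativity is \<open>star_env\<close>.

  \<^item> On the right (\<open>assoc_right\<close>), it holds because right multiplication by \<open>U\<close> only affects the last
    tensor factor and so commutes with the action of \<open>g\<close> and with \<open>(x y) v\<close>.

  \<^item> On the left (\<open>assoc_left\<close>), it suffices that each \<open>z\<close> in \<open>g\<close> satisfies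
    \<open>z (x y) = [z, x] y + (-1)^(zx) x [z, y] + (-1)^(zx + zy) (x y) z\<close> in \<open>U\<close>, for \<open>x\<close> and \<open>y\<close> of degrees
    \<open>i\<close> and \<open>-i\<close> (\<open>opp_prod_derivation\<close>). Here \<open>x y\<close> is a combination of \<open>[x, y]\<close>, \<open>\<langle>x|y\<rangle> L\<close> and \<open>\<langle>x|y\<rangle> 1\<close>.
    The Jacobi identity gives the claim for the first term, and the other two satisfy it because
    \<open>L\<close> commutes with \<open>g\<close> and the form is invariant and homogeneous.
\<close>

section \<open>Vector spaces\<close>

lemma scalars_simps [simp]:
  "carrier (scalars :: 'k::field ring) = UNIV"
  "x \<otimes>\<^bsub>(scalars :: 'k ring)\<^esub> y = x * y"
  "x \<oplus>\<^bsub>(scalars :: 'k ring)\<^esub> y = x + y"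
  "\<one>\<^bsub>(scalars :: 'k ring)\<^esub> = 1"
  "\<zero>\<^bsub>(scalars :: 'k ring)\<^esub> = 0"
  by (auto simp: ring_of_type_algebra_def)

locale kspace = module "scalars :: 'k::field ring" V
  for V :: "('k::field, 'a, 'm) module_scheme" (structure)

sublocale local_algebra \<subseteq> kspace U ..

lemma kspaceI:
  fixes V :: "('k::field, 'a, 'm) module_scheme" (structure)
  assumes "\<And>x y. \<lbrakk>x \<in> carrier V; y \<in> carrier V\<rbrakk> \<Longrightarrow> x \<oplus> y \<in> carrier V"
    and "\<zero> \<in> carrier V"
    and "\<And>x y z. \<lbrakk>x \<in> carrier V; y \<in> carrier V; z \<in> carrier V\<rbrakk> \<Longrightarrow> (x \<oplus> y) \<oplus> z = x \<oplus> (y \<oplus> z)"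
    and "\<And>x y. \<lbrakk>x \<in> carrier V; y \<in> carrier V\<rbrakk> \<Longrightarrow> x \<oplus> y = y \<oplus> x"
    and "\<And>x. x \<in> carrier V \<Longrightarrow> \<zero> \<oplus> x = x"
    and smult: "\<And>s x. x \<in> carrier V \<Longrightarrow> s \<odot> x \<in> carrier V"
    and add: "\<And>s t x. x \<in> carrier V \<Longrightarrow> (s + t) \<odot> x = s \<odot> x \<oplus> t \<odot> x"
    and "\<And>s x y. \<lbrakk>x \<in> carrier V; y \<in> carrier V\<rbrakk> \<Longrightarrow> s \<odot> (x \<oplus> y) = s \<odot> x \<oplus> s \<odot> y"
    and "\<And>s t x. x \<in> carrier V \<Longrightarrow> (s * t) \<odot> x = s \<odot> (t \<odot> x)"
    and one: "\<And>x. x \<in> carrier V \<Longrightarrow> 1 \<odot> x = x"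
    and zero: "\<And>x. x \<in> carrier V \<Longrightarrow> 0 \<odot> x = \<zero>"
  shows "kspace V"
proof -
  have inv: "\<exists>y\<in>carrier V. y \<oplus> x = \<zero>" if "x \<in> carrier V" for x
    using add[OF that, of "-1" 1] one[OF that] zero[OF that] smult[OF that] by force
  have "abelian_group V"
    by (rule abelian_groupI) (use assms inv in auto)
  then have "module scalars V"
    by (intro moduleI) (use assms cring_from_type_algebra in auto)
  then show ?thesis by (simp add: kspace_def)
qed

context kspace
begin

lemma smult_mem [simp, intro]: "x \<in> carrier V \<Longrightarrow> s \<odot> x \<in> carrier V"
  by (rule smult_closed) auto

lemma smult_add_left: "x \<in> carrier V \<Longrightarrow> (s + t) \<odot> x = s \<odot> x \<oplus> t \<odot> x"
  using smult_l_distr[of s t x] by simp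

lemma smult_add_right:
  "\<lbrakk>x \<in> carrier V; y \<in> carrier V\<rbrakk> \<Longrightarrow> s \<odot> (x \<oplus> y) = s \<odot> x \<oplus> s \<odot> y"
  using smult_r_distr[of s x y] by simp

lemma smult_smult: "x \<in> carrier V \<Longrightarrow> s \<odot> (t \<odot> x) = (s * t) \<odot> x"
  using smult_assoc1[of s t x] by simp

lemma smult_1 [simp]: "x \<in> carrier V \<Longrightarrow> 1 \<odot> x = x"
  using smult_one[of x] by simp

lemma smult_0 [simp]: "x \<in> carrier V \<Longrightarrow> 0 \<odot> x = \<zero>"
  using smult_l_null[of x] by simp

lemma smult_zero [simp]: "s \<odot> \<zero> = \<zero>"
  using smult_r_null[of s] by simp

lemma add_minus_cancel: "\<lbrakk>x \<in> carrier V; y \<in> carrier V\<rbrakk> \<Longrightarrow> y \<oplus> (x \<ominus> y) = x"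
  by (simp add: a_minus_def M.a_lcomm M.r_neg)

lemma minus_eq_smult: "x \<in> carrier V \<Longrightarrow> \<ominus> x = (-1) \<odot> x"
proof -
  assume x: "x \<in> carrier V"
  have "(-1) \<odot> x \<oplus> x = \<zero>"
    using smult_add_left[OF x, of "-1" 1] x by simp
  then show ?thesis using x by (metis M.minus_equality smult_mem)
qed

lemma submoduleI':
  assumes "H \<subseteq> carrier V" "\<zero> \<in> H" "\<And>x y. \<lbrakk>x \<in> H; y \<in> H\<rbrakk> \<Longrightarrow> x \<oplus> y \<in> H"
    "\<And>s x. x \<in> H \<Longrightarrow> s \<odot> x \<in> H"
  shows "submodule H scalars V"
  by (rule submoduleI) (use assms minus_eq_smult in \<open>auto simp: subset_eq\<close>)

lemma submoduleD:
  assumes "submodule H scalars V"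
  shows "H \<subseteq> carrier V" "\<zero> \<in> H" "\<And>x y. \<lbrakk>x \<in> H; y \<in> H\<rbrakk> \<Longrightarrow> x \<oplus> y \<in> H"
    "\<And>s x. x \<in> H \<Longrightarrow> s \<odot> x \<in> H" "kspace (V\<lparr>carrier := H\<rparr>)"
proof -
  show 1: "H \<subseteq> carrier V" and "\<And>x y. \<lbrakk>x \<in> H; y \<in> H\<rbrakk> \<Longrightarrow> x \<oplus> y \<in> H"
    using submoduleE[OF assms] by auto
  show 2: "\<And>s x. x \<in> H \<Longrightarrow> s \<odot> x \<in> H" using submoduleE(4)[OF assms] by simp
  from submoduleE(2)[OF assms] obtain x where "x \<in> H" by auto
  with 1 2[of x 0] show "\<zero> \<in> H" by auto
  show "kspace (V\<lparr>carrier := H\<rparr>)"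
    unfolding kspace_def by (rule submodule.submodule_is_module[OF assms module_axioms])
qed

lemma vspan_submodule:
  assumes "S \<subseteq> carrier V"
  shows "submodule (vspan V S) scalars V" 
proof (rule submoduleI')
  show "vspan V S \<subseteq> carrier V"
    unfolding vspan_def using carrier_is_submodule assms by auto
qed (auto simp: vspan_def dest: submoduleD)

lemma vspan_closed: "S \<subseteq> carrier V \<Longrightarrow> vspan V S \<subseteq> carrier V"
  using vspan_submodule submoduleD(1) by blast

lemma vspan_superset: "x \<in> S \<Longrightarrow> x \<in> vspan V S"
  by (auto simp: vspan_def)

lemma vspan_least: "\<lbrakk>submodule N scalars V; S \<subseteq> N\<rbrakk> \<Longrightarrow> vspan V S \<subseteq> N"
  by (auto simp: vspan_def)

end

subsection \<open>Linear maps\<close>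

definition linear_map ::
    "('k::field, 'a, 'm) module_scheme \<Rightarrow> ('k, 'b, 'n) module_scheme \<Rightarrow> ('a \<Rightarrow> 'b) \<Rightarrow> bool"
  where "linear_map V W f \<longleftrightarrow>
    (\<forall>x\<in>carrier V. f x \<in> carrier W) \<and>
    (\<forall>x\<in>carrier V. \<forall>y\<in>carrier V. f (x \<oplus>\<^bsub>V\<^esub> y) = f x \<oplus>\<^bsub>W\<^esub> f y) \<and>
    (\<forall>s. \<forall>x\<in>carrier V. f (s \<odot>\<^bsub>V\<^esub> x) = s \<odot>\<^bsub>W\<^esub> f x)"

lemma linear_mapI:
  assumes "\<And>x. x \<in> carrier V \<Longrightarrow> f x \<in> carrier W"
    and "\<And>x y. \<lbrakk>x \<in> carrier V; y \<in> carrier V\<rbrakk> \<Longrightarrow> f (x \<oplus>\<^bsub>V\<^esub> y) = f x \<oplus>\<^bsub>W\<^esub> f y"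
    and "\<And>s x. x \<in> carrier V \<Longrightarrow> f (s \<odot>\<^bsub>V\<^esub> x) = s \<odot>\<^bsub>W\<^esub> f x"
  shows "linear_map V W f"
  using assms by (simp add: linear_map_def)

lemma linear_mapD:
  assumes "linear_map V W f"
  shows "x \<in> carrier V \<Longrightarrow> f x \<in> carrier W"
    and "\<lbrakk>x \<in> carrier V; y \<in> carrier V\<rbrakk> \<Longrightarrow> f (x \<oplus>\<^bsub>V\<^esub> y) = f x \<oplus>\<^bsub>W\<^esub> f y"
    and "x \<in> carrier V \<Longrightarrow> f (s \<odot>\<^bsub>V\<^esub> x) = s \<odot>\<^bsub>W\<^esub> f x"
  using assms by (auto simp: linear_map_def)

lemma linear_map_zero:
  assumes "kspace V" "kspace W" "linear_map V W f"
  shows "f \<zero>\<^bsub>V\<^esub> = \<zero>\<^bsub>W\<^esub>"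
proof -
  interpret V: kspace V by fact
  interpret W: kspace W by fact
  show ?thesis
    using linear_mapD(1,3)[OF assms(3), of "\<zero>\<^bsub>V\<^esub>"] V.smult_0[of "\<zero>\<^bsub>V\<^esub>"] W.smult_0
    by (metis V.M.zero_closed)
qed

text \<open>
  This is the form in which spanning sets of relations are used: a linear map that kills the relations
  kills the subspace that they span, by \<open>vspan_least\<close>.
\<close>

lemma linear_map_kernel:
  assumes "kspace V" "kspace W" "linear_map V W f"
  shows "submodule {x \<in> carrier V. f x = \<zero>\<^bsub>W\<^esub>} scalars V"
proof -
  interpret V: kspace V by fact
  interpret W: kspace W by fact
  show ?thesis
    by (rule V.submoduleI') (auto simp: linear_mapD[OF assms(3)] linear_map_zero[OF assms])
qed

subsection \<open>Free spaces\<close>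

lemma free_space_simps [simp]:
  "f \<in> carrier (free_space B) \<longleftrightarrow> Poly_Mapping.keys f \<subseteq> B"
  "\<zero>\<^bsub>free_space B\<^esub> = 0"
  "f \<oplus>\<^bsub>free_space B\<^esub> g = f + g"
  "s \<odot>\<^bsub>free_space B\<^esub> f = Poly_Mapping.map ((*) s) f"
  by (auto simp: free_space_def)

lemma lookup_map_times [simp]:
  "Poly_Mapping.lookup (Poly_Mapping.map ((*) (s::'k::field)) f) b = s * Poly_Mapping.lookup f b"
  by (transfer) (auto simp: when_def)

lemma keys_map_times: "Poly_Mapping.keys (Poly_Mapping.map ((*) (s::'k::field)) f) \<subseteq> Poly_Mapping.keys f"
  by (auto simp: in_keys_iff)

lemma map_times_single [simp]:
  "Poly_Mapping.map ((*) (s::'k::field)) (Poly_Mapping.single b t) = Poly_Mapping.single b (s * t)"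
  by (rule map_single) simp

lemma free_space_kspace: "kspace (free_space B :: ('k::field, 'b \<Rightarrow>\<^sub>0 'k) module)"
proof (rule kspaceI, goal_cases)
  case (1 x y) then show ?case using keys_add[of x y] by auto
next
  case (6 s x) then show ?case using keys_map_times[of s x] by auto
qed (auto intro!: poly_mapping_eqI simp: lookup_add algebra_simps)

lemma free_space_induct [consumes 1, case_names single add zero]:
  assumes "f \<in> carrier (free_space B)"
    and single: "\<And>b s. b \<in> B \<Longrightarrow> P (Poly_Mapping.single b s)"
    and add: "\<And>f g. \<lbrakk>f \<in> carrier (free_space B); g \<in> carrier (free_space B); P f; P g\<rbrakk> \<Longrightarrow> P (f + g)"
    and zero: "P 0"
  shows "P (f :: 'b \<Rightarrow>\<^sub>0 'k::field)"
proof -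
  have "Poly_Mapping.keys f \<subseteq> B" using assms by simp
  then show ?thesis
  proof (induction "Poly_Mapping.keys f" arbitrary: f rule: infinite_finite_induct)
    case (insert b K)
    define g where "g = Poly_Mapping.update b 0 f"
    have g: "Poly_Mapping.keys g = K" using insert by (auto simp: g_def keys_update)
    have f: "f = Poly_Mapping.single b (Poly_Mapping.lookup f b) + g"
      by (rule poly_mapping_eqI) (simp add: g_def lookup_add lookup_single lookup_update when_def)
    show ?case
      by (subst f) (rule add, insert insert g single, auto)
  next
    case empty
    then have "f = 0" by (intro poly_mapping_eqI) (auto simp: not_in_keys_iff_lookup_eq_zero[symmetric])
    then show ?case using zero by simp
  qed auto
qed

definition lin_ext :: "('k::field, 'a, 'm) module_scheme \<Rightarrow> ('b \<Rightarrow> 'a) \<Rightarrow> ('b \<Rightarrow>\<^sub>0 'k) \<Rightarrow> 'a"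
  where "lin_ext W \<phi> f = finsum W (\<lambda>b. Poly_Mapping.lookup f b \<odot>\<^bsub>W\<^esub> \<phi> b) (Poly_Mapping.keys f)"

context kspace
begin

lemma lin_ext_eq:
  assumes "\<And>b. b \<in> B \<Longrightarrow> \<phi> b \<in> carrier V" and "Poly_Mapping.keys f \<subseteq> A" "finite A" "A \<subseteq> B"
  shows "lin_ext V \<phi> f = finsum V (\<lambda>b. Poly_Mapping.lookup f b \<odot> \<phi> b) A"
  unfolding lin_ext_def
  by (rule M.add.finprod_mono_neutral_cong_left) (use assms in \<open>auto simp: in_keys_iff\<close>)

lemma lin_ext_linear:
  assumes \<phi>: "\<And>b. b \<in> B \<Longrightarrow> \<phi> b \<in> carrier V"
  shows "linear_map (free_space B) V (lin_ext V \<phi>)"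
proof (rule linear_mapI)
  fix f g :: "'b \<Rightarrow>\<^sub>0 'k" and s :: 'k
  assume f: "f \<in> carrier (free_space B)"
  show "lin_ext V \<phi> f \<in> carrier V"
    unfolding lin_ext_def by (rule M.finsum_closed) (use f \<phi> in auto)
  have "lin_ext V \<phi> (Poly_Mapping.map ((*) s) f) = finsum V (\<lambda>b. (s * Poly_Mapping.lookup f b) \<odot> \<phi> b) (Poly_Mapping.keys f)"
    using f keys_map_times[of s f] by (subst lin_ext_eq[OF \<phi>]) auto
  also have "\<dots> = finsum V (\<lambda>b. s \<odot> (Poly_Mapping.lookup f b \<odot> \<phi> b)) (Poly_Mapping.keys f)"
    by (rule M.finsum_cong') (use f \<phi> in \<open>auto simp: smult_smult\<close>)
  also have "\<dots> = s \<odot> lin_ext V \<phi> f"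
    unfolding lin_ext_def by (rule finsum_smult_ldistr[symmetric]) (use f \<phi> in auto)
  finally show "lin_ext V \<phi> (s \<odot>\<^bsub>free_space B\<^esub> f) = s \<odot> lin_ext V \<phi> f" by simp
  assume g: "g \<in> carrier (free_space B)"
  have "lin_ext V \<phi> (f + g) = finsum V (\<lambda>b. Poly_Mapping.lookup (f + g) b \<odot> \<phi> b) (Poly_Mapping.keys f \<union> Poly_Mapping.keys g)"
    using f g keys_add[of f g] by (subst lin_ext_eq[OF \<phi>]) auto
  also have "\<dots> = finsum V (\<lambda>b. Poly_Mapping.lookup f b \<odot> \<phi> b \<oplus> Poly_Mapping.lookup g b \<odot> \<phi> b) (Poly_Mapping.keys f \<union> Poly_Mapping.keys g)"
    by (rule M.finsum_cong') (use f g \<phi> in \<open>auto simp: lookup_add smult_add_left\<close>)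
  also have "\<dots> = finsum V (\<lambda>b. Poly_Mapping.lookup f b \<odot> \<phi> b) (Poly_Mapping.keys f \<union> Poly_Mapping.keys g)
      \<oplus> finsum V (\<lambda>b. Poly_Mapping.lookup g b \<odot> \<phi> b) (Poly_Mapping.keys f \<union> Poly_Mapping.keys g)"
    by (rule M.finsum_addf) (use f g \<phi> in auto)
  also have "\<dots> = lin_ext V \<phi> f \<oplus> lin_ext V \<phi> g"
    using f g by (simp add: lin_ext_eq[OF \<phi>, where A = "Poly_Mapping.keys f \<union> Poly_Mapping.keys g"])
  finally show "lin_ext V \<phi> (f \<oplus>\<^bsub>free_space B\<^esub> g) = lin_ext V \<phi> f \<oplus> lin_ext V \<phi> g" by simp
qed

lemma lin_ext_single: "\<phi> b \<in> carrier V \<Longrightarrow> lin_ext V \<phi> (Poly_Mapping.single b s) = s \<odot> \<phi> b"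
  by (subst lin_ext_eq[of "{b}" _ _ "{b}"]) auto

end

subsection \<open>Quotients\<close>

lemma quot_space_simps:
  "carrier (quot_space V N) = {N +>\<^bsub>V\<^esub> x | x. x \<in> carrier V}"
  "\<zero>\<^bsub>quot_space V N\<^esub> = N"
  "C \<oplus>\<^bsub>quot_space V N\<^esub> D = C <+>\<^bsub>V\<^esub> D"
  "C \<otimes>\<^bsub>quot_space V N\<^esub> D = rcoset_mult V N C D"
  "\<one>\<^bsub>quot_space V N\<^esub> = N +>\<^bsub>V\<^esub> \<one>\<^bsub>V\<^esub>"
  "s \<odot>\<^bsub>quot_space V N\<^esub> C = (\<Union>x\<in>C. N +>\<^bsub>V\<^esub> (s \<odot>\<^bsub>V\<^esub> x))"
  by (auto simp: quot_space_def ring.defs module.defs FactRing_def A_RCOSETS_def' )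

text \<open>
  The map induced by \<open>f\<close> on cosets. It is meaningful if \<open>f\<close> is constant on each coset, so that the
  image of a coset is a singleton.
\<close>

definition quot_lift :: "('a \<Rightarrow> 'b) \<Rightarrow> 'a set \<Rightarrow> 'b"
  where "quot_lift f C = the_elem (f ` C)"

locale kquotient = kspace V for V :: "('k::field, 'a, 'm) module_scheme" (structure) +
  fixes N assumes sub: "submodule N scalars V"
begin

abbreviation cls where "cls x \<equiv> N +> x"

sublocale N: abelian_subgroup N V
  by (rule abelian_subgroupI3) (use sub M.abelian_group_axioms in \<open>auto intro!: additive_subgroup.intro simp: submodule_def\<close>)

lemma in_cls_iff: "\<lbrakk>x \<in> carrier V; y \<in> carrier V\<rbrakk> \<Longrightarrow> y \<in> cls x \<longleftrightarrow> y \<ominus> x \<in> N"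
  by (simp add: N.a_rcos_module a_minus_def)

lemma in_clsD: "\<lbrakk>y \<in> cls x; x \<in> carrier V\<rbrakk> \<Longrightarrow> y \<in> carrier V \<and> cls y = cls x"
  using N.a_elemrcos_carrier[OF _ ] M.a_repr_independence[OF _ _ N.a_subgroup, of y x] by auto

text \<open>
  Below, \<open>N\<close> is generated by relations, and an equation in the quotient holds because \<open>x \<ominus> y\<close> is one of
  them.
\<close>

lemma cls_eq_iff:
  assumes "x \<in> carrier V" "y \<in> carrier V"
  shows "cls x = cls y \<longleftrightarrow> x \<ominus> y \<in> N"
proof
  assume "cls x = cls y"
  then have "x \<in> cls y" using N.a_rcos_self[OF assms(1)] by simp
  then show "x \<ominus> y \<in> N" using in_cls_iff[OF assms(2,1)] by simp
next
  assume "x \<ominus> y \<in> N"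
  then have "x \<in> cls y" using in_cls_iff[OF assms(2,1)] by simp
  then show "cls x = cls y" using in_clsD assms by blast
qed

lemma cls_closed: "x \<in> carrier V \<Longrightarrow> cls x \<in> carrier (quot_space V N)"
  by (auto simp: quot_space_simps)

lemma cls_add: "\<lbrakk>x \<in> carrier V; y \<in> carrier V\<rbrakk> \<Longrightarrow> cls x \<oplus>\<^bsub>quot_space V N\<^esub> cls y = cls (x \<oplus> y)"
  by (simp add: quot_space_simps N.a_rcos_sum)

lemma cls_smult: 
  assumes x: "x \<in> carrier V" 
  shows "s \<odot>\<^bsub>quot_space V N\<^esub> cls x = cls (s \<odot> x)"
proof -
  have "cls (s \<odot> y) = cls (s \<odot> x)" if "y \<in> cls x" for y
  proof -
    have y: "y \<in> carrier V" "y \<ominus> x \<in> N"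
      using in_clsD[OF that x] cls_eq_iff[of y x] x by auto
    then have "s \<odot> (y \<ominus> x) \<in> N" using sub submoduleD(4) by blast
    also have "s \<odot> (y \<ominus> x) = s \<odot> y \<ominus> s \<odot> x"
      using x y by (simp add: a_minus_def minus_eq_smult smult_add_right smult_smult mult.commute)
    finally show ?thesis using x y by (simp add: cls_eq_iff)
  qed
  moreover have "x \<in> cls x" using x N.a_rcos_self by blast
  ultimately show ?thesis unfolding quot_space_simps by blast
qed

lemma cls_zero: "\<zero>\<^bsub>quot_space V N\<^esub> = cls \<zero>"
  using N.a_subset by (simp add: quot_space_simps)

lemma quot_cases:
  assumes "C \<in> carrier (quot_space V N)"
  obtains x where "x \<in> carrier V" "C = cls x"
  using assms by (auto simp: quot_space_simps)

lemma quot_kspace: "kspace (quot_space V N)"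
  by (rule kspaceI)
    (auto elim!: quot_cases simp: cls_add cls_smult cls_zero M.a_ac cls_closed
      smult_add_left smult_add_right smult_smult)

lemma quot_lift:
  assumes "kspace W" "linear_map V W f" "\<And>x. x \<in> N \<Longrightarrow> f x = \<zero>\<^bsub>W\<^esub>"
  shows quot_lift_cls: "x \<in> carrier V \<Longrightarrow> quot_lift f (cls x) = f x"
    and quot_lift_linear: "linear_map (quot_space V N) W (quot_lift f)"
proof -
  interpret W: kspace W by fact
  note f = linear_mapD[OF assms(2)]
  show *: "quot_lift f (cls x) = f x" if x: "x \<in> carrier V" for x
  proof -
    have "f y = f x" if "y \<in> cls x" for y
    proof -
      have y: "y \<in> carrier V" "x \<ominus> y \<in> N"
        using in_clsD[OF that x] cls_eq_iff[of x y] x by auto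
      have "f x = f (y \<oplus> (x \<ominus> y))" using x y by (simp add: add_minus_cancel)
      also have "\<dots> = f y" using x y f assms(3) by auto
      finally show ?thesis by simp
    qed
    then have "f ` cls x = {f x}" using x N.a_rcos_self by blast
    then show ?thesis by (simp add: quot_lift_def)
  qed
  show "linear_map (quot_space V N) W (quot_lift f)"
    by (rule linear_mapI) (auto elim!: quot_cases simp: cls_add cls_smult * f)
qed

end

section \<open>Tensor products\<close>

lemma free_space_minus:
  assumes "f \<in> carrier (free_space B)" "g \<in> carrier (free_space B)"
  shows "f \<ominus>\<^bsub>free_space B\<^esub> g = f - (g :: 'b \<Rightarrow>\<^sub>0 'k::field)"
proof -
  interpret F: kspace "free_space B :: ('k, 'b \<Rightarrow>\<^sub>0 'k) module" by (rule free_space_kspace)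
  show ?thesis
    using assms F.minus_eq_smult[OF assms(2)]
    by (intro poly_mapping_eqI) (simp add: a_minus_def lookup_add lookup_minus)
qed

lemma free_space_diff_closed:
  assumes "f \<in> carrier (free_space B)" "g \<in> carrier (free_space B)"
  shows "f - (g :: 'b \<Rightarrow>\<^sub>0 'k::field) \<in> carrier (free_space B)"
  using assms keys_diff[of f g] by auto

lemma linear_map_diff:
  assumes "kspace W" "linear_map (free_space B) W \<phi>"
    and "f \<in> carrier (free_space B)" "g \<in> carrier (free_space B)"
  shows "\<phi> (f - (g :: 'b \<Rightarrow>\<^sub>0 'k::field)) = \<phi> f \<ominus>\<^bsub>W\<^esub> \<phi> g"
proof -
  interpret W: kspace W by fact
  have "f - g = f \<oplus>\<^bsub>free_space B\<^esub> ((-1) \<odot>\<^bsub>free_space B\<^esub> g)"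
    by (rule poly_mapping_eqI) (simp add: lookup_add lookup_minus)
  moreover have "(-1) \<odot>\<^bsub>free_space B\<^esub> g \<in> carrier (free_space B)"
    using kspace.smult_mem[OF free_space_kspace assms(4)] .
  ultimately have "\<phi> (f - g) = \<phi> f \<oplus>\<^bsub>W\<^esub> (-1) \<odot>\<^bsub>W\<^esub> \<phi> g"
    using linear_mapD(2)[OF assms(2,3)] linear_mapD(3)[OF assms(2,4)] by metis
  then show ?thesis
    using linear_mapD(1)[OF assms(2)] assms(3,4) by (simp add: a_minus_def W.minus_eq_smult)
qed

lemma (in kspace) sum_minus_summands:
  assumes "x \<in> carrier V" "y \<in> carrier V"
  shows "(x \<oplus> y) \<ominus> x \<ominus> y = \<zero>"
proof -
  have "(x \<oplus> y) \<ominus> x \<ominus> y = (x \<oplus> y) \<ominus> (x \<oplus> y)"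
    using assms by (simp add: a_minus_def M.minus_add M.a_assoc)
  then show ?thesis using assms by (simp add: a_minus_def M.r_neg)
qed

definition bilinear_map ::
    "('k::field, 'a, 'm) module_scheme \<Rightarrow> ('k, 'b, 'n) module_scheme \<Rightarrow> ('k, 'c, 'l) module_scheme
      \<Rightarrow> ('a \<Rightarrow> 'b \<Rightarrow> 'c) \<Rightarrow> bool"
  where "bilinear_map V W M \<beta> \<longleftrightarrow>
    (\<forall>y\<in>carrier W. linear_map V M (\<lambda>x. \<beta> x y)) \<and> (\<forall>x\<in>carrier V. linear_map W M (\<beta> x))"

lemma bilinear_mapI:
  assumes "\<And>x y. \<lbrakk>x \<in> carrier V; y \<in> carrier W\<rbrakk> \<Longrightarrow> \<beta> x y \<in> carrier M"
    and "\<And>x x' y. \<lbrakk>x \<in> carrier V; x' \<in> carrier V; y \<in> carrier W\<rbrakk> \<Longrightarrow> \<beta> (x \<oplus>\<^bsub>V\<^esub> x') y = \<beta> x y \<oplus>\<^bsub>M\<^esub> \<beta> x' y"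
    and "\<And>x y y'. \<lbrakk>x \<in> carrier V; y \<in> carrier W; y' \<in> carrier W\<rbrakk> \<Longrightarrow> \<beta> x (y \<oplus>\<^bsub>W\<^esub> y') = \<beta> x y \<oplus>\<^bsub>M\<^esub> \<beta> x y'"
    and "\<And>s x y. \<lbrakk>x \<in> carrier V; y \<in> carrier W\<rbrakk> \<Longrightarrow> \<beta> (s \<odot>\<^bsub>V\<^esub> x) y = s \<odot>\<^bsub>M\<^esub> \<beta> x y"
    and "\<And>s x y. \<lbrakk>x \<in> carrier V; y \<in> carrier W\<rbrakk> \<Longrightarrow> \<beta> x (s \<odot>\<^bsub>W\<^esub> y) = s \<odot>\<^bsub>M\<^esub> \<beta> x y"
  shows "bilinear_map V W M \<beta>"
  using assms by (simp add: bilinear_map_def linear_map_def)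

lemma bilinear_mapD:
  assumes "bilinear_map V W M \<beta>"
  shows "\<lbrakk>x \<in> carrier V; y \<in> carrier W\<rbrakk> \<Longrightarrow> \<beta> x y \<in> carrier M"
    and "\<lbrakk>x \<in> carrier V; x' \<in> carrier V; y \<in> carrier W\<rbrakk> \<Longrightarrow> \<beta> (x \<oplus>\<^bsub>V\<^esub> x') y = \<beta> x y \<oplus>\<^bsub>M\<^esub> \<beta> x' y"
    and "\<lbrakk>x \<in> carrier V; y \<in> carrier W; y' \<in> carrier W\<rbrakk> \<Longrightarrow> \<beta> x (y \<oplus>\<^bsub>W\<^esub> y') = \<beta> x y \<oplus>\<^bsub>M\<^esub> \<beta> x y'"
    and "\<lbrakk>x \<in> carrier V; y \<in> carrier W\<rbrakk> \<Longrightarrow> \<beta> (s \<odot>\<^bsub>V\<^esub> x) y = s \<odot>\<^bsub>M\<^esub> \<beta> x y"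
    and "\<lbrakk>x \<in> carrier V; y \<in> carrier W\<rbrakk> \<Longrightarrow> \<beta> x (s \<odot>\<^bsub>W\<^esub> y) = s \<odot>\<^bsub>M\<^esub> \<beta> x y"
  using assms by (auto simp: bilinear_map_def linear_map_def)

definition tensor_lift ::
    "('k::field, 'c, 'l) module_scheme \<Rightarrow> ('a \<Rightarrow> 'b \<Rightarrow> 'c) \<Rightarrow> ('a \<times> 'b \<Rightarrow>\<^sub>0 'k) set \<Rightarrow> 'c"
  where "tensor_lift M \<beta> = quot_lift (lin_ext M (\<lambda>(x, y). \<beta> x y))"

locale ktensor = V: kspace V + W: kspace W
  for V :: "('k::field, 'a, 'm) module_scheme" and W :: "('k, 'b, 'n) module_scheme"
begin

abbreviation "F \<equiv> free_space (carrier V \<times> carrier W) :: ('k, 'a \<times> 'b \<Rightarrow>\<^sub>0 'k) module"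

lemma rels_closed: "tensor_rels V W \<subseteq> carrier F"
proof
  fix r assume "r \<in> tensor_rels V W"
  then show "r \<in> carrier F"
    unfolding tensor_rels_def by (elim UnE CollectE exE conjE) (auto intro!: free_space_diff_closed simp del: free_space_simps simp: free_space_simps(1)[of "Poly_Mapping.single _ _"])
qed

sublocale Q: kquotient F "tensor_null V W"
  unfolding kquotient_def kquotient_axioms_def tensor_null_def
  using free_space_kspace kspace.vspan_submodule[OF free_space_kspace rels_closed] by blast

lemma tensor_space_kspace: "kspace (tensor_space V W)"
  unfolding tensor_space_def by (rule Q.quot_kspace)

lemma pure_eq: "pure_tensor V W x y = Q.cls (Poly_Mapping.single (x, y) 1)"
  by (simp add: pure_tensor_def)

lemma single_closed: "\<lbrakk>x \<in> carrier V; y \<in> carrier W\<rbrakk> \<Longrightarrow> Poly_Mapping.single (x, y) s \<in> carrier F"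
  by simp

lemma pure_closed: "\<lbrakk>x \<in> carrier V; y \<in> carrier W\<rbrakk> \<Longrightarrow> pure_tensor V W x y \<in> carrier (tensor_space V W)"
  unfolding pure_eq tensor_space_def by (rule Q.cls_closed) simp

lemma cls_rel:
  assumes "f - g \<in> tensor_rels V W" "f \<in> carrier F" "g \<in> carrier F"
  shows "Q.cls f = Q.cls g"
  using assms V.vspan_superset kspace.vspan_superset[OF free_space_kspace]
  by (subst Q.cls_eq_iff) (auto simp: free_space_minus tensor_null_def simp del: free_space_simps)

lemma pure_smult_single:
  assumes "x \<in> carrier V" "y \<in> carrier W"
  shows "s \<odot>\<^bsub>tensor_space V W\<^esub> pure_tensor V W x y = Q.cls (Poly_Mapping.single (x, y) s)"
  using Q.cls_smult[of "Poly_Mapping.single (x, y) 1" s] assms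
  by (simp add: pure_eq tensor_space_def)

lemma pure_bilinear: "bilinear_map V W (tensor_space V W) (pure_tensor V W)"
proof -
  note s = single_closed and d = free_space_diff_closed
  have 1: "pure_tensor V W (x \<oplus>\<^bsub>V\<^esub> x') y = pure_tensor V W x y \<oplus>\<^bsub>tensor_space V W\<^esub> pure_tensor V W x' y"
    if "x \<in> carrier V" "x' \<in> carrier V" "y \<in> carrier W" for x x' y
  proof -
    have "Q.cls (Poly_Mapping.single (x \<oplus>\<^bsub>V\<^esub> x', y) 1)
        = Q.cls (Poly_Mapping.single (x, y) 1 \<oplus>\<^bsub>F\<^esub> Poly_Mapping.single (x', y) 1)"
      by (rule cls_rel; (rule s Q.M.a_closed)?)
        (use that in \<open>auto simp: tensor_rels_def diff_diff_eq[symmetric] intro!: s\<close>)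
    then show ?thesis using that s by (simp add: pure_eq tensor_space_def Q.cls_add)
  qed
  have 2: "pure_tensor V W x (y \<oplus>\<^bsub>W\<^esub> y') = pure_tensor V W x y \<oplus>\<^bsub>tensor_space V W\<^esub> pure_tensor V W x y'"
    if "x \<in> carrier V" "y' \<in> carrier W" "y \<in> carrier W" for x y y'
  proof -
    have "Q.cls (Poly_Mapping.single (x, y \<oplus>\<^bsub>W\<^esub> y') 1)
        = Q.cls (Poly_Mapping.single (x, y) 1 \<oplus>\<^bsub>F\<^esub> Poly_Mapping.single (x, y') 1)"
      by (rule cls_rel; (rule s Q.M.a_closed)?)
        (use that in \<open>auto simp: tensor_rels_def diff_diff_eq[symmetric] intro!: s\<close>)
    then show ?thesis using that s by (simp add: pure_eq tensor_space_def Q.cls_add)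
  qed
  have 3: "pure_tensor V W (t \<odot>\<^bsub>V\<^esub> x) y = t \<odot>\<^bsub>tensor_space V W\<^esub> pure_tensor V W x y"
    if "x \<in> carrier V" "y \<in> carrier W" for x y t
    unfolding pure_smult_single[OF that] unfolding pure_eq
    by (rule cls_rel) (use that in \<open>auto simp: tensor_rels_def intro!: s\<close>)
  have 4: "pure_tensor V W x (t \<odot>\<^bsub>W\<^esub> y) = t \<odot>\<^bsub>tensor_space V W\<^esub> pure_tensor V W x y"
    if "x \<in> carrier V" "y \<in> carrier W" for x y t
    unfolding pure_smult_single[OF that] unfolding pure_eq
    by (rule cls_rel) (use that in \<open>auto simp: tensor_rels_def intro!: s\<close>)
  show ?thesis
    unfolding bilinear_map_def linear_map_def using 1 2 3 4 pure_closed by simp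
qed

text \<open>
  A multiple of a pure tensor is again pure, so the sums of pure tensors exhaust the space.
\<close>

lemma tensor_induct [consumes 1, case_names pure add]:
  assumes "t \<in> carrier (tensor_space V W)"
    and pure: "\<And>x y. \<lbrakk>x \<in> carrier V; y \<in> carrier W\<rbrakk> \<Longrightarrow> P (pure_tensor V W x y)"
    and add: "\<And>t t'. \<lbrakk>t \<in> carrier (tensor_space V W); t' \<in> carrier (tensor_space V W); P t; P t'\<rbrakk>
      \<Longrightarrow> P (t \<oplus>\<^bsub>tensor_space V W\<^esub> t')"
  shows "P t"
proof -
  obtain f where f: "f \<in> carrier F" "t = Q.cls f"
    using assms(1) Q.quot_cases unfolding tensor_space_def by blast
  have "P (Q.cls f)" using f(1)
  proof (induction rule: free_space_induct)
    case (single b s)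
    obtain x y where b: "b = (x, y)" "x \<in> carrier V" "y \<in> carrier W" using single by auto
    have "Q.cls (Poly_Mapping.single b s) = pure_tensor V W (s \<odot>\<^bsub>V\<^esub> x) y"
      using pure_bilinear b linear_mapD(3) unfolding b(1) pure_smult_single[OF b(2,3), symmetric] bilinear_map_def
      by fastforce
    then show ?case using pure b by auto
  next
    case (add f g)
    then show ?case
      using assms(3)[of "Q.cls f" "Q.cls g"] Q.cls_closed Q.cls_add[of f g] by (simp add: tensor_space_def)
  next
    case zero
    have "Q.cls 0 = pure_tensor V W (0 \<odot>\<^bsub>V\<^esub> \<zero>\<^bsub>V\<^esub>) \<zero>\<^bsub>W\<^esub>"
      using pure_smult_single[of "\<zero>\<^bsub>V\<^esub>" "\<zero>\<^bsub>W\<^esub>" 0] pure_bilinear linear_mapD(3)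
      unfolding bilinear_map_def by fastforce
    then show ?case using pure by auto
  qed
  then show ?thesis using f by simp
qed

text \<open>
  The universal property. The linear extension of \<open>\<beta>\<close> to the free space kills each of the four
  families of relations because \<open>\<beta>\<close> is additive and homogeneous in each argument, so it descends to the
  quotient.
\<close>

lemma tensor_lift:
  assumes M: "kspace M" and \<beta>: "bilinear_map V W M \<beta>"
  shows tensor_lift_pure: "\<lbrakk>x \<in> carrier V; y \<in> carrier W\<rbrakk>
      \<Longrightarrow> tensor_lift M \<beta> (pure_tensor V W x y) = \<beta> x y"
    and tensor_lift_linear: "linear_map (tensor_space V W) M (tensor_lift M \<beta>)"
proof -
  interpret M: kspace M by fact
  let ?f = "lin_ext M (\<lambda>(x, y). \<beta> x y)"
  have bx: "linear_map V M (\<lambda>x. \<beta> x y)" if "y \<in> carrier W" for y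
    using \<beta> that by (simp add: bilinear_map_def)
  have bY: "linear_map W M (\<beta> x)" if "x \<in> carrier V" for x
    using \<beta> that by (simp add: bilinear_map_def)
  note b = linear_mapD[OF bx] linear_mapD[OF bY]
  have lin: "linear_map F M ?f"
    by (rule M.lin_ext_linear) (auto simp: b)
  have single: "?f (Poly_Mapping.single (x, y) s) = s \<odot>\<^bsub>M\<^esub> \<beta> x y" if "x \<in> carrier V" "y \<in> carrier W" for x y s
    using M.lin_ext_single[of "\<lambda>(x, y). \<beta> x y" "(x, y)" s] that b by simp
  note diff = linear_map_diff[OF M lin]
  have "tensor_rels V W \<subseteq> {r \<in> carrier F. ?f r = \<zero>\<^bsub>M\<^esub>}"
  proof
    fix r assume r: "r \<in> tensor_rels V W"
    have "?f r = \<zero>\<^bsub>M\<^esub>"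
      using r unfolding tensor_rels_def
      by (elim UnE CollectE exE conjE)
        (simp_all add: diff single b single_closed free_space_diff_closed M.sum_minus_summands
          M.M.r_neg[folded a_minus_def] del: free_space_simps)
    with r rels_closed show "r \<in> {r \<in> carrier F. ?f r = \<zero>\<^bsub>M\<^esub>}" by blast
  qed
  then have "tensor_null V W \<subseteq> {r \<in> carrier F. ?f r = \<zero>\<^bsub>M\<^esub>}"
    unfolding tensor_null_def
    by (rule Q.vspan_least[OF linear_map_kernel[OF free_space_kspace M lin]])
  then have null: "?f r = \<zero>\<^bsub>M\<^esub>" if "r \<in> tensor_null V W" for r using that by blast
  show "linear_map (tensor_space V W) M (tensor_lift M \<beta>)"
    unfolding tensor_lift_def tensor_space_def by (rule Q.quot_lift_linear[OF M lin null])
  show "tensor_lift M \<beta> (pure_tensor V W x y) = \<beta> x y" if "x \<in> carrier V" "y \<in> carrier W"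
    unfolding tensor_lift_def pure_eq
    using Q.quot_lift_cls[OF M lin null, of "Poly_Mapping.single (x, y) 1"] that single b by simp
qed

end

text \<open>
  If the bilinear map depends linearly on a parameter \<open>w\<close>, so does the induced map, since this can be
  checked on pure tensors. Right multiplication by \<open>U\<close> and the product of opposite components are of this
  form.
\<close>

lemma (in ktensor) tensor_lift_bilinear:
  assumes N: "kspace N" and M: "kspace M"
    and \<beta>: "\<And>w. w \<in> carrier N \<Longrightarrow> bilinear_map V W M (\<beta> w)"
    and lin: "\<And>x y. \<lbrakk>x \<in> carrier V; y \<in> carrier W\<rbrakk> \<Longrightarrow> linear_map N M (\<lambda>w. \<beta> w x y)"
  shows "bilinear_map (tensor_space V W) N M (\<lambda>t w. tensor_lift M (\<beta> w) t)"
proof -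
  interpret N: kspace N by fact
  interpret M: kspace M by fact
  interpret T: kspace "tensor_space V W" by (rule tensor_space_kspace)
  note l = linear_mapD[OF tensor_lift_linear[OF M \<beta>]]
  note p = tensor_lift_pure[OF M \<beta>]
  have "linear_map N M (\<lambda>w. tensor_lift M (\<beta> w) t)" if "t \<in> carrier (tensor_space V W)" for t
    using that
  proof (induction rule: tensor_induct)
    case (pure x y)
    then show ?case by (intro linear_mapI) (simp_all add: p linear_mapD[OF lin])
  next
    case (add t t')
    note h = linear_mapD[OF add(3)] linear_mapD[OF add(4)]
    show ?case
      by (rule linear_mapI) (use add in \<open>simp_all add: l h M.M.a_ac M.smult_add_right\<close>)
  qed
  then show ?thesis
    using tensor_lift_linear[OF M \<beta>] by (simp add: bilinear_map_def)
qed

section \<open>Associative algebras\<close>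

text \<open>
  For records that differ in their multiplicative fields.
\<close>

lemma kspace_transfer:
  assumes "kspace V" "carrier V' = carrier V" "ring.add V' = ring.add V"
    "ring.zero V' = ring.zero V" "module.smult V' = module.smult V"
  shows "kspace V'"
proof -
  interpret V: kspace V by fact
  show ?thesis
    by (rule kspaceI) (auto simp: assms V.M.a_ac V.smult_add_left V.smult_add_right V.smult_smult)
qed

locale kalgebra = kspace A + ring A for A :: "('k::field, 'a, 'm) module_scheme" (structure) +
  assumes smult_mult_left: "\<lbrakk>x \<in> carrier A; y \<in> carrier A\<rbrakk> \<Longrightarrow> (s \<odot> x) \<otimes> y = s \<odot> (x \<otimes> y)"
    and smult_mult_right: "\<lbrakk>x \<in> carrier A; y \<in> carrier A\<rbrakk> \<Longrightarrow> x \<otimes> (s \<odot> y) = s \<odot> (x \<otimes> y)"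

lemma kalgebraI:
  fixes A :: "('k::field, 'a, 'm) module_scheme" (structure)
  assumes "kspace A"
    and "\<And>x y. \<lbrakk>x \<in> carrier A; y \<in> carrier A\<rbrakk> \<Longrightarrow> x \<otimes> y \<in> carrier A"
    and "\<one> \<in> carrier A"
    and "\<And>x y z. \<lbrakk>x \<in> carrier A; y \<in> carrier A; z \<in> carrier A\<rbrakk> \<Longrightarrow> (x \<otimes> y) \<otimes> z = x \<otimes> (y \<otimes> z)"
    and "\<And>x. x \<in> carrier A \<Longrightarrow> \<one> \<otimes> x = x"
    and "\<And>x. x \<in> carrier A \<Longrightarrow> x \<otimes> \<one> = x"
    and "\<And>x y z. \<lbrakk>x \<in> carrier A; y \<in> carrier A; z \<in> carrier A\<rbrakk> \<Longrightarrow> (x \<oplus> y) \<otimes> z = x \<otimes> z \<oplus> y \<otimes> z"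
    and "\<And>x y z. \<lbrakk>x \<in> carrier A; y \<in> carrier A; z \<in> carrier A\<rbrakk> \<Longrightarrow> z \<otimes> (x \<oplus> y) = z \<otimes> x \<oplus> z \<otimes> y"
    and "\<And>s x y. \<lbrakk>x \<in> carrier A; y \<in> carrier A\<rbrakk> \<Longrightarrow> (s \<odot> x) \<otimes> y = s \<odot> (x \<otimes> y)"
    and "\<And>s x y. \<lbrakk>x \<in> carrier A; y \<in> carrier A\<rbrakk> \<Longrightarrow> x \<otimes> (s \<odot> y) = s \<odot> (x \<otimes> y)"
  shows "kalgebra A"
proof -
  interpret kspace A by fact
  have "monoid A" by (rule monoidI) (use assms in auto)
  then have "ring A" by (intro ringI) (use assms M.abelian_group_axioms in auto)
  then show ?thesis
    by (intro kalgebra.intro kalgebra_axioms.intro) (use assms in auto)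
qed

lemma (in kalgebra) ideal_submodule:
  assumes "ideal I A"
  shows "submodule I scalars A"
proof -
  interpret I: ideal I A by fact
  have "s \<odot> x \<in> I" if "x \<in> I" for s x
    using I.I_l_closed[OF that, of "s \<odot> \<one>"] smult_mult_left[of \<one> x s] I.Icarr[OF that] by simp
  then show ?thesis
    using I.a_subset by (intro submoduleI') (auto simp: I.a_closed)
qed

lemma (in kalgebra) quot_kalgebra:
  assumes "ideal I A"
  shows "kalgebra (quot_space A I)"
    and "\<lbrakk>x \<in> carrier A; y \<in> carrier A\<rbrakk> \<Longrightarrow> (I +> x) \<otimes>\<^bsub>quot_space A I\<^esub> (I +> y) = I +> (x \<otimes> y)"
proof -
  interpret I: ideal I A by fact
  interpret Q: kquotient A I
    by (intro kquotient.intro kquotient_axioms.intro ideal_submodule assms kspace_axioms)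
  show mult: "(I +> x) \<otimes>\<^bsub>quot_space A I\<^esub> (I +> y) = I +> (x \<otimes> y)"
    if "x \<in> carrier A" "y \<in> carrier A" for x y
    using I.rcoset_mult_add[OF that] by (simp add: quot_space_simps)
  have one: "\<one>\<^bsub>quot_space A I\<^esub> = I +> \<one>" by (simp add: quot_space_simps)
  show "kalgebra (quot_space A I)"
    by (rule kalgebraI[OF Q.quot_kspace])
      (auto elim!: Q.quot_cases simp: mult one Q.cls_add Q.cls_smult Q.cls_closed m_assoc l_distr
        r_distr smult_mult_left smult_mult_right)
qed

subsection \<open>The free algebra\<close>

lemma free_algebra_simps:
  "carrier (free_algebra B) = carrier (free_space (lists B))"
  "f \<oplus>\<^bsub>free_algebra B\<^esub> g = f + g"
  "\<zero>\<^bsub>free_algebra B\<^esub> = 0"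
  "s \<odot>\<^bsub>free_algebra B\<^esub> f = Poly_Mapping.map ((*) s) f"
  "\<one>\<^bsub>free_algebra B\<^esub> = Poly_Mapping.single [] 1"
  by (auto simp: free_algebra_def)

text \<open>
  Summation over arbitrary finite supersets of the supports makes it possible to compare products of
  different elements over the same index sets.
\<close>

lemma free_algebra_mult:
  assumes "Poly_Mapping.keys f \<subseteq> V" "Poly_Mapping.keys g \<subseteq> W" "finite V" "finite W"
  shows "f \<otimes>\<^bsub>free_algebra B\<^esub> (g :: 'x list \<Rightarrow>\<^sub>0 'k::field) = (\<Sum>v\<in>V. \<Sum>w\<in>W.
    Poly_Mapping.single (v @ w) (Poly_Mapping.lookup f v * Poly_Mapping.lookup g w))"
proof -
  have "f \<otimes>\<^bsub>free_algebra B\<^esub> g = (\<Sum>v\<in>Poly_Mapping.keys f. \<Sum>w\<in>Poly_Mapping.keys g.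
    Poly_Mapping.single (v @ w) (Poly_Mapping.lookup f v * Poly_Mapping.lookup g w))"
    by (simp add: free_algebra_def)
  also have "\<dots> = (\<Sum>v\<in>Poly_Mapping.keys f. \<Sum>w\<in>W.
    Poly_Mapping.single (v @ w) (Poly_Mapping.lookup f v * Poly_Mapping.lookup g w))"
    by (intro sum.cong sum.mono_neutral_left refl) (use assms in \<open>auto simp: in_keys_iff\<close>)
  also have "\<dots> = (\<Sum>v\<in>V. \<Sum>w\<in>W.
    Poly_Mapping.single (v @ w) (Poly_Mapping.lookup f v * Poly_Mapping.lookup g w))"
    by (intro sum.mono_neutral_left) (use assms in \<open>auto simp: in_keys_iff\<close>)
  finally show ?thesis .
qed

lemma free_algebra_mult_single:
  "Poly_Mapping.single v s \<otimes>\<^bsub>free_algebra B\<^esub> Poly_Mapping.single w (t :: 'k::field)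
    = Poly_Mapping.single (v @ w) (s * t)"
  by (subst free_algebra_mult[of _ "{v}" _ "{w}"]) auto

lemma free_algebra_distrib:
  fixes f g h :: "'x list \<Rightarrow>\<^sub>0 'k::field"
  shows "(f + g) \<otimes>\<^bsub>free_algebra B\<^esub> h = f \<otimes>\<^bsub>free_algebra B\<^esub> h + g \<otimes>\<^bsub>free_algebra B\<^esub> h"
    and "h \<otimes>\<^bsub>free_algebra B\<^esub> (f + g) = h \<otimes>\<^bsub>free_algebra B\<^esub> f + h \<otimes>\<^bsub>free_algebra B\<^esub> g"
proof -
  let ?K = "Poly_Mapping.keys f \<union> Poly_Mapping.keys g" and ?H = "Poly_Mapping.keys h"
  have K: "Poly_Mapping.keys (f + g) \<subseteq> ?K" by (rule keys_add)
  show "(f + g) \<otimes>\<^bsub>free_algebra B\<^esub> h = f \<otimes>\<^bsub>free_algebra B\<^esub> h + g \<otimes>\<^bsub>free_algebra B\<^esub> h"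
    using K by (simp add: free_algebra_mult[where V = ?K and W = ?H] lookup_add distrib_right single_add sum.distrib)
  show "h \<otimes>\<^bsub>free_algebra B\<^esub> (f + g) = h \<otimes>\<^bsub>free_algebra B\<^esub> f + h \<otimes>\<^bsub>free_algebra B\<^esub> g"
    using K by (simp add: free_algebra_mult[where V = ?H and W = ?K] lookup_add distrib_left single_add sum.distrib)
qed

lemma free_algebra_mult_0 [simp]:
  "0 \<otimes>\<^bsub>free_algebra B\<^esub> f = 0" "f \<otimes>\<^bsub>free_algebra B\<^esub> 0 = (0 :: 'x list \<Rightarrow>\<^sub>0 'k::field)"
  by (simp_all add: free_algebra_def)

lemma free_algebra_mult_closed:
  assumes "f \<in> carrier (free_space (lists B))" "g \<in> carrier (free_space (lists B))"
  shows "f \<otimes>\<^bsub>free_algebra B\<^esub> (g :: 'x list \<Rightarrow>\<^sub>0 'k::field) \<in> carrier (free_space (lists B))"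
proof -
  interpret F: kspace "free_space (lists B) :: ('k, 'x list \<Rightarrow>\<^sub>0 'k) module" by (rule free_space_kspace)
  note closed = F.M.a_closed[unfolded free_space_simps(3)]
  from assms(1) show ?thesis
  proof (induction rule: free_space_induct)
    case (single v s)
    from assms(2) show ?case
    proof (induction rule: free_space_induct)
      case (single w t) then show ?case using \<open>v \<in> lists B\<close> by (simp add: free_algebra_mult_single)
    next
      case (add f g) then show ?case by (simp only: free_algebra_distrib closed)
    qed simp
  next
    case (add f g) then show ?case by (simp only: free_algebra_distrib closed)
  qed simp
qed

lemma free_algebra_kalgebra: "kalgebra (free_algebra B :: ('k::field, 'x list \<Rightarrow>\<^sub>0 'k) module)"
proof -
  let ?A = "free_algebra B :: ('k, 'x list \<Rightarrow>\<^sub>0 'k) module"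
  let ?F = "free_space (lists B) :: ('k, 'x list \<Rightarrow>\<^sub>0 'k) module"
  let ?m = "\<lambda>s. Poly_Mapping.map ((*) s) :: ('x list \<Rightarrow>\<^sub>0 'k) \<Rightarrow> ('x list \<Rightarrow>\<^sub>0 'k)"
  interpret F: kspace ?F by (rule free_space_kspace)
  note mult_closed = free_algebra_mult_closed
  have madd: "?m s (f + g) = ?m s f + ?m s g" for s f g
    by (rule poly_mapping_eqI) (simp add: lookup_add distrib_left)
  have m0: "?m s 0 = 0" for s by (rule poly_mapping_eqI) simp
  have assoc: "(f \<otimes>\<^bsub>?A\<^esub> g) \<otimes>\<^bsub>?A\<^esub> h = f \<otimes>\<^bsub>?A\<^esub> (g \<otimes>\<^bsub>?A\<^esub> h)"
    if "f \<in> carrier ?F" "g \<in> carrier ?F" "h \<in> carrier ?F" for f g h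
    using that(1)
  proof (induction rule: free_space_induct)
    case (single v s)
    from that(2) show ?case
    proof (induction rule: free_space_induct)
      case (single w t)
      from that(3) show ?case
        by (induction rule: free_space_induct) (simp_all add: free_algebra_mult_single mult.assoc free_algebra_distrib)
    qed (simp_all add: free_algebra_distrib)
  qed (simp_all add: free_algebra_distrib)
  have sl: "?m s f \<otimes>\<^bsub>?A\<^esub> g = ?m s (f \<otimes>\<^bsub>?A\<^esub> g)" "f \<otimes>\<^bsub>?A\<^esub> ?m s g = ?m s (f \<otimes>\<^bsub>?A\<^esub> g)"
    if "f \<in> carrier ?F" "g \<in> carrier ?F" for f g s
    using that(1)
  proof (induction rule: free_space_induct)
    case (single v t)
    {
      case 1 from that(2) show ?case
        by (induction rule: free_space_induct) (simp_all add: free_algebra_mult_single mult.assoc free_algebra_distrib madd m0)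
    next
      case 2 from that(2) show ?case
        by (induction rule: free_space_induct) (simp_all add: free_algebra_mult_single mult.left_commute free_algebra_distrib madd m0)
    }
  qed (simp_all add: free_algebra_distrib madd m0)
  have one: "Poly_Mapping.single [] 1 \<otimes>\<^bsub>?A\<^esub> f = f" "f \<otimes>\<^bsub>?A\<^esub> Poly_Mapping.single [] 1 = f"
    if "f \<in> carrier ?F" for f
    using that by (induction rule: free_space_induct)
      (simp_all add: free_algebra_mult_single free_algebra_distrib)
  show ?thesis
  proof (rule kalgebraI)
    show "kspace ?A" by (rule kspace_transfer[OF free_space_kspace]) (auto simp: free_algebra_def)
  qed (simp_all only: free_algebra_simps mult_closed assoc sl one free_algebra_distrib, simp)
qed

section \<open>Local Lie superalgebras\<close>

text \<open>
  Sums and products of parities are kept as ring expressions, to be expanded by distributivity in the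
  exponents of signs.
\<close>

declare add_bit_eq_xor [simp del] mult_bit_eq_and [simp del]

lemma bit_1_plus_1 [simp]: "1 + 1 = (0::bit)"
  by (simp add: add_bit_eq_xor)

lemma bit_exhaust: "(p::bit) = 0 \<or> p = 1"
  by (cases p) auto

lemma UNIV_bit': "(UNIV :: bit set) = {0, 1}"
  using bit_exhaust by auto

lemma parity_sign_simps [simp]:
  "parity_sign 0 = 1" "parity_sign 1 = - 1" "parity_sign p * parity_sign p = 1"
  "parity_sign p * (parity_sign p * s) = s"
  by (auto simp: parity_sign_def)

lemma parity_sign_add: "parity_sign (p + q) = parity_sign p * parity_sign q"
  using bit_exhaust[of p] bit_exhaust[of q] by (auto simp: parity_sign_def)

locale local_Lie = local_Lie_superalgebra G
  for G :: "('k::field, 'g, 'm) local_superalgebra_scheme" (structure)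
begin

lemma local_degs_simps [simp]: "0 \<in> local_degs" "1 \<in> local_degs" "-1 \<in> local_degs"
  by (auto simp: local_degs_def)

lemma deg_submodule: "i \<in> local_degs \<Longrightarrow> submodule (deg G i) scalars G"
  using Z_grading by (simp add: is_direct_sum_def)

lemma par_submodule: "submodule (par G p) scalars G"
  using Z2_grading by (simp add: is_direct_sum_def)

lemmas deg_closed = submoduleD[OF deg_submodule]
lemmas par_closed = submoduleD[OF par_submodule]

lemma deg_carrier: "\<lbrakk>x \<in> deg G i; i \<in> local_degs\<rbrakk> \<Longrightarrow> x \<in> carrier G"
  using deg_closed(1) by blast

lemma deg_simps [simp]: "\<lbrakk>x \<in> deg G 0\<rbrakk> \<Longrightarrow> x \<in> carrier G"
  "x \<in> deg G 1 \<Longrightarrow> x \<in> carrier G"   "x \<in> deg G (-1) \<Longrightarrow> x \<in> carrier G"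
  using deg_carrier by auto

lemma bracket_closed:
  "\<lbrakk>z \<in> deg G 0; y \<in> deg G i; i \<in> local_degs\<rbrakk> \<Longrightarrow> z \<otimes> y \<in> deg G i"
  "\<lbrakk>z \<in> deg G 0; y \<in> deg G i; i \<in> local_degs\<rbrakk> \<Longrightarrow> y \<otimes> z \<in> deg G i"
  "\<lbrakk>x \<in> deg G i; y \<in> deg G (-i); i \<in> local_degs\<rbrakk> \<Longrightarrow> x \<otimes> y \<in> deg G 0"
  using mult_deg[of 0 i z y] mult_deg[of i 0 y z] mult_deg[of i "-i" x y] by (auto simp: local_degs_def)

subsection \<open>The parity decomposition\<close>

text \<open>
  The homogeneous components. They are needed because the tensor product is built from all elements of
  \<open>deg G i\<close>, whereas the sign rules are stated for homogeneous ones.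
\<close>

definition part :: "bit \<Rightarrow> 'g \<Rightarrow> 'g"
  where "part p x = (THE f. f \<in> (\<Pi>\<^sub>E p\<in>UNIV. par G p) \<and> x = finsum G f UNIV) p"

lemma finsum_bit:
  assumes "f (0::bit) \<in> carrier G" "f 1 \<in> carrier G"
  shows "finsum G f UNIV = f 0 \<oplus> f 1"
  using assms by (simp add: UNIV_bit')

lemma part_props:
  assumes "x \<in> carrier G"
  shows "part p x \<in> par G p" "part 0 x \<oplus> part 1 x = x"
proof -
  let ?f = "THE f. f \<in> (\<Pi>\<^sub>E p\<in>UNIV. par G p) \<and> x = finsum G f UNIV"
  have "\<exists>!f. f \<in> (\<Pi>\<^sub>E p\<in>UNIV. par G p) \<and> x = finsum G f UNIV"
    using Z2_grading assms by (simp add: is_direct_sum_def)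
  from theI'[OF this] have f: "?f \<in> (\<Pi>\<^sub>E p\<in>UNIV. par G p)" "x = finsum G ?f UNIV" by auto
  then have p: "?f p \<in> par G p" for p by auto
  then show "part p x \<in> par G p" by (simp add: part_def)
  have "?f p \<in> carrier G" for p using p[of p] par_closed(1)[of p] by blast
  then show "part 0 x \<oplus> part 1 x = x" using f(2) finsum_bit[of ?f] by (simp add: part_def)
qed

lemma part_unique:
  assumes "x \<in> par G 0" "y \<in> par G 1"
  shows "part 0 (x \<oplus> y) = x" "part 1 (x \<oplus> y) = y"
proof -
  let ?P = "\<lambda>f. f \<in> (\<Pi>\<^sub>E p\<in>UNIV. par G p) \<and> x \<oplus> y = finsum G f UNIV"
  let ?g = "\<lambda>p::bit. if p = 0 then x else y"
  have c: "x \<in> carrier G" "y \<in> carrier G" using assms par_closed(1) by blast+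
  have "\<exists>!f. ?P f"
    using Z2_grading c by (simp add: is_direct_sum_def)
  moreover have "?P ?g" using assms c finsum_bit[of ?g] by (auto dest: bit_exhaust[THEN disjE])
  ultimately have "The ?P = ?g" by (rule the1_equality[of ?P])
  then show "part 0 (x \<oplus> y) = x" "part 1 (x \<oplus> y) = y" by (simp_all add: part_def)
qed

lemma part_carrier: "x \<in> carrier G \<Longrightarrow> part p x \<in> carrier G"
  using part_props par_closed(1) by blast

lemma part_linear: "linear_map G G (part p)"
proof (rule linear_mapI)
  fix x y s assume x: "x \<in> carrier G" 
  then show "part p x \<in> carrier G" by (rule part_carrier)
  have "s \<odot> x = s \<odot> part 0 x \<oplus> s \<odot> part 1 x"
    using x part_props(2)[OF x] part_carrier[OF x] smult_add_right[of "part 0 x" "part 1 x" s] by simp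
  then have "part 0 (s \<odot> x) = s \<odot> part 0 x \<and> part 1 (s \<odot> x) = s \<odot> part 1 x"
    using x part_unique[of "s \<odot> part 0 x" "s \<odot> part 1 x"] by (simp add: part_props par_closed)
  then show "part p (s \<odot> x) = s \<odot> part p x" using bit_exhaust[of p] by auto
  assume y: "y \<in> carrier G"
  have "x \<oplus> y = (part 0 x \<oplus> part 1 x) \<oplus> (part 0 y \<oplus> part 1 y)"
    using x y by (simp add: part_props(2))
  also have "\<dots> = (part 0 x \<oplus> part 0 y) \<oplus> (part 1 x \<oplus> part 1 y)"
    using x y by (simp add: part_carrier M.a_ac)
  finally have "part 0 (x \<oplus> y) = part 0 x \<oplus> part 0 y \<and> part 1 (x \<oplus> y) = part 1 x \<oplus> part 1 y"
    using x y part_unique[of "part 0 x \<oplus> part 0 y" "part 1 x \<oplus> part 1 y"] by (simp add: part_props par_closed)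
  then show "part p (x \<oplus> y) = part p x \<oplus> part p y" using bit_exhaust[of p] by auto
qed

lemma part_homogeneous: "x \<in> par G p \<Longrightarrow> part q x = (if q = p then x else \<zero>)"
proof -
  assume x: "x \<in> par G p"
  have c: "x \<in> carrier G" using x par_closed(1) by blast
  show ?thesis
    using bit_exhaust[of p] bit_exhaust[of q] part_unique[of x \<zero>] part_unique[of \<zero> x] x c
    by (auto simp: par_closed)
qed

lemma part_deg: "\<lbrakk>i \<in> local_degs; x \<in> deg G i\<rbrakk> \<Longrightarrow> part p x \<in> deg G i"
  using gradings_compatible[of i x] part_unique bit_exhaust[of p] by auto

lemma part_deg_par: "\<lbrakk>i \<in> local_degs; x \<in> deg G i\<rbrakk> \<Longrightarrow> part p x \<in> deg G i \<inter> par G p"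
  using part_deg part_props(1) deg_carrier by blast

lemma homogeneous_cases [consumes 2]:
  assumes "i \<in> local_degs" "x \<in> deg G i"
  obtains y z where "y \<in> deg G i \<inter> par G 0" "z \<in> deg G i \<inter> par G 1" "x = y \<oplus> z"
  using part_deg_par[OF assms] part_props(2)[of x] deg_carrier assms by metis

text \<open>
  The linear extension to all \<open>x\<close> of the rule \<open>(-1)^(rx) x\<close> for homogeneous \<open>x\<close>; see
  \<open>twist_homogeneous\<close>.
\<close>

definition twist :: "bit \<Rightarrow> 'g \<Rightarrow> 'g"
  where "twist r x = part 0 x \<oplus> parity_sign r \<odot> part 1 x"

lemma twist_linear: "linear_map G G (twist r)"
  by (rule linear_mapI)
    (auto simp: twist_def linear_mapD[OF part_linear] smult_add_right smult_smult M.a_ac mult.commute)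

lemma twist_homogeneous: 
  assumes "x \<in> par G p"
  shows "twist r x = parity_sign (p * r) \<odot> x"
proof -
  have c: "x \<in> carrier G" using assms par_closed(1) by blast
  show ?thesis
    using bit_exhaust[of p] bit_exhaust[of r] assms c by (auto simp: twist_def part_homogeneous)
qed

lemma twist_deg: "\<lbrakk>i \<in> local_degs; x \<in> deg G i\<rbrakk> \<Longrightarrow> twist r x \<in> deg G i"
  by (simp add: twist_def part_deg deg_closed)

section \<open>The enveloping algebra\<close>

abbreviation "FA \<equiv> free_algebra (deg G 0) :: ('k, 'g list \<Rightarrow>\<^sub>0 'k) module"
abbreviation "U \<equiv> env_alg G"
abbreviation "\<iota> \<equiv> env_incl G"
abbreviation "word w s \<equiv> Poly_Mapping.single w (s::'k)"

sublocale FA: kalgebra FA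
  by (rule free_algebra_kalgebra)

lemma word_closed: "w \<in> lists (deg G 0) \<Longrightarrow> word w s \<in> carrier FA"
  by (simp add: free_algebra_simps)

lemma FA_diff:
  assumes "f \<in> carrier FA" "g \<in> carrier FA"
  shows "f - g \<in> carrier FA" "f - g = f \<ominus>\<^bsub>FA\<^esub> g"
proof -
  show "f - g \<in> carrier FA" using assms free_space_diff_closed by (simp only: free_algebra_simps)
  show "f - g = f \<ominus>\<^bsub>FA\<^esub> g"
    using FA.minus_eq_smult[OF assms(2)]
    by (intro poly_mapping_eqI) (simp add: a_minus_def free_algebra_simps lookup_add lookup_minus)
qed

lemma env_rels_closed: "env_rels G \<subseteq> carrier FA"
proof
  fix r assume "r \<in> env_rels G"
  then show "r \<in> carrier FA"
    unfolding env_rels_def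
    by (elim UnE CollectE exE conjE)
      (auto intro!: FA_diff word_closed simp: deg_closed bracket_closed)
qed

lemma env_ideal: "ideal (env_ideal G) FA"
  unfolding env_ideal_def by (rule FA.genideal_ideal[OF env_rels_closed])

sublocale EQ: kquotient FA "env_ideal G"
  by (intro kquotient.intro kquotient_axioms.intro FA.ideal_submodule env_ideal FA.kspace_axioms)

sublocale U: kalgebra U
  unfolding env_alg_def by (rule FA.quot_kalgebra[OF env_ideal])

lemma U_cases:
  assumes "u \<in> carrier U"
  obtains f where "f \<in> carrier FA" "u = EQ.cls f"
  using assms EQ.quot_cases unfolding env_alg_def by blast

lemma cls_U:
  "f \<in> carrier FA \<Longrightarrow> EQ.cls f \<in> carrier U"
  "\<lbrakk>f \<in> carrier FA; g \<in> carrier FA\<rbrakk> \<Longrightarrow> EQ.cls f \<otimes>\<^bsub>U\<^esub> EQ.cls g = EQ.cls (f \<otimes>\<^bsub>FA\<^esub> g)"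
  "\<lbrakk>f \<in> carrier FA; g \<in> carrier FA\<rbrakk> \<Longrightarrow> EQ.cls f \<oplus>\<^bsub>U\<^esub> EQ.cls g = EQ.cls (f \<oplus>\<^bsub>FA\<^esub> g)"
  "f \<in> carrier FA \<Longrightarrow> s \<odot>\<^bsub>U\<^esub> EQ.cls f = EQ.cls (s \<odot>\<^bsub>FA\<^esub> f)"
  "\<one>\<^bsub>U\<^esub> = EQ.cls (word [] 1)"
  unfolding env_alg_def
  using EQ.cls_closed FA.quot_kalgebra(2)[OF env_ideal] EQ.cls_add EQ.cls_smult
  by (auto simp: quot_space_simps free_algebra_simps)

lemma cls_rel:
  assumes "f - g \<in> env_rels G" "f \<in> carrier FA" "g \<in> carrier FA"
  shows "EQ.cls f = EQ.cls g"
  using assms FA.genideal_self[OF env_rels_closed] FA_diff(2)[OF assms(2,3)]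
  by (subst EQ.cls_eq_iff) (auto simp: env_ideal_def)

lemma incl_eq: "\<iota> x = EQ.cls (word [x] 1)"
  by (simp add: env_incl_def)

lemma incl_closed [simp]: "x \<in> deg G 0 \<Longrightarrow> \<iota> x \<in> carrier U"
  unfolding incl_eq by (rule cls_U) (rule word_closed, simp)

lemma incl_add: 
  assumes "x \<in> deg G 0" "y \<in> deg G 0" shows "\<iota> (x \<oplus> y) = \<iota> x \<oplus>\<^bsub>U\<^esub> \<iota> y"
proof -
  have "EQ.cls (word [x \<oplus> y] 1) = EQ.cls (word [x] 1 \<oplus>\<^bsub>FA\<^esub> word [y] 1)"
    by (rule cls_rel; (rule word_closed FA.a_closed)?)
      (use assms in \<open>auto simp: env_rels_def free_algebra_simps(2) diff_diff_eq[symmetric] deg_closed intro!: word_closed\<close>)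
  then show ?thesis using assms by (simp add: incl_eq cls_U word_closed)
qed

lemma incl_smult: 
  assumes "x \<in> deg G 0" shows "\<iota> (s \<odot> x) = s \<odot>\<^bsub>U\<^esub> \<iota> x"
proof -
  have "EQ.cls (word [s \<odot> x] 1) = EQ.cls (s \<odot>\<^bsub>FA\<^esub> word [x] 1)"
    by (rule cls_rel; (rule word_closed FA.smult_mem)?)
      (use assms in \<open>auto simp: env_rels_def free_algebra_simps(4) deg_closed intro!: word_closed\<close>)
  then show ?thesis using assms by (simp add: incl_eq cls_U word_closed)
qed

lemma incl_commute:
  assumes "x \<in> deg G 0 \<inter> par G p" "y \<in> deg G 0 \<inter> par G q"
  shows "\<iota> x \<otimes>\<^bsub>U\<^esub> \<iota> y = parity_sign (p * q) \<odot>\<^bsub>U\<^esub> (\<iota> y \<otimes>\<^bsub>U\<^esub> \<iota> x) \<oplus>\<^bsub>U\<^esub> \<iota> (x \<otimes> y)"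
proof -
  have "EQ.cls (word [x, y] 1) = EQ.cls (word [y, x] (parity_sign (p * q)) \<oplus>\<^bsub>FA\<^esub> word [x \<otimes> y] 1)"
    by (rule cls_rel; (rule word_closed FA.a_closed)?)
      (use assms in \<open>auto simp: env_rels_def free_algebra_simps(2) diff_diff_eq[symmetric]
          bracket_closed intro!: word_closed\<close>)
  then show ?thesis
    using assms by (simp add: incl_eq cls_U word_closed free_algebra_mult_single free_algebra_simps(4) bracket_closed)
qed

lemma env_pow_closed: "env_pow G k \<subseteq> carrier U"
proof (induction k)
  case 0 show ?case using U.vspan_closed[of "{\<one>\<^bsub>U\<^esub>}"] by simp
next
  case (Suc k)
  then have "{u \<otimes>\<^bsub>U\<^esub> \<iota> x | u x. u \<in> env_pow G k \<and> x \<in> deg G 0} \<subseteq> carrier U" by auto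
  then show ?case using U.vspan_closed by simp
qed

lemma env_pow_word: "w \<in> lists (deg G 0) \<Longrightarrow> EQ.cls (word w s) \<in> env_pow G (length w)"
proof (induction w rule: rev_induct)
  case Nil
  have "submodule (env_pow G 0) scalars U"
    unfolding env_pow.simps by (rule U.vspan_submodule) simp
  moreover have "\<one>\<^bsub>U\<^esub> \<in> env_pow G 0" by (simp add: U.vspan_superset)
  ultimately have "s \<odot>\<^bsub>U\<^esub> \<one>\<^bsub>U\<^esub> \<in> env_pow G 0" using U.submoduleD(4) by blast
  then show ?case by (simp add: cls_U(4,5) word_closed free_algebra_simps(4) del: env_pow.simps)
next
  case (snoc z w)
  have "EQ.cls (word (w @ [z]) s) = EQ.cls (word w s) \<otimes>\<^bsub>U\<^esub> \<iota> z"
    using snoc by (simp add: incl_eq cls_U word_closed free_algebra_mult_single)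
  then show ?case using snoc by (auto intro!: U.vspan_superset)
qed

lemma FA_induct [consumes 1, case_names word add zero]:
  assumes "f \<in> carrier FA"
    and "\<And>w s. w \<in> lists (deg G 0) \<Longrightarrow> P (word w s)"
    and "\<And>f g. \<lbrakk>f \<in> carrier FA; g \<in> carrier FA; P f; P g\<rbrakk> \<Longrightarrow> P (f \<oplus>\<^bsub>FA\<^esub> g)"
    and "P \<zero>\<^bsub>FA\<^esub>"
  shows "P f"
  using assms free_space_induct[of f "lists (deg G 0)" P] by (simp add: free_algebra_simps)

text \<open>
  The space \<open>env_pow G k\<close> comes from the words of length exactly \<open>k\<close>, so that these spaces need not
  form an increasing chain and their union need not be closed under addition. It does contain the image of each
  word, hence it spans the enveloping algebra. This is how the defining equations of the product, which
  concern elements of \<open>env_pow G k\<close>, extend to the whole algebra.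
\<close>

lemma env_pow_induct [consumes 1, case_names pow add]:
  assumes "u \<in> carrier U"
    and pow: "\<And>k u. u \<in> env_pow G k \<Longrightarrow> P u"
    and add: "\<And>u v. \<lbrakk>u \<in> carrier U; v \<in> carrier U; P u; P v\<rbrakk> \<Longrightarrow> P (u \<oplus>\<^bsub>U\<^esub> v)"
  shows "P u"
proof -
  obtain f where f: "f \<in> carrier FA" "u = EQ.cls f" using assms(1) by (rule U_cases)
  have "P (EQ.cls f)" using f(1)
  proof (induction rule: FA_induct)
    case (word w s) then show ?case using env_pow_word pow by blast
  next
    case (add f g) then show ?case using assms(3) by (simp add: cls_U(3)[symmetric] cls_U(1))
  next
    case zero
    have "EQ.cls \<zero>\<^bsub>FA\<^esub> = EQ.cls (word [] 0)" by (simp add: free_algebra_simps)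
    then show ?case using pow[OF env_pow_word[of "[]" 0]] by simp
  qed
  then show ?thesis using f by simp
qed

text \<open>
  The sign rules apply to homogeneous letters. Closure under addition reduces arbitrary words to words
  in homogeneous letters.
\<close>

lemma U_induct [consumes 1, case_names one mult smult add]:
  assumes "u \<in> carrier U"
    and one: "P \<one>\<^bsub>U\<^esub>"
    and mult: "\<And>u z r. \<lbrakk>u \<in> carrier U; P u; z \<in> deg G 0 \<inter> par G r\<rbrakk> \<Longrightarrow> P (u \<otimes>\<^bsub>U\<^esub> \<iota> z)"
    and smult: "\<And>u s. \<lbrakk>u \<in> carrier U; P u\<rbrakk> \<Longrightarrow> P (s \<odot>\<^bsub>U\<^esub> u)"
    and add: "\<And>u v. \<lbrakk>u \<in> carrier U; v \<in> carrier U; P u; P v\<rbrakk> \<Longrightarrow> P (u \<oplus>\<^bsub>U\<^esub> v)"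
  shows "P u"
proof -
  have words: "P (EQ.cls (word w s))" if "w \<in> lists (deg G 0)" for w s using that
  proof (induction w rule: rev_induct)
    case Nil
    have "EQ.cls (word [] s) = s \<odot>\<^bsub>U\<^esub> \<one>\<^bsub>U\<^esub>" by (simp add: cls_U word_closed free_algebra_simps(4))
    then show ?case using one smult by simp
  next
    case (snoc z w)
    then obtain x y where z: "x \<in> deg G 0 \<inter> par G 0" "y \<in> deg G 0 \<inter> par G 1" "z = x \<oplus> y"
      using homogeneous_cases[of 0 z] by auto
    have w: "EQ.cls (word w s) \<in> carrier U" using snoc by (simp add: cls_U word_closed)
    have "EQ.cls (word (w @ [z]) s) = EQ.cls (word w s) \<otimes>\<^bsub>U\<^esub> \<iota> z"
      using snoc by (simp add: incl_eq cls_U word_closed free_algebra_mult_single)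
    also have "\<dots> = EQ.cls (word w s) \<otimes>\<^bsub>U\<^esub> \<iota> x \<oplus>\<^bsub>U\<^esub> EQ.cls (word w s) \<otimes>\<^bsub>U\<^esub> \<iota> y"
      using w z by (simp add: incl_add U.r_distr)
    finally show ?case
      using snoc mult[OF w] z w by (auto intro!: add)
  qed
  obtain f where f: "f \<in> carrier FA" "u = EQ.cls f" using assms(1) by (rule U_cases)
  have "P (EQ.cls f)" using f(1)
  proof (induction rule: FA_induct)
    case (add f g) then show ?case using assms(5) by (simp add: cls_U(3)[symmetric] cls_U(1))
  next
    case zero then show ?case using words[of "[]" 0] by (simp add: free_algebra_simps)
  qed (rule words)
  then show ?thesis using f by simp
qed

subsection \<open>Modules over the enveloping algebra\<close>

text \<open>
  The universal property of the enveloping algebra, for algebras of linear operators: a representation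
  of the Lie superalgebra \<open>deg G 0\<close> on \<open>M\<close> extends to \<open>U\<close>. Words act by composition of the operators of
  their letters. This defines an action of the free algebra, and its annihilator \<open>J\<close> is a two-sided
  ideal. It contains the defining relations of \<open>U\<close>, by linearity of \<open>R\<close> and by \<open>R_bracket\<close>, and hence
  the ideal that they generate.
\<close>

lemma env_module:
  fixes M :: "('k, 'c, 'l) module_scheme"
  assumes M: "kspace M"
    and R: "\<And>z. z \<in> deg G 0 \<Longrightarrow> linear_map M M (R z)"
    and R_add: "\<And>z z' w. \<lbrakk>z \<in> deg G 0; z' \<in> deg G 0; w \<in> carrier M\<rbrakk> \<Longrightarrow> R (z \<oplus> z') w = R z w \<oplus>\<^bsub>M\<^esub> R z' w"
    and R_smult: "\<And>s z w. \<lbrakk>z \<in> deg G 0; w \<in> carrier M\<rbrakk> \<Longrightarrow> R (s \<odot> z) w = s \<odot>\<^bsub>M\<^esub> R z w"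
    and R_bracket: "\<And>x y p q w. \<lbrakk>x \<in> deg G 0 \<inter> par G p; y \<in> deg G 0 \<inter> par G q; w \<in> carrier M\<rbrakk>
      \<Longrightarrow> R x (R y w) = parity_sign (p * q) \<odot>\<^bsub>M\<^esub> R y (R x w) \<oplus>\<^bsub>M\<^esub> R (x \<otimes> y) w"
  obtains \<rho> where "bilinear_map U M M \<rho>" "\<And>w. w \<in> carrier M \<Longrightarrow> \<rho> \<one>\<^bsub>U\<^esub> w = w"
    "\<And>u z w. \<lbrakk>u \<in> carrier U; z \<in> deg G 0; w \<in> carrier M\<rbrakk> \<Longrightarrow> \<rho> (u \<otimes>\<^bsub>U\<^esub> \<iota> z) w = \<rho> u (R z w)"
proof -
  interpret M: kspace M by fact
  define act where "act f w = lin_ext M (\<lambda>v. foldr R v w) f" for f w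
  have foldr: "linear_map M M (foldr R v)" if "v \<in> lists (deg G 0)" for v
    using that by (induction v) (auto simp: linear_map_def linear_mapD[OF R])
  note foldr_D = linear_mapD[OF foldr]
  have act_lin: "linear_map FA M (\<lambda>f. act f w)" if "w \<in> carrier M" for w
    using M.lin_ext_linear[of "lists (deg G 0)" "\<lambda>v. foldr R v w"] foldr_D(1) that
    unfolding act_def linear_map_def free_algebra_simps by auto
  note act_D = linear_mapD[OF act_lin]
  have act_word: "act (word v s) w = s \<odot>\<^bsub>M\<^esub> foldr R v w" if "v \<in> lists (deg G 0)" "w \<in> carrier M" for v s w
    unfolding act_def using foldr_D(1) that by (subst M.lin_ext_single) auto
  have act_0: "act \<zero>\<^bsub>FA\<^esub> w = \<zero>\<^bsub>M\<^esub>" if "w \<in> carrier M" for w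
    using linear_map_zero[OF FA.kspace_axioms M act_lin[OF that]] .
  have act_lin2: "linear_map M M (act f)" if "f \<in> carrier FA" for f
    using that
  proof (induction rule: FA_induct)
    case (word w s)
    show ?case
      by (rule linear_mapI)
        (simp_all add: act_word[OF word] foldr_D[OF word] M.smult_add_right M.smult_smult mult.commute)
  next
    case (add f g)
    note f = linear_mapD[OF add(3)] and g = linear_mapD[OF add(4)]
    show ?case
      by (rule linear_mapI) (use add in \<open>auto simp: act_D f g M.M.a_ac M.smult_add_right\<close>)
  next
    case zero then show ?case by (auto intro!: linear_mapI simp: act_0)
  qed
  note act_D2 = linear_mapD[OF act_lin2]
  have act_mult: "act (f \<otimes>\<^bsub>FA\<^esub> g) w = act f (act g w)"
    if "f \<in> carrier FA" "g \<in> carrier FA" "w \<in> carrier M" for f g w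
    using that(1)
  proof (induction rule: FA_induct)
    case (word v s)
    from that(2) show ?case
    proof (induction rule: FA_induct)
      case (word v' s')
      have "v @ v' \<in> lists (deg G 0)" using word \<open>v \<in> lists (deg G 0)\<close> by simp
      note words = this word \<open>v \<in> lists (deg G 0)\<close>
      show ?case using that(3)
        by (simp add: words[THEN act_word] words[THEN foldr_D(1)] words[THEN foldr_D(3)]
          free_algebra_mult_single M.smult_smult)
    next
      case (add f g)
      then show ?case using word that(3) by (simp add: act_D act_D2 word_closed FA.r_distr)
    next
      case zero
      then show ?case using word that(3) act_D2(3)[of "word v s" "\<zero>\<^bsub>M\<^esub>" 0] act_D2(1)[of "word v s" "\<zero>\<^bsub>M\<^esub>"]
        by (simp add: act_0 word_closed)
    qed
  next
    case (add f g)
    then show ?case using that by (simp add: act_D FA.l_distr)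
  next
    case zero
    then show ?case using that by (simp add: act_0 act_D)
  qed
  define J where "J = {f \<in> carrier FA. \<forall>w \<in> carrier M. act f w = \<zero>\<^bsub>M\<^esub>}"
  have J_sub: "submodule J scalars FA"
    by (rule FA.submoduleI') (auto simp: J_def act_D act_0)
  have "ideal J FA"
  proof (rule idealI)
    show "subgroup J (add_monoid FA)" using J_sub by (simp add: submodule_def)
    show "x \<otimes>\<^bsub>FA\<^esub> a \<in> J" if "a \<in> J" "x \<in> carrier FA" for a x
      using that act_D2(3)[of x "\<zero>\<^bsub>M\<^esub>" 0] act_D2(1)[of x "\<zero>\<^bsub>M\<^esub>"] by (simp add: J_def act_mult)
    show "a \<otimes>\<^bsub>FA\<^esub> x \<in> J" if "a \<in> J" "x \<in> carrier FA" for a x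
      using that by (simp add: J_def act_mult act_D)
  qed (rule FA.ring_axioms)
  moreover have "env_rels G \<subseteq> J"
  proof
    fix r assume r: "r \<in> env_rels G"
    have act_diff: "act (f - g) w = act f w \<ominus>\<^bsub>M\<^esub> act g w"
      if "f \<in> carrier FA" "g \<in> carrier FA" "w \<in> carrier M" for f g w
      using that by (simp add: FA_diff(2) a_minus_def FA.minus_eq_smult M.minus_eq_smult act_D)
    have R_bracket_minus: "R x (R y w) \<ominus>\<^bsub>M\<^esub> parity_sign (p * q) \<odot>\<^bsub>M\<^esub> R y (R x w) \<ominus>\<^bsub>M\<^esub> R (x \<otimes> y) w = \<zero>\<^bsub>M\<^esub>"
      if "x \<in> deg G 0 \<and> x \<in> par G p" "y \<in> deg G 0 \<and> y \<in> par G q" "w \<in> carrier M" for x y p q w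
      using that R_bracket[of x p y q w]
      by (simp add: M.sum_minus_summands linear_mapD[OF R] bracket_closed)
    have "act r w = \<zero>\<^bsub>M\<^esub>" if "w \<in> carrier M" for w
      using r that unfolding env_rels_def
      by (elim UnE CollectE exE conjE)
        (simp_all add: act_diff act_word word_closed FA_diff(1) deg_closed bracket_closed R_add R_smult
          linear_mapD[OF R] R_bracket_minus M.sum_minus_summands M.M.r_neg[folded a_minus_def])
    with r env_rels_closed show "r \<in> J" by (auto simp: J_def)
  qed
  ultimately have "env_ideal G \<subseteq> J"
    unfolding env_ideal_def by (rule FA.genideal_minimal)
  then have null: "act f w = \<zero>\<^bsub>M\<^esub>" if "f \<in> env_ideal G" "w \<in> carrier M" for f w
    using that by (auto simp: J_def)
  define \<rho> where "\<rho> u w = quot_lift (\<lambda>f. act f w) u" for u w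
  have \<rho>_cls: "\<rho> (EQ.cls f) w = act f w" if "f \<in> carrier FA" "w \<in> carrier M" for f w
    unfolding \<rho>_def using EQ.quot_lift_cls[OF M act_lin null] that by blast
  show thesis
  proof (rule that)
    have "linear_map U M (\<lambda>u. \<rho> u w)" if "w \<in> carrier M" for w
      unfolding \<rho>_def env_alg_def using EQ.quot_lift_linear[OF M act_lin null] that by blast
    moreover have "linear_map M M (\<rho> u)" if "u \<in> carrier U" for u
      using that by (elim U_cases) (auto intro!: linear_mapI simp: \<rho>_cls act_D2)
    ultimately show "bilinear_map U M M \<rho>" by (simp add: bilinear_map_def)
    show "\<rho> \<one>\<^bsub>U\<^esub> w = w" if "w \<in> carrier M" for w
      using that by (simp add: cls_U \<rho>_cls word_closed act_word)
    show "\<rho> (u \<otimes>\<^bsub>U\<^esub> \<iota> z) w = \<rho> u (R z w)" if "u \<in> carrier U" "z \<in> deg G 0" "w \<in> carrier M" for u z w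
      using that by (elim U_cases)
        (simp add: incl_eq cls_U \<rho>_cls word_closed FA.m_closed act_mult act_word linear_mapD(1)[OF R])
  qed
qed

section \<open>The modules \<open>deg G i \<otimes> U\<close>\<close>

abbreviation "T i \<equiv> tens_mod G i"
abbreviation "tp i \<equiv> tens_pure G i"

lemma tens_ktensor: "i \<in> local_degs \<Longrightarrow> ktensor (G\<lparr>carrier := deg G i\<rparr>) U"
  unfolding ktensor_def using deg_closed(5) U.kspace_axioms by blast

lemma T_kspace: "i \<in> local_degs \<Longrightarrow> kspace (T i)"
  unfolding tens_mod_def by (rule ktensor.tensor_space_kspace[OF tens_ktensor])

lemma tp_bilinear: "i \<in> local_degs \<Longrightarrow> bilinear_map (G\<lparr>carrier := deg G i\<rparr>) U (T i) (tp i)"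
  using ktensor.pure_bilinear[OF tens_ktensor] unfolding tens_mod_def tens_pure_def by fastforce

lemmas tp_props = bilinear_mapD[OF tp_bilinear, simplified]

lemma T_induct [consumes 2, case_names pure add]:
  assumes i: "i \<in> local_degs" and t: "t \<in> carrier (T i)"
    and pure: "\<And>x p u. \<lbrakk>x \<in> deg G i \<inter> par G p; u \<in> carrier U\<rbrakk> \<Longrightarrow> P (tp i x u)"
    and add: "\<And>t t'. \<lbrakk>t \<in> carrier (T i); t' \<in> carrier (T i); P t; P t'\<rbrakk> \<Longrightarrow> P (t \<oplus>\<^bsub>T i\<^esub> t')"
  shows "P t"
  using t unfolding tens_mod_def
proof (induction rule: ktensor.tensor_induct[OF tens_ktensor[OF i], consumes 1, case_names 2 3])
  case (2 x u)
  then obtain y z where x: "y \<in> deg G i \<inter> par G 0" "z \<in> deg G i \<inter> par G 1" "x = y \<oplus> z"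
    using homogeneous_cases[OF i] by auto
  then have "tp i x u = tp i y u \<oplus>\<^bsub>T i\<^esub> tp i z u"
    using 2 i by (simp add: tp_props)
  then show ?case
    using add[OF _ _ pure[OF x(1) 2(2)] pure[OF x(2) 2(2)]] x i 2(2) by (simp add: tens_pure_def[symmetric] tp_props)
next
  case (3 t t')
  then show ?case using add by (simp add: tens_mod_def)
qed

lemma tens_lift:
  assumes "i \<in> local_degs" "kspace M" "bilinear_map (G\<lparr>carrier := deg G i\<rparr>) U M \<beta>"
  shows "\<lbrakk>x \<in> deg G i; u \<in> carrier U\<rbrakk> \<Longrightarrow> tensor_lift M \<beta> (tp i x u) = \<beta> x u"
    and "linear_map (T i) M (tensor_lift M \<beta>)"
  using ktensor.tensor_lift_pure[OF tens_ktensor[OF assms(1)] assms(2,3)]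
    ktensor.tensor_lift_linear[OF tens_ktensor[OF assms(1)] assms(2,3)]
  by (simp_all add: tens_mod_def tens_pure_def)

lemma linear_map_eq_on_T:
  assumes "i \<in> local_degs" "linear_map (T i) M f" "linear_map (T i) M g" "t \<in> carrier (T i)"
    and "\<And>x p u. \<lbrakk>x \<in> deg G i \<inter> par G p; u \<in> carrier U\<rbrakk> \<Longrightarrow> f (tp i x u) = g (tp i x u)"
  shows "f t = g t"
  using assms(1,4)
proof (induction rule: T_induct)
  case (pure x p u) then show ?case by (rule assms(5))
next
  case (add t t')
  then show ?case by (simp add: linear_mapD[OF assms(2)] linear_mapD[OF assms(3)])
qed

subsection \<open>The action of the enveloping algebra\<close>

text \<open>
  The action of \<open>z\<close> on \<open>deg G i \<otimes> U\<close> by \<open>z (y \<otimes> v) = [z, y] \<otimes> v + (-1)^(yz) y \<otimes> z v\<close>. The universal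
  properties require a formula that is linear in \<open>z\<close> and in \<open>y\<close>. Therefore \<open>z\<close> is split into its
  homogeneous components, and the sign becomes the operator \<open>twist\<close> on \<open>y\<close>.
\<close>

definition lie_act :: "int \<Rightarrow> 'g \<Rightarrow> ('k, 'g) tens \<Rightarrow> ('k, 'g) tens"
  where "lie_act i z = tensor_lift (T i) (\<lambda>y v. tp i (z \<otimes> y) v
    \<oplus>\<^bsub>T i\<^esub> (tp i (twist 0 y) (\<iota> (part 0 z) \<otimes>\<^bsub>U\<^esub> v) \<oplus>\<^bsub>T i\<^esub> tp i (twist 1 y) (\<iota> (part 1 z) \<otimes>\<^bsub>U\<^esub> v)))"

lemma lie_act_bilinear:
  assumes i: "i \<in> local_degs" and z: "z \<in> deg G 0"
  shows "bilinear_map (G\<lparr>carrier := deg G i\<rparr>) U (T i) (\<lambda>y v. tp i (z \<otimes> y) v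
    \<oplus>\<^bsub>T i\<^esub> (tp i (twist 0 y) (\<iota> (part 0 z) \<otimes>\<^bsub>U\<^esub> v) \<oplus>\<^bsub>T i\<^esub> tp i (twist 1 y) (\<iota> (part 1 z) \<otimes>\<^bsub>U\<^esub> v)))"
proof -
  interpret Ti: kspace "T i" by (rule T_kspace[OF i])
  note [simp] = i z
  have [simp]: "part p z \<in> deg G 0" for p by (simp add: part_deg)
  have [simp]: "y \<in> deg G i \<Longrightarrow> y \<in> carrier G" for y using deg_carrier i by blast
  have [simp]: "z \<otimes> (y \<oplus> y') = z \<otimes> y \<oplus> z \<otimes> y'" "z \<otimes> (s \<odot> y) = s \<odot> (z \<otimes> y)"
    if "y \<in> deg G i" "y' \<in> deg G i" for y y' s
    using that mult_add_right[of 0 i z y y'] mult_smult_right[of 0 i z y s] by auto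
  have [simp]: "z \<otimes> (s \<odot> y) = s \<odot> (z \<otimes> y)" if "y \<in> deg G i" for y s
    using that mult_smult_right[of 0 i z y s] by auto
  show ?thesis
    by (rule bilinear_mapI)
      (simp_all add: tp_props bracket_closed twist_deg linear_mapD[OF twist_linear] U.r_distr U.smult_mult_right
        Ti.M.a_ac Ti.smult_add_right)
qed

lemma lie_act_pure:
  assumes i: "i \<in> local_degs" and z: "z \<in> deg G 0 \<inter> par G r" and y: "y \<in> deg G i \<inter> par G q" and v: "v \<in> carrier U"
  shows "lie_act i z (tp i y v)
    = tp i (z \<otimes> y) v \<oplus>\<^bsub>T i\<^esub> parity_sign (q * r) \<odot>\<^bsub>T i\<^esub> tp i y (\<iota> z \<otimes>\<^bsub>U\<^esub> v)"
proof -
  interpret Ti: kspace "T i" by (rule T_kspace[OF i])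
  \<comment> \<open>only the component of \<open>z\<close> of parity \<open>r\<close> survives\<close>
  have zero: "\<iota> \<zero> = \<zero>\<^bsub>U\<^esub>"
    using incl_smult[of \<zero> 0] by (simp add: deg_closed)
  have zero': "tp i x \<zero>\<^bsub>U\<^esub> = \<zero>\<^bsub>T i\<^esub>" if "x \<in> deg G i" for x
    using tp_props(5)[OF i that, of "\<zero>\<^bsub>U\<^esub>" 0] tp_props(1)[OF i that, of "\<zero>\<^bsub>U\<^esub>"] by simp
  have "lie_act i z (tp i y v) = tp i (z \<otimes> y) v
    \<oplus>\<^bsub>T i\<^esub> (tp i (twist 0 y) (\<iota> (part 0 z) \<otimes>\<^bsub>U\<^esub> v) \<oplus>\<^bsub>T i\<^esub> tp i (twist 1 y) (\<iota> (part 1 z) \<otimes>\<^bsub>U\<^esub> v))"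
    unfolding lie_act_def using tens_lift(1)[OF i T_kspace[OF i] lie_act_bilinear[OF i]] z y v by simp
  also have "tp i (twist 0 y) (\<iota> (part 0 z) \<otimes>\<^bsub>U\<^esub> v) \<oplus>\<^bsub>T i\<^esub> tp i (twist 1 y) (\<iota> (part 1 z) \<otimes>\<^bsub>U\<^esub> v)
      = tp i (twist r y) (\<iota> z \<otimes>\<^bsub>U\<^esub> v)"
    using bit_exhaust[of r] z y v i
    by (auto simp: part_homogeneous zero zero' tp_props twist_deg)
  also have "twist r y = parity_sign (q * r) \<odot> y"
    using y by (simp add: twist_homogeneous)
  finally show ?thesis using z y v i by (simp add: tp_props)
qed

lemma lie_act_linear: "\<lbrakk>i \<in> local_degs; z \<in> deg G 0\<rbrakk> \<Longrightarrow> linear_map (T i) (T i) (lie_act i z)"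
  unfolding lie_act_def by (rule tens_lift(2)[OF _ T_kspace lie_act_bilinear])

lemma lie_act_linear_left:
  assumes i: "i \<in> local_degs" and z: "z \<in> deg G 0" "z' \<in> deg G 0" and t: "t \<in> carrier (T i)"
  shows "lie_act i (z \<oplus> z') t = lie_act i z t \<oplus>\<^bsub>T i\<^esub> lie_act i z' t"
    and "lie_act i (s \<odot> z) t = s \<odot>\<^bsub>T i\<^esub> lie_act i z t"
proof -
  interpret Ti: kspace "T i" by (rule T_kspace[OF i])
  have [simp]: "part p z \<in> deg G 0" "part p z' \<in> deg G 0" for p using z by (simp_all add: part_deg)
  have zz: "z \<oplus> z' \<in> deg G 0" "s \<odot> z \<in> deg G 0" using z by (simp_all add: deg_closed)
  note l = linear_mapD[OF lie_act_linear[OF i]]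
  note p = tens_lift(1)[OF i T_kspace[OF i] lie_act_bilinear[OF i], folded lie_act_def]
  show "lie_act i (z \<oplus> z') t = lie_act i z t \<oplus>\<^bsub>T i\<^esub> lie_act i z' t"
  proof (rule linear_map_eq_on_T[OF i lie_act_linear[OF i zz(1)] _ t])
    show "linear_map (T i) (T i) (\<lambda>t. lie_act i z t \<oplus>\<^bsub>T i\<^esub> lie_act i z' t)"
      by (rule linear_mapI) (use z in \<open>simp_all add: l Ti.M.a_ac Ti.smult_add_right\<close>)
    fix y q v assume "y \<in> deg G i \<inter> par G q" "v \<in> carrier U"
    then show "lie_act i (z \<oplus> z') (tp i y v) = lie_act i z (tp i y v) \<oplus>\<^bsub>T i\<^esub> lie_act i z' (tp i y v)"
      using z zz i mult_add_left[of 0 i z z' y]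
      by (simp add: p linear_mapD[OF part_linear] incl_add U.l_distr tp_props bracket_closed twist_deg
          Ti.M.a_ac)
  qed
  show "lie_act i (s \<odot> z) t = s \<odot>\<^bsub>T i\<^esub> lie_act i z t"
  proof (rule linear_map_eq_on_T[OF i lie_act_linear[OF i zz(2)] _ t])
    show "linear_map (T i) (T i) (\<lambda>t. s \<odot>\<^bsub>T i\<^esub> lie_act i z t)"
      by (rule linear_mapI) (use z in \<open>simp_all add: l Ti.smult_add_right Ti.smult_smult mult.commute\<close>)
    fix y q v assume "y \<in> deg G i \<inter> par G q" "v \<in> carrier U"
    then show "lie_act i (s \<odot> z) (tp i y v) = s \<odot>\<^bsub>T i\<^esub> lie_act i z (tp i y v)"
      using z zz i mult_smult_left[of 0 i z y s]
      by (simp add: p linear_mapD[OF part_linear] incl_smult U.smult_mult_left tp_props bracket_closed twist_deg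
          Ti.smult_add_right)
  qed
qed

lemma bracket_par:
  assumes i: "i \<in> local_degs" and z: "z \<in> deg G 0 \<inter> par G r" and y: "y \<in> deg G i \<inter> par G q"
  shows "z \<otimes> y \<in> deg G i \<inter> par G (r + q)"
  using mult_par[of 0 i z r y q] bracket_closed(1)[of z y i] i z y by simp

lemma Jacobi_plus:
  assumes i: "i \<in> local_degs" and x: "x \<in> deg G 0 \<inter> par G p" and y: "y \<in> deg G 0 \<inter> par G q"
    and g: "g \<in> deg G i \<inter> par G r"
  shows "x \<otimes> (y \<otimes> g) = parity_sign (p * q) \<odot> (y \<otimes> (x \<otimes> g)) \<oplus> (x \<otimes> y) \<otimes> g"
proof -
  have c: "x \<otimes> (y \<otimes> g) \<in> carrier G" "y \<otimes> (x \<otimes> g) \<in> carrier G" 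
    using bracket_par[OF i] x y g deg_carrier i by blast+
  have "(x \<otimes> y) \<otimes> g = x \<otimes> (y \<otimes> g) \<ominus> parity_sign (p * q) \<odot> (y \<otimes> (x \<otimes> g))"
    using super_Jacobi[of 0 0 i x p y q g r] i x y g by simp
  then show ?thesis using c by (simp add: add_minus_cancel)
qed

text \<open>
  In \<open>x (y (g \<otimes> v)) - (-1)^(xy) y (x (g \<otimes> v))\<close>, the terms that apply one of \<open>x\<close>, \<open>y\<close> to \<open>g\<close> and the
  other one to \<open>v\<close> cancel. What is left is the Jacobi identity in the first factor and the
  commutation relation of \<open>U\<close> in the second one.
\<close>

lemma lie_act_bracket:
  assumes i: "i \<in> local_degs" and x: "x \<in> deg G 0 \<inter> par G p" and y: "y \<in> deg G 0 \<inter> par G q"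
    and t: "t \<in> carrier (T i)"
  shows "lie_act i x (lie_act i y t)
    = parity_sign (p * q) \<odot>\<^bsub>T i\<^esub> lie_act i y (lie_act i x t) \<oplus>\<^bsub>T i\<^esub> lie_act i (x \<otimes> y) t"
proof -
  interpret Ti: kspace "T i" by (rule T_kspace[OF i])
  note l = linear_mapD[OF lie_act_linear[OF i]]
  have xy: "x \<otimes> y \<in> deg G 0 \<inter> par G (p + q)" using bracket_par[of 0 x p y q] x y by simp
  note [simp] = x[THEN IntD1] y[THEN IntD1] xy[THEN IntD1]
  show ?thesis
  proof (rule linear_map_eq_on_T[OF i _ _ t])
    show "linear_map (T i) (T i) (\<lambda>t. lie_act i x (lie_act i y t))"
      by (rule linear_mapI) (simp_all add: l)
    show "linear_map (T i) (T i) (\<lambda>t. parity_sign (p * q) \<odot>\<^bsub>T i\<^esub> lie_act i y (lie_act i x t) \<oplus>\<^bsub>T i\<^esub> lie_act i (x \<otimes> y) t)"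
      by (rule linear_mapI) (simp_all add: l Ti.M.a_ac Ti.smult_add_right Ti.smult_smult mult.commute)
    fix g r v assume g: "g \<in> deg G i \<inter> par G r" and v: "v \<in> carrier U"
    note xg = bracket_par[OF i x g] and yg = bracket_par[OF i y g]
    note xyg = bracket_par[OF i x yg] and yxg = bracket_par[OF i y xg] and xy_g = bracket_par[OF i xy g]
    note [simp] = g[THEN IntD1] xg[THEN IntD1] yg[THEN IntD1] xyg[THEN IntD1] yxg[THEN IntD1] xy_g[THEN IntD1] v i
    note pure = lie_act_pure[OF i x g] lie_act_pure[OF i y g] lie_act_pure[OF i x yg] lie_act_pure[OF i y xg]
      lie_act_pure[OF i xy g]
    have "\<iota> x \<otimes>\<^bsub>U\<^esub> (\<iota> y \<otimes>\<^bsub>U\<^esub> v)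
      = parity_sign (p * q) \<odot>\<^bsub>U\<^esub> (\<iota> y \<otimes>\<^bsub>U\<^esub> (\<iota> x \<otimes>\<^bsub>U\<^esub> v)) \<oplus>\<^bsub>U\<^esub> \<iota> (x \<otimes> y) \<otimes>\<^bsub>U\<^esub> v"
      by (simp add: U.m_assoc[symmetric] incl_commute[OF x y] U.l_distr U.smult_mult_left)
    then show "lie_act i x (lie_act i y (tp i g v)) = parity_sign (p * q) \<odot>\<^bsub>T i\<^esub> lie_act i y (lie_act i x (tp i g v))
        \<oplus>\<^bsub>T i\<^esub> lie_act i (x \<otimes> y) (tp i g v)"
      by (simp add: pure l tp_props Jacobi_plus[OF i x y g] Ti.smult_add_right Ti.smult_smult deg_closed
          distrib_left distrib_right parity_sign_add mult_ac Ti.M.a_ac)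
  qed
qed

definition env_act :: "int \<Rightarrow> ('k, 'g) env \<Rightarrow> ('k, 'g) tens \<Rightarrow> ('k, 'g) tens"
  where "env_act i = (SOME \<rho>. bilinear_map U (T i) (T i) \<rho> \<and> (\<forall>w\<in>carrier (T i). \<rho> \<one>\<^bsub>U\<^esub> w = w) \<and>
    (\<forall>u\<in>carrier U. \<forall>z\<in>deg G 0. \<forall>w\<in>carrier (T i). \<rho> (u \<otimes>\<^bsub>U\<^esub> \<iota> z) w = \<rho> u (lie_act i z w)))"

lemma env_act:
  assumes i: "i \<in> local_degs"
  shows env_act_bilinear: "bilinear_map U (T i) (T i) (env_act i)"
    and env_act_one: "w \<in> carrier (T i) \<Longrightarrow> env_act i \<one>\<^bsub>U\<^esub> w = w"
    and env_act_mult: "\<lbrakk>u \<in> carrier U; z \<in> deg G 0; w \<in> carrier (T i)\<rbrakk>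
      \<Longrightarrow> env_act i (u \<otimes>\<^bsub>U\<^esub> \<iota> z) w = env_act i u (lie_act i z w)"
proof -
  let ?P = "\<lambda>\<rho>. bilinear_map U (T i) (T i) \<rho> \<and> (\<forall>w\<in>carrier (T i). \<rho> \<one>\<^bsub>U\<^esub> w = w) \<and>
    (\<forall>u\<in>carrier U. \<forall>z\<in>deg G 0. \<forall>w\<in>carrier (T i). \<rho> (u \<otimes>\<^bsub>U\<^esub> \<iota> z) w = \<rho> u (lie_act i z w))"
  have "\<exists>\<rho>. ?P \<rho>"
    by (rule env_module[OF T_kspace[OF i] lie_act_linear[OF i] lie_act_linear_left(1)[OF i]
          lie_act_linear_left(2)[OF i] lie_act_bracket[OF i]]) blast+
  then have "?P (env_act i)" unfolding env_act_def by (rule someI_ex)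
  then show "bilinear_map U (T i) (T i) (env_act i)" "w \<in> carrier (T i) \<Longrightarrow> env_act i \<one>\<^bsub>U\<^esub> w = w"
    "\<lbrakk>u \<in> carrier U; z \<in> deg G 0; w \<in> carrier (T i)\<rbrakk>
      \<Longrightarrow> env_act i (u \<otimes>\<^bsub>U\<^esub> \<iota> z) w = env_act i u (lie_act i z w)"
    by auto
qed

subsection \<open>Right multiplication\<close>

definition right_mult :: "int \<Rightarrow> ('k, 'g) tens \<Rightarrow> ('k, 'g) env \<Rightarrow> ('k, 'g) tens"
  where "right_mult i t v = tensor_lift (T i) (\<lambda>x u. tp i x (u \<otimes>\<^bsub>U\<^esub> v)) t"

lemma right_mult:
  assumes i: "i \<in> local_degs"
  shows right_mult_bilinear: "bilinear_map (T i) U (T i) (right_mult i)"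
    and right_mult_pure: "\<lbrakk>x \<in> deg G i; u \<in> carrier U; v \<in> carrier U\<rbrakk>
      \<Longrightarrow> right_mult i (tp i x u) v = tp i x (u \<otimes>\<^bsub>U\<^esub> v)"
proof -
  interpret Ti: kspace "T i" by (rule T_kspace[OF i])
  have b: "bilinear_map (G\<lparr>carrier := deg G i\<rparr>) U (T i) (\<lambda>x u. tp i x (u \<otimes>\<^bsub>U\<^esub> v))" if "v \<in> carrier U" for v
    by (rule bilinear_mapI) (use that i in \<open>simp_all add: tp_props U.l_distr U.smult_mult_left\<close>)
  show "bilinear_map (T i) U (T i) (right_mult i)"
    unfolding right_mult_def tens_mod_def
    by (rule ktensor.tensor_lift_bilinear[OF tens_ktensor[OF i] U.kspace_axioms _ b[unfolded tens_mod_def]])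
      (use Ti.kspace_axioms in \<open>auto intro!: linear_mapI simp: i tp_props U.r_distr U.smult_mult_right tens_mod_def[symmetric]\<close>)
  show "\<lbrakk>x \<in> deg G i; u \<in> carrier U; v \<in> carrier U\<rbrakk>
      \<Longrightarrow> right_mult i (tp i x u) v = tp i x (u \<otimes>\<^bsub>U\<^esub> v)"
    unfolding right_mult_def by (rule tens_lift(1)[OF i T_kspace[OF i] b])
qed

end

section \<open>Existence of the product\<close>

locale Gl_construction = contragredient G L form + local_Lie G
  for G :: "('k::field, 'g, 'm) local_superalgebra_scheme" (structure) and L form +
  fixes a b c :: 'k
begin

text \<open>
  The product of \<open>x\<close> and \<open>y\<close> of degrees \<open>i\<close> and \<open>-i\<close>, for possibly inhomogeneous elements. As the form
  vanishes on elements of different parities, \<open>(-1)^(xy) \<langle>y|x\<rangle> = (-1)^x \<langle>y|x\<rangle>\<close> for \<open>x\<close> of degree \<open>1\<close>, and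
  \<open>(-1)^x x\<close> extends to the linear map \<open>twist 1\<close>.
\<close>

definition opp_prod :: "int \<Rightarrow> 'g \<Rightarrow> 'g \<Rightarrow> ('k, 'g) env"
  where "opp_prod i x y =
    (if i = - 1 then (- a) \<odot>\<^bsub>U\<^esub> \<iota> (x \<otimes> y) \<oplus>\<^bsub>U\<^esub> (b * form x y) \<odot>\<^bsub>U\<^esub> \<iota> L
     else a \<odot>\<^bsub>U\<^esub> \<iota> (x \<otimes> y) \<oplus>\<^bsub>U\<^esub> (b * form y (twist 1 x)) \<odot>\<^bsub>U\<^esub> \<iota> L
       \<oplus>\<^bsub>U\<^esub> (c * form y (twist 1 x)) \<odot>\<^bsub>U\<^esub> \<one>\<^bsub>U\<^esub>)"

lemma unit_int_cases: "i \<in> {-1, 1} \<Longrightarrow> i = -1 \<or> i = (1::int)" by auto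

lemma unit_int_degs: "i \<in> {-1, 1} \<Longrightarrow> i \<in> local_degs" "i \<in> {-1, 1} \<Longrightarrow> - i \<in> local_degs"
  "i \<in> {-1, 1} \<Longrightarrow> - i \<in> {-1, 1}"
  by (auto simp: local_degs_def)

lemmas L_props [simp] = L_deg L_even

lemma form_twist:
  assumes "x \<in> deg G 1 \<inter> par G p" "y \<in> deg G (-1) \<inter> par G q"
  shows "form y (twist 1 x) = parity_sign (p * q) * form y x"
  using assms bit_exhaust[of p] bit_exhaust[of q] form_homogeneous[of y q x p]
  by (auto simp: twist_homogeneous form_smult_right)

lemma opp_prod_homogeneous:
  assumes i: "i \<in> {-1, 1}" and x: "x \<in> deg G i \<inter> par G p" and y: "y \<in> deg G (-i) \<inter> par G q"
  shows "opp_prod i x y = opposite_prod G L form a b c i p q x y"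
  using unit_int_cases[OF i] form_twist[of x p y q] x y by (auto simp: opp_prod_def opposite_prod_def Let_def)

lemma opp_prod_bilinear:
  assumes i: "i \<in> {-1, 1}"
  shows "bilinear_map (G\<lparr>carrier := deg G i\<rparr>) (G\<lparr>carrier := deg G (-i)\<rparr>) U (opp_prod i)"
proof -
  have br: "x \<otimes> y \<in> deg G 0" "(x \<oplus> x') \<otimes> y = x \<otimes> y \<oplus> x' \<otimes> y" "x \<otimes> (y \<oplus> y') = x \<otimes> y \<oplus> x \<otimes> y'"
    "(s \<odot> x) \<otimes> y = s \<odot> (x \<otimes> y)" "x \<otimes> (s \<odot> y) = s \<odot> (x \<otimes> y)"
    if "x \<in> deg G i" "y \<in> deg G (-i)" "x' \<in> deg G i" "y' \<in> deg G (-i)" for x y x' y' s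
    using that i bracket_closed(3) mult_add_left[of i "-i"] mult_add_right[of i "-i"]
      mult_smult_left[of i "-i"] mult_smult_right[of i "-i"] by (auto simp: unit_int_degs)
  show ?thesis
  proof (rule bilinear_mapI)
    fix x y assume x: "x \<in> carrier (G\<lparr>carrier := deg G i\<rparr>)" and y: "y \<in> carrier (G\<lparr>carrier := deg G (-i)\<rparr>)"
    then show "opp_prod i x y \<in> carrier U" using br(1)[of x y] by (auto simp: opp_prod_def)
    show "opp_prod i (x \<oplus>\<^bsub>G\<lparr>carrier := deg G i\<rparr>\<^esub> x') y = opp_prod i x y \<oplus>\<^bsub>U\<^esub> opp_prod i x' y"
      if "x' \<in> carrier (G\<lparr>carrier := deg G i\<rparr>)" for x'
      using x y that unit_int_cases[OF i]
      by (auto simp: opp_prod_def br[of x y x' y] br(1)[of x' y] incl_add U.smult_add_right U.M.a_ac form_add_left form_add_right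
          twist_deg linear_mapD[OF twist_linear] distrib_left U.smult_add_left)
    show "opp_prod i x (y \<oplus>\<^bsub>G\<lparr>carrier := deg G (-i)\<rparr>\<^esub> y') = opp_prod i x y \<oplus>\<^bsub>U\<^esub> opp_prod i x y'"
      if "y' \<in> carrier (G\<lparr>carrier := deg G (-i)\<rparr>)" for y'
      using x y that unit_int_cases[OF i]
      by (auto simp: opp_prod_def br[of x y x y'] br(1)[of x y'] incl_add U.smult_add_right U.M.a_ac form_add_left form_add_right
          twist_deg distrib_left U.smult_add_left)
    show "opp_prod i (s \<odot>\<^bsub>G\<lparr>carrier := deg G i\<rparr>\<^esub> x) y = s \<odot>\<^bsub>U\<^esub> opp_prod i x y" for s
      using x y unit_int_cases[OF i]
      by (auto simp: opp_prod_def br[of x y x y] incl_smult U.smult_add_right U.smult_smult form_smult_left form_smult_right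
          twist_deg linear_mapD[OF twist_linear] mult_ac)
    show "opp_prod i x (s \<odot>\<^bsub>G\<lparr>carrier := deg G (-i)\<rparr>\<^esub> y) = s \<odot>\<^bsub>U\<^esub> opp_prod i x y" for s
      using x y unit_int_cases[OF i]
      by (auto simp: opp_prod_def br[of x y x y] incl_smult U.smult_add_right U.smult_smult form_smult_left form_smult_right
          twist_deg mult_ac)
  qed
qed

lemmas opp_prod_props = bilinear_mapD[OF opp_prod_bilinear, simplified]

text \<open>
  Left multiplication by \<open>x = x \<otimes> 1\<close>, that is \<open>x (y \<otimes> v) = (x y) v\<close>.
\<close>

definition gen_pairing :: "int \<Rightarrow> 'g \<Rightarrow> ('k, 'g) tens \<Rightarrow> ('k, 'g) env"
  where "gen_pairing i x w = tensor_lift U (\<lambda>y v. opp_prod i x y \<otimes>\<^bsub>U\<^esub> v) w"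

lemma gen_pairing:
  assumes i: "i \<in> {-1, 1}"
  shows gen_pairing_bilinear: "bilinear_map (G\<lparr>carrier := deg G i\<rparr>) (T (-i)) U (gen_pairing i)"
    and gen_pairing_pure: "\<lbrakk>x \<in> deg G i; y \<in> deg G (-i); v \<in> carrier U\<rbrakk> \<Longrightarrow> gen_pairing i x (tp (-i) y v) = opp_prod i x y \<otimes>\<^bsub>U\<^esub> v"
proof -
  have b: "bilinear_map (G\<lparr>carrier := deg G (-i)\<rparr>) U U (\<lambda>y v. opp_prod i x y \<otimes>\<^bsub>U\<^esub> v)" if "x \<in> deg G i" for x
    by (rule bilinear_mapI) (use that i in \<open>simp_all add: opp_prod_props U.l_distr U.r_distr U.smult_mult_left U.smult_mult_right\<close>)
  have "bilinear_map (T (-i)) (G\<lparr>carrier := deg G i\<rparr>) U (\<lambda>w x. gen_pairing i x w)"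
    unfolding gen_pairing_def tens_mod_def
    by (rule ktensor.tensor_lift_bilinear[OF tens_ktensor _ U.kspace_axioms b])
      (use i in \<open>auto intro!: linear_mapI simp: deg_closed(5) opp_prod_props U.l_distr U.smult_mult_left unit_int_degs\<close>)
  then show "bilinear_map (G\<lparr>carrier := deg G i\<rparr>) (T (-i)) U (gen_pairing i)"
    by (simp add: bilinear_map_def)
  show "\<lbrakk>x \<in> deg G i; y \<in> deg G (-i); v \<in> carrier U\<rbrakk> \<Longrightarrow> gen_pairing i x (tp (-i) y v) = opp_prod i x y \<otimes>\<^bsub>U\<^esub> v"
    unfolding gen_pairing_def by (rule tens_lift(1)[OF _ U.kspace_axioms b]) (use i in \<open>auto simp: unit_int_degs\<close>)
qed

text \<open>
  The product \<open>(x \<otimes> u) w = x (u w)\<close> of opposite components.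
\<close>

definition pairing :: "int \<Rightarrow> ('k, 'g) tens \<Rightarrow> ('k, 'g) tens \<Rightarrow> ('k, 'g) env"
  where "pairing i t w = tensor_lift U (\<lambda>x u. gen_pairing i x (env_act (-i) u w)) t"

lemma pairing:
  assumes i: "i \<in> {-1, 1}"
  shows pairing_bilinear: "bilinear_map (T i) (T (-i)) U (pairing i)"
    and pairing_pure: "\<lbrakk>x \<in> deg G i; u \<in> carrier U; w \<in> carrier (T (-i))\<rbrakk>
      \<Longrightarrow> pairing i (tp i x u) w = gen_pairing i x (env_act (-i) u w)"
proof -
  note [simp] = bilinear_mapD[OF gen_pairing_bilinear[OF i], simplified] bilinear_mapD[OF env_act_bilinear[OF unit_int_degs(2)[OF i]]]
  have b: "bilinear_map (G\<lparr>carrier := deg G i\<rparr>) U U (\<lambda>x u. gen_pairing i x (env_act (-i) u w))" if "w \<in> carrier (T (-i))" for w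
    by (rule bilinear_mapI) (use that i in simp_all)
  show "bilinear_map (T i) (T (-i)) U (pairing i)"
    unfolding pairing_def tens_mod_def[of G i]
    by (rule ktensor.tensor_lift_bilinear[OF tens_ktensor T_kspace U.kspace_axioms b])
      (use i in \<open>simp_all add: linear_map_def unit_int_degs\<close>)
  show "\<lbrakk>x \<in> deg G i; u \<in> carrier U; w \<in> carrier (T (-i))\<rbrakk>
      \<Longrightarrow> pairing i (tp i x u) w = gen_pairing i x (env_act (-i) u w)"
    unfolding pairing_def by (rule tens_lift(1)[OF _ U.kspace_axioms b]) (use i in \<open>auto simp: unit_int_degs\<close>)
qed

subsection \<open>The product\<close>

abbreviation "S \<equiv> Gl_space G"

lemma Gl_simps:
  "carrier S = carrier (T (-1)) \<times> carrier U \<times> carrier (T 1)"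
  "\<zero>\<^bsub>S\<^esub> = (\<zero>\<^bsub>T (-1)\<^esub>, \<zero>\<^bsub>U\<^esub>, \<zero>\<^bsub>T 1\<^esub>)"
  "(x, u, y) \<oplus>\<^bsub>S\<^esub> (x', u', y') = (x \<oplus>\<^bsub>T (-1)\<^esub> x', u \<oplus>\<^bsub>U\<^esub> u', y \<oplus>\<^bsub>T 1\<^esub> y')"
  "s \<odot>\<^bsub>S\<^esub> (x, u, y) = (s \<odot>\<^bsub>T (-1)\<^esub> x, s \<odot>\<^bsub>U\<^esub> u, s \<odot>\<^bsub>T 1\<^esub> y)"
  by (simp_all add: Gl_space_def Let_def)

lemma Gl_deg:
  "deg S (-1) = carrier (T (-1)) \<times> {\<zero>\<^bsub>U\<^esub>} \<times> {\<zero>\<^bsub>T 1\<^esub>}"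
  "deg S 0 = {\<zero>\<^bsub>T (-1)\<^esub>} \<times> carrier U \<times> {\<zero>\<^bsub>T 1\<^esub>}"
  "deg S 1 = {\<zero>\<^bsub>T (-1)\<^esub>} \<times> {\<zero>\<^bsub>U\<^esub>} \<times> carrier (T 1)"
  by (simp_all add: Gl_space_def Let_def)

sublocale Tm: kspace "T (-1)" by (rule T_kspace) simp
sublocale Tp: kspace "T 1" by (rule T_kspace) simp

lemma Gl_kspace: "kspace S"
  by (rule kspaceI)
    (auto simp: Gl_simps U.M.a_ac Tm.M.a_ac Tp.M.a_ac U.smult_add_left U.smult_add_right U.smult_smult
      Tm.smult_add_left Tm.smult_add_right Tm.smult_smult Tp.smult_add_left Tp.smult_add_right Tp.smult_smult)

sublocale S: kspace S by (rule Gl_kspace)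

definition inj0 :: "('k, 'g) env \<Rightarrow> ('k, 'g) gl"
  where "inj0 u = (\<zero>\<^bsub>T (-1)\<^esub>, u, \<zero>\<^bsub>T 1\<^esub>)"

definition inj :: "int \<Rightarrow> ('k, 'g) tens \<Rightarrow> ('k, 'g) gl"
  where "inj i t = (if i = - 1 then (t, \<zero>\<^bsub>U\<^esub>, \<zero>\<^bsub>T 1\<^esub>) else (\<zero>\<^bsub>T (-1)\<^esub>, \<zero>\<^bsub>U\<^esub>, t))"

lemma inj0_linear: "linear_map U S inj0"
  by (rule linear_mapI) (simp_all add: inj0_def Gl_simps)

lemma inj_linear: "i \<in> {-1, 1} \<Longrightarrow> linear_map (T i) S (inj i)"
  by (rule linear_mapI) (auto simp: inj_def Gl_simps)

lemma deg_inj: "deg S 0 = inj0 ` carrier U" "i \<in> {-1, 1} \<Longrightarrow> deg S i = inj i ` carrier (T i)"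
  by (auto simp: inj0_def inj_def Gl_deg image_iff)

text \<open>
  The values on two elements of degree \<open>1\<close>, or two of degree \<open>-1\<close>, have no meaning in a local algebra.
  With the value \<open>0\<close> the product is bilinear on the whole space.
\<close>

definition gl_mult :: "('k, 'g) gl \<Rightarrow> ('k, 'g) gl \<Rightarrow> ('k, 'g) gl"
  where "gl_mult = (\<lambda>(t, u, s) (t', u', s').
    (env_act (-1) u t' \<oplus>\<^bsub>T (-1)\<^esub> right_mult (-1) t u',
     u \<otimes>\<^bsub>U\<^esub> u' \<oplus>\<^bsub>U\<^esub> (pairing (-1) t s' \<oplus>\<^bsub>U\<^esub> pairing 1 s t'),
     env_act 1 u s' \<oplus>\<^bsub>T 1\<^esub> right_mult 1 s u'))"

lemmas env_act_props [simp] = bilinear_mapD[OF env_act_bilinear]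
lemmas right_mult_props [simp] = bilinear_mapD[OF right_mult_bilinear]
lemmas pairing_props [simp] = bilinear_mapD[OF pairing_bilinear[of "-1"], simplified]
  bilinear_mapD[OF pairing_bilinear[of 1], simplified]

lemma bilinear_zero:
  assumes "bilinear_map V W M \<beta>" "kspace V" "kspace W" "kspace M"
  shows "y \<in> carrier W \<Longrightarrow> \<beta> \<zero>\<^bsub>V\<^esub> y = \<zero>\<^bsub>M\<^esub>" "x \<in> carrier V \<Longrightarrow> \<beta> x \<zero>\<^bsub>W\<^esub> = \<zero>\<^bsub>M\<^esub>"
  using linear_map_zero[OF assms(2,4)] linear_map_zero[OF assms(3,4)] assms(1) by (auto simp: bilinear_map_def)

lemmas bilinear_zeros [simp] =
  bilinear_zero[OF env_act_bilinear U.kspace_axioms T_kspace T_kspace]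
  bilinear_zero[OF right_mult_bilinear T_kspace U.kspace_axioms T_kspace]
  bilinear_zero[OF pairing_bilinear[of "-1"] Tm.kspace_axioms, simplified, OF Tp.kspace_axioms U.kspace_axioms]
  bilinear_zero[OF pairing_bilinear[of 1] Tp.kspace_axioms, simplified, OF Tm.kspace_axioms U.kspace_axioms]

lemma gl_mult_bilinear: "bilinear_map S S S gl_mult"
  by (rule bilinear_mapI)
    (auto simp: gl_mult_def Gl_simps U.l_distr U.r_distr U.smult_mult_left U.smult_mult_right
      U.M.a_ac Tm.M.a_ac Tp.M.a_ac U.smult_add_right Tm.smult_add_right Tp.smult_add_right)

lemma gl_mult_inj:
  "\<lbrakk>u \<in> carrier U; v \<in> carrier U\<rbrakk> \<Longrightarrow> gl_mult (inj0 u) (inj0 v) = inj0 (u \<otimes>\<^bsub>U\<^esub> v)"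
  "\<lbrakk>i \<in> {-1, 1}; u \<in> carrier U; t \<in> carrier (T i)\<rbrakk> \<Longrightarrow> gl_mult (inj0 u) (inj i t) = inj i (env_act i u t)"
  "\<lbrakk>i \<in> {-1, 1}; u \<in> carrier U; t \<in> carrier (T i)\<rbrakk> \<Longrightarrow> gl_mult (inj i t) (inj0 u) = inj i (right_mult i t u)"
  "\<lbrakk>i \<in> {-1, 1}; t \<in> carrier (T i); t' \<in> carrier (T (-i))\<rbrakk> \<Longrightarrow> gl_mult (inj i t) (inj (-i) t') = inj0 (pairing i t t')"
  by (auto simp: gl_mult_def inj0_def inj_def)

abbreviation "alg m \<equiv> S\<lparr>monoid.mult := m\<rparr>"

lemma alg_simps:
  "carrier (alg m) = carrier S" "\<zero>\<^bsub>alg m\<^esub> = \<zero>\<^bsub>S\<^esub>" "x \<oplus>\<^bsub>alg m\<^esub> y = x \<oplus>\<^bsub>S\<^esub> y"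
  "s \<odot>\<^bsub>alg m\<^esub> x = s \<odot>\<^bsub>S\<^esub> x" "deg (alg m) = deg S" "x \<otimes>\<^bsub>alg m\<^esub> y = m x y"
  by simp_all

lemma alg_kspace: "kspace (alg m)"
  by (rule kspace_transfer[OF Gl_kspace]) simp_all

lemma deg_S_submodule: "i \<in> local_degs \<Longrightarrow> submodule (deg S i) scalars (alg m)"
proof -
  interpret A: kspace "alg m" by (rule alg_kspace)
  show "i \<in> local_degs \<Longrightarrow> submodule (deg S i) scalars (alg m)"
    by (intro A.submoduleI') (auto simp: alg_simps local_degs_def Gl_deg Gl_simps)
qed

lemma alg_grading: "is_direct_sum (alg m) local_degs (deg (alg m))"
proof -
  interpret A: kspace "alg m" by (rule alg_kspace)
  have sum: "finsum (alg m) f local_degs = (fst (f (-1)), fst (snd (f 0)), snd (snd (f 1)))"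
    if f: "f \<in> (\<Pi>\<^sub>E i\<in>local_degs. deg S i)" for f
  proof -
    have fi: "f i \<in> deg S i" if "i \<in> local_degs" for i using f that by (rule PiE_mem)
    from fi[of "-1"] obtain t where 1: "f (-1) = (t, \<zero>\<^bsub>U\<^esub>, \<zero>\<^bsub>T 1\<^esub>)" "t \<in> carrier (T (-1))"
      by (auto simp: Gl_deg)
    from fi[of 0] obtain u where 2: "f 0 = (\<zero>\<^bsub>T (-1)\<^esub>, u, \<zero>\<^bsub>T 1\<^esub>)" "u \<in> carrier U"
      by (auto simp: Gl_deg)
    from fi[of 1] obtain s where 3: "f 1 = (\<zero>\<^bsub>T (-1)\<^esub>, \<zero>\<^bsub>U\<^esub>, s)" "s \<in> carrier (T 1)"
      by (auto simp: Gl_deg)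
    have "finsum (alg m) f local_degs = f (-1) \<oplus>\<^bsub>alg m\<^esub> (f 0 \<oplus>\<^bsub>alg m\<^esub> f 1)"
      using 1 2 3 unfolding local_degs_def by (simp add: Gl_simps alg_simps)
    also have "\<dots> = (t, u, s)" using 1 2 3 by (simp add: Gl_simps)
    finally show ?thesis by (simp add: 1 2 3)
  qed
  have "\<exists>!f. f \<in> (\<Pi>\<^sub>E i\<in>local_degs. deg S i) \<and> x = finsum (alg m) f local_degs"
    if x: "x \<in> carrier S" for x
  proof (rule ex_ex1I)
    obtain t u s where xx: "x = (t, u, s)" "t \<in> carrier (T (-1))" "u \<in> carrier U" "s \<in> carrier (T 1)"
      using x by (auto simp: Gl_simps)
    let ?f = "\<lambda>i\<in>local_degs. if i = -1 then (t, \<zero>\<^bsub>U\<^esub>, \<zero>\<^bsub>T 1\<^esub>)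
      else if i = 0 then (\<zero>\<^bsub>T (-1)\<^esub>, u, \<zero>\<^bsub>T 1\<^esub>) else (\<zero>\<^bsub>T (-1)\<^esub>, \<zero>\<^bsub>U\<^esub>, s)"
    have f: "?f \<in> (\<Pi>\<^sub>E i\<in>local_degs. deg S i)"
      using xx by (auto simp: local_degs_def Gl_deg)
    then show "\<exists>f. f \<in> (\<Pi>\<^sub>E i\<in>local_degs. deg S i) \<and> x = finsum (alg m) f local_degs"
      using sum[OF f] xx by (intro exI[of _ ?f]) simp
    fix f g assume f: "f \<in> (\<Pi>\<^sub>E i\<in>local_degs. deg S i) \<and> x = finsum (alg m) f local_degs"
      and g: "g \<in> (\<Pi>\<^sub>E i\<in>local_degs. deg S i) \<and> x = finsum (alg m) g local_degs"
    have eq: "(fst (f (-1)), fst (snd (f 0)), snd (snd (f 1))) = (fst (g (-1)), fst (snd (g 0)), snd (snd (g 1)))"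
      using sum f g by metis
    show "f = g"
    proof (rule PiE_ext)
      show "f \<in> (\<Pi>\<^sub>E i\<in>local_degs. deg S i)" "g \<in> (\<Pi>\<^sub>E i\<in>local_degs. deg S i)" using f g by auto
      fix i assume i: "i \<in> local_degs"
      have "f i \<in> deg S i" "g i \<in> deg S i" using f g i by (auto dest: PiE_mem)
      with eq i show "f i = g i" by (auto simp: local_degs_def Gl_deg)
    qed
  qed
  then show ?thesis
    unfolding is_direct_sum_def alg_simps using deg_S_submodule by blast
qed

lemma deg_S_carrier: "\<lbrakk>i \<in> local_degs; x \<in> deg S i\<rbrakk> \<Longrightarrow> x \<in> carrier S"
  by (auto simp: local_degs_def Gl_deg Gl_simps)

lemma alg_local_algebra:
  assumes m: "bilinear_map S S S m"
    and deg: "\<And>i j x y. \<lbrakk>i \<in> local_degs; j \<in> local_degs; i + j \<in> local_degs; x \<in> deg S i; y \<in> deg S j\<rbrakk>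
      \<Longrightarrow> m x y \<in> deg S (i + j)"
  shows "local_algebra (alg m)"
proof (intro local_algebra.intro local_algebra_axioms.intro)
  show "module scalars (alg m)" using alg_kspace by (simp add: kspace_def)
  show "is_direct_sum (alg m) local_degs (deg (alg m))" by (rule alg_grading)
qed (use deg bilinear_mapD[OF m] deg_S_carrier in \<open>simp_all add: alg_simps\<close>)

lemma gl_mult_deg:
  assumes "i \<in> local_degs" "j \<in> local_degs" "i + j \<in> local_degs" "x \<in> deg S i" "y \<in> deg S j"
  shows "gl_mult x y \<in> deg S (i + j)"
  using assms by (auto simp: local_degs_def Gl_deg gl_mult_def)

lemma tens_eq:
  "tens G i (Inl s) u = inj0 (s \<odot>\<^bsub>U\<^esub> u)"
  "i \<in> {-1, 1} \<Longrightarrow> tens G i (Inr x) u = inj i (tp i x u)"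
  by (auto simp: tens_def inj0_def inj_def Let_def)

lemma gens_cases:
  assumes "x \<in> gens G i p"
  obtains (scalar) s where "x = Inl s" "p = 0" | (element) y where "x = Inr y" "y \<in> deg G i \<inter> par G p"
  using assms by (auto simp: gens_def)

text \<open>
  Both equations are evaluated separately for \<open>x\<close> and \<open>y\<close> scalar or not. If \<open>y\<close> is not a scalar, the
  recursive one expresses that \<open>u z\<close> acts as \<open>z\<close> followed by \<open>u\<close>. If \<open>y\<close> is a scalar, it comes from the
  associativity of \<open>U\<close>.
\<close>

theorem gl_mult_is_Gl_prod: "is_Gl_prod G L form a b c gl_mult"
  unfolding is_Gl_prod_def
proof (intro conjI ballI allI)
  show "local_algebra (alg gl_mult)"
    by (rule alg_local_algebra[OF gl_mult_bilinear gl_mult_deg])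
next
  fix i p q x y k v
  assume i: "i \<in> {-1, 1::int}" and x: "x \<in> gens G i p" and y: "y \<in> gens G (-i) q" and "v \<in> env_pow G k"
  then have v: "v \<in> carrier U" using env_pow_closed by blast
  note degs = unit_int_degs[OF i]
  note [simp] = gl_mult_inj(1) gl_mult_inj(2)[OF degs(3)] gl_mult_inj(3,4)[OF i]
    tens_eq(1) tens_eq(2)[OF i] tens_eq(2)[OF degs(3)] v degs(1,2) tp_props
  from x show "gl_mult (tens G i x \<one>\<^bsub>U\<^esub>) (tens G (- i) y v) = base_prod G L form a b c i p q x y v"
  proof (cases rule: gens_cases)
    case (scalar s)
    from y show ?thesis
      by (cases rule: gens_cases)
        (simp_all add: scalar base_prod_def env_act_one U.smult_mult_left U.smult_smult)
  next
    case (element x')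
    from y show ?thesis
    proof (cases rule: gens_cases)
      case scalar
      then show ?thesis
        using element by (simp add: base_prod_def right_mult_pure)
    next
      case y: (element y')
      note opp_prod = opp_prod_homogeneous[OF i element(2) y(2), symmetric]
      have "opp_prod i x' y' \<in> carrier U" using opp_prod_props(1)[of i x' y'] i element(2) y(2) by simp
      then show ?thesis
        using element(2) y(2)
        by (simp add: element(1) y(1) base_prod_def opp_prod pairing_pure[OF i] gen_pairing_pure[OF i] env_act_one)
    qed
  qed
next
  fix i p q r x y z j k u v
  assume i: "i \<in> {-1, 1::int}" and x: "x \<in> gens G i p" and y: "y \<in> gens G (-i) q"
    and z: "z \<in> deg G 0 \<inter> par G r" and "u \<in> env_pow G j" "v \<in> env_pow G k"
  then have u: "u \<in> carrier U" and v: "v \<in> carrier U" using env_pow_closed by blast+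
  note degs = unit_int_degs[OF i]
  interpret T1: kspace "T i" by (rule T_kspace[OF degs(1)])
  interpret T2: kspace "T (-i)" by (rule T_kspace[OF degs(2)])
  note [simp] = gl_mult_inj(1) gl_mult_inj(2)[OF degs(3)] gl_mult_inj(3,4)[OF i]
    tens_eq(1) tens_eq(2)[OF i] tens_eq(2)[OF degs(3)] u v z[THEN IntD1] degs(1,2) tp_props
    linear_mapD(2,3)[OF inj0_linear, symmetric] linear_mapD(2,3)[OF inj_linear[OF i], symmetric]
    linear_mapD(2,3)[OF inj_linear[OF degs(3)], symmetric]
    gen_bracket_def
  from x show "gl_mult (tens G i x (u \<otimes>\<^bsub>U\<^esub> \<iota> z)) (tens G (- i) y v) =
       gl_mult (tens G i x u) (tens G (- i) (gen_bracket G z y) v) \<oplus>\<^bsub>S\<^esub>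
       parity_sign (q * r) \<odot>\<^bsub>S\<^esub> gl_mult (tens G i x u) (tens G (- i) y (\<iota> z \<otimes>\<^bsub>U\<^esub> v))"
  proof (cases rule: gens_cases)
    case (scalar s)
    from y show ?thesis
    proof (cases rule: gens_cases)
      case scalar': (scalar t)
      then show ?thesis
        by (simp add: scalar U.smult_mult_left U.smult_mult_right U.smult_smult U.m_assoc)
    next
      case (element y')
      have "z \<otimes> y' \<in> deg G (-i)" using bracket_closed(1)[of z y' "-i"] element z degs by simp
      then show ?thesis
        using element(2)
        by (simp add: scalar element(1) env_act_mult lie_act_pure[OF degs(2) z element(2)] T2.smult_smult T2.smult_add_right
            mult.commute)
    qed
  next
    case (element x')
    note gen_pairing = bilinear_mapD[OF gen_pairing_bilinear[OF i], simplified]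
    from y show ?thesis
    proof (cases rule: gens_cases)
      case scalar': (scalar t)
      then show ?thesis
        using element(2) by (simp add: element(1) right_mult_pure U.smult_mult_right U.m_assoc)
    next
      case y: (element y')
      have "z \<otimes> y' \<in> deg G (-i)" using bracket_closed(1)[of z y' "-i"] y z degs by simp
      then show ?thesis
        using element(2) y(2)
        by (simp add: element(1) y(1) pairing_pure[OF i] env_act_mult lie_act_pure[OF degs(2) z y(2)] gen_pairing)
    qed
  qed
qed

section \<open>The derivation property of the product of opposite components\<close>

text \<open>
  For \<open>x\<close> and \<open>y\<close> of degrees \<open>i\<close> and \<open>-i\<close>, \<open>x y = opp_sign i [x, y] + \<langle>x|y\<rangle> opp_central i\<close>, where
  \<open>\<langle>x|y\<rangle>\<close> is \<open>opp_form i x y\<close>. In this form, the two values of \<open>i\<close> can be treated alike.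
\<close>

definition opp_form :: "int \<Rightarrow> 'g \<Rightarrow> 'g \<Rightarrow> 'k"
  where "opp_form i x y = (if i = -1 then form x y else form y (twist 1 x))"

definition opp_sign :: "int \<Rightarrow> 'k"
  where "opp_sign i = (if i = -1 then - a else a)"

definition opp_central :: "int \<Rightarrow> ('k, 'g) env"
  where "opp_central i = b \<odot>\<^bsub>U\<^esub> \<iota> L \<oplus>\<^bsub>U\<^esub> (if i = -1 then 0 else c) \<odot>\<^bsub>U\<^esub> \<one>\<^bsub>U\<^esub>"

lemma opp_prod_split:
  assumes "i \<in> {-1, 1}" "x \<in> deg G i" "y \<in> deg G (-i)"
  shows "opp_prod i x y = opp_sign i \<odot>\<^bsub>U\<^esub> \<iota> (x \<otimes> y) \<oplus>\<^bsub>U\<^esub> opp_form i x y \<odot>\<^bsub>U\<^esub> opp_central i"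
  using assms bracket_closed(3)[of x i y] unit_int_degs[OF assms(1)]
  by (auto simp: opp_prod_def opp_sign_def opp_form_def opp_central_def U.smult_add_right U.smult_smult
      U.M.a_assoc mult.commute)

text \<open>
  The element \<open>L\<close> commutes with \<open>deg G 0\<close>, as it acts there by the scalar \<open>0\<close>.
\<close>

lemma opp_central_commute:
  assumes z: "z \<in> deg G 0 \<inter> par G r"
  shows "\<iota> z \<otimes>\<^bsub>U\<^esub> opp_central i = opp_central i \<otimes>\<^bsub>U\<^esub> \<iota> z" "opp_central i \<in> carrier U"
proof -
  have "L \<otimes> z = \<zero>" using L_bracket[of 0 z] z by simp
  then have "\<iota> (L \<otimes> z) = \<zero>\<^bsub>U\<^esub>" using incl_smult[of \<zero> 0] by (simp add: deg_closed)
  then have "\<iota> L \<otimes>\<^bsub>U\<^esub> \<iota> z = \<iota> z \<otimes>\<^bsub>U\<^esub> \<iota> L"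
    using incl_commute[of L 0 z r] z by simp
  then show "\<iota> z \<otimes>\<^bsub>U\<^esub> opp_central i = opp_central i \<otimes>\<^bsub>U\<^esub> \<iota> z" "opp_central i \<in> carrier U"
    using z by (simp_all add: opp_central_def U.l_distr U.r_distr U.smult_mult_left U.smult_mult_right)
qed

lemma opp_form_homogeneous:
  assumes i: "i \<in> {-1, 1}" and x: "x \<in> deg G i \<inter> par G p" and y: "y \<in> deg G (-i) \<inter> par G q"
    and "p \<noteq> q"
  shows "opp_form i x y = 0"
  using unit_int_cases[OF i] form_twist[of x p y q] x y form_homogeneous[of x p y q] form_homogeneous[of y q x p] assms(4)
  by (auto simp: opp_form_def)

lemma bracket_right:
  assumes i: "i \<in> {-1, 1}" and z: "z \<in> deg G 0 \<inter> par G r" and x: "x \<in> deg G i \<inter> par G p"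
  shows "x \<otimes> z \<in> deg G i \<and> z \<otimes> x = (- parity_sign (r * p)) \<odot> (x \<otimes> z)"
proof -
  have c: "x \<otimes> z \<in> deg G i" using bracket_closed(2)[of z x i] x z unit_int_degs[OF i] by simp
  moreover have "z \<otimes> x = \<ominus> (parity_sign (r * p) \<odot> (x \<otimes> z))"
    using super_antisym[of 0 i z r x p] x z unit_int_degs[OF i] by simp
  ultimately show ?thesis
    using deg_carrier[OF c] unit_int_degs[OF i] by (simp add: minus_eq_smult smult_smult)
qed

text \<open>
  The invariance of the form under \<open>z\<close>. For \<open>i = -1\<close> it is the assumption on the form, up to the
  antisymmetry of the bracket. For \<open>i = 1\<close> the signs in \<open>\<langle>x|y\<rangle> = (-1)^(xy) \<langle>y|x\<rangle>\<close> have to be compared in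
  addition.
\<close>

lemma opp_form_invariant:
  assumes i: "i \<in> {-1, 1}" and x: "x \<in> deg G i \<inter> par G p" and y: "y \<in> deg G (-i) \<inter> par G q"
    and z: "z \<in> deg G 0 \<inter> par G r"
  shows "opp_form i (z \<otimes> x) y = - (parity_sign (r * p) * opp_form i x (z \<otimes> y))"
  using unit_int_cases[OF i]
proof
  assume i: "i = -1"
  then show ?thesis
    using bracket_right[of "-1" z r x p] x y z form_invariant[of x z y] by (auto simp: opp_form_def form_smult_left)
next
  assume i: "i = 1"
  have zx: "z \<otimes> x \<in> deg G 1 \<inter> par G (r + p)" and zy: "z \<otimes> y \<in> deg G (-1) \<inter> par G (r + q)"
    using bracket_par[of 1 z r x p] bracket_par[of "-1" z r y q] x y z i by simp_all
  have "opp_form i (z \<otimes> x) y = parity_sign ((r + p) * q) * form y (z \<otimes> x)"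
    using form_twist[OF zx, of y q] y i by (simp add: opp_form_def)
  moreover have "opp_form i x (z \<otimes> y) = parity_sign (p * (r + q)) * form (z \<otimes> y) x"
    using form_twist[of x p, OF _ zy] x i by (simp add: opp_form_def)
  moreover have "form (z \<otimes> y) x = - (parity_sign (r * q) * form y (z \<otimes> x))"
    using bracket_right[of "-1" z r y q] x y z i form_invariant[of y z x] by (auto simp: form_smult_left)
  ultimately show ?thesis
    by (simp add: distrib_left distrib_right parity_sign_add mult_ac)
qed

text \<open>
  Here \<open>z\<close> is moved through \<open>x y\<close>. For the term \<open>[x, y]\<close>, this is the commutation relation of \<open>U\<close>
  combined with the Jacobi identity for \<open>[z, [x, y]]\<close>. For the term \<open>\<langle>x|y\<rangle> opp_central i\<close>, the
  contributions of \<open>[z, x]\<close> and \<open>[z, y]\<close> cancel by invariance, while the sign in the last summand is \<open>1\<close>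
  unless \<open>\<langle>x|y\<rangle> = 0\<close>.
\<close>

lemma opp_prod_derivation:
  assumes i: "i \<in> {-1, 1}" and x: "x \<in> deg G i \<inter> par G p" and y: "y \<in> deg G (-i) \<inter> par G q"
    and z: "z \<in> deg G 0 \<inter> par G r"
  shows "\<iota> z \<otimes>\<^bsub>U\<^esub> opp_prod i x y = opp_prod i (z \<otimes> x) y \<oplus>\<^bsub>U\<^esub> (parity_sign (r * p) \<odot>\<^bsub>U\<^esub> opp_prod i x (z \<otimes> y)
    \<oplus>\<^bsub>U\<^esub> (parity_sign (r * p) * parity_sign (r * q)) \<odot>\<^bsub>U\<^esub> (opp_prod i x y \<otimes>\<^bsub>U\<^esub> \<iota> z))"
proof -
  note degs = unit_int_degs[OF i]
  have zx: "z \<otimes> x \<in> deg G i \<inter> par G (r + p)" and zy: "z \<otimes> y \<in> deg G (-i) \<inter> par G (r + q)"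
    using bracket_par x y z degs by auto
  have br: "g \<otimes> h \<in> deg G 0" if "g \<in> deg G i" "h \<in> deg G (-i)" for g h
    using bracket_closed(3)[of g i h] that degs by simp
  have xy: "x \<otimes> y \<in> deg G 0 \<inter> par G (p + q)"
    using mult_par[of i "-i" x p y q] x y degs br[of x y] by simp
  let ?s = "parity_sign (r * p) :: 'k" and ?e = "parity_sign (r * p) * parity_sign (r * q) :: 'k"
  let ?A = "\<iota> ((z \<otimes> x) \<otimes> y)" and ?B = "\<iota> (x \<otimes> (z \<otimes> y))" and ?C = "\<iota> (x \<otimes> y) \<otimes>\<^bsub>U\<^esub> \<iota> z"
    and ?K = "opp_central i" and ?\<alpha> = "opp_sign i" and ?f = "opp_form i x y" and ?g = "opp_form i x (z \<otimes> y)"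
  let ?D = "?K \<otimes>\<^bsub>U\<^esub> \<iota> z"
  note [simp] = opp_central_commute(2)[OF z] x[THEN IntD1] y[THEN IntD1] z[THEN IntD1] zx[THEN IntD1] zy[THEN IntD1]
  have c [simp]: "?A \<in> carrier U" "?B \<in> carrier U" "\<iota> (x \<otimes> y) \<in> carrier U" "\<iota> z \<in> carrier U"
    using br by simp_all
  have "(z \<otimes> x) \<otimes> y = z \<otimes> (x \<otimes> y) \<ominus> ?s \<odot> (x \<otimes> (z \<otimes> y))"
    using super_Jacobi[of 0 i "-i" z r x p y q] x y z degs by simp
  then have "z \<otimes> (x \<otimes> y) = ?s \<odot> (x \<otimes> (z \<otimes> y)) \<oplus> (z \<otimes> x) \<otimes> y"
    using br bracket_closed(1)[of z "x \<otimes> y" 0] by (simp add: add_minus_cancel)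
  then have "\<iota> (z \<otimes> (x \<otimes> y)) = ?s \<odot>\<^bsub>U\<^esub> ?B \<oplus>\<^bsub>U\<^esub> ?A"
    using br by (simp add: incl_add incl_smult deg_closed)
  then have comm: "\<iota> z \<otimes>\<^bsub>U\<^esub> \<iota> (x \<otimes> y) = ?e \<odot>\<^bsub>U\<^esub> ?C \<oplus>\<^bsub>U\<^esub> (?s \<odot>\<^bsub>U\<^esub> ?B \<oplus>\<^bsub>U\<^esub> ?A)"
    using incl_commute[OF z xy] by (simp add: distrib_left parity_sign_add)
  \<comment> \<open>\<open>?e\<close> is the sign of moving \<open>z\<close> past both \<open>x\<close> and \<open>y\<close>\<close>
  have ef: "?e * ?f = ?f"
    using opp_form_homogeneous[OF i x y] by (cases "p = q") auto
  have "opp_prod i (z \<otimes> x) y \<oplus>\<^bsub>U\<^esub> (?s \<odot>\<^bsub>U\<^esub> opp_prod i x (z \<otimes> y) \<oplus>\<^bsub>U\<^esub> ?e \<odot>\<^bsub>U\<^esub> (opp_prod i x y \<otimes>\<^bsub>U\<^esub> \<iota> z))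
    = (?\<alpha> \<odot>\<^bsub>U\<^esub> ?A \<oplus>\<^bsub>U\<^esub> (?\<alpha> * ?s) \<odot>\<^bsub>U\<^esub> ?B \<oplus>\<^bsub>U\<^esub> (?\<alpha> * ?e) \<odot>\<^bsub>U\<^esub> ?C \<oplus>\<^bsub>U\<^esub> (?e * ?f) \<odot>\<^bsub>U\<^esub> ?D)
      \<oplus>\<^bsub>U\<^esub> ((- (?s * ?g)) \<odot>\<^bsub>U\<^esub> ?K \<oplus>\<^bsub>U\<^esub> (?s * ?g) \<odot>\<^bsub>U\<^esub> ?K)"
    by (simp add: opp_prod_split[OF i] opp_form_invariant[OF i x y z] U.smult_add_right U.smult_smult U.l_distr
        U.smult_mult_left U.M.a_ac mult_ac)
  also have "(- (?s * ?g)) \<odot>\<^bsub>U\<^esub> ?K \<oplus>\<^bsub>U\<^esub> (?s * ?g) \<odot>\<^bsub>U\<^esub> ?K = \<zero>\<^bsub>U\<^esub>"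
    by (simp add: U.smult_add_left[symmetric])
  finally show ?thesis
    by (simp add: opp_prod_split[OF i] ef comm opp_central_commute(1)[OF z] U.smult_add_right U.smult_smult U.r_distr
        U.smult_mult_right U.M.a_ac)
qed

end

section \<open>Consequences of the defining equations\<close>

text \<open>
  From now on, \<open>m\<close> is any product that satisfies the defining equations.
\<close>

locale Gl_product = Gl_construction G L form a b c
  for G :: "('k::field, 'g, 'm) local_superalgebra_scheme" (structure) and L form a b c +
  fixes m :: "('k, 'g) gl \<Rightarrow> ('k, 'g) gl \<Rightarrow> ('k, 'g) gl" (infixl "\<star>" 70)
  assumes Gl_prod: "is_Gl_prod G L form a b c m"
begin

lemma alg_m: "local_algebra (alg m)"
  using Gl_prod by (simp add: is_Gl_prod_def)

lemmas star_deg = local_algebra.mult_deg[OF alg_m, unfolded alg_simps]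
  and star_add_left = local_algebra.mult_add_left[OF alg_m, unfolded alg_simps]
  and star_add_right = local_algebra.mult_add_right[OF alg_m, unfolded alg_simps]
  and star_smult_left = local_algebra.mult_smult_left[OF alg_m, unfolded alg_simps]
  and star_smult_right = local_algebra.mult_smult_right[OF alg_m, unfolded alg_simps]

lemma star_zero_degree:
  assumes "j \<in> local_degs" "x \<in> deg S 0" "y \<in> deg S j"
  shows "x \<star> y \<in> deg S j" "y \<star> x \<in> deg S j"
  using star_deg[of 0 j x y] star_deg[of j 0 y x] assms by simp_all

lemma star_add_zero_degree:
  assumes "j \<in> local_degs"
  shows "\<lbrakk>x \<in> deg S 0; x' \<in> deg S 0; y \<in> deg S j\<rbrakk> \<Longrightarrow> (x \<oplus>\<^bsub>S\<^esub> x') \<star> y = x \<star> y \<oplus>\<^bsub>S\<^esub> x' \<star> y"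
    and "\<lbrakk>x \<in> deg S 0; y \<in> deg S j; y' \<in> deg S j\<rbrakk> \<Longrightarrow> x \<star> (y \<oplus>\<^bsub>S\<^esub> y') = x \<star> y \<oplus>\<^bsub>S\<^esub> x \<star> y'"
    and "\<lbrakk>x \<in> deg S 0; y \<in> deg S j; y' \<in> deg S j\<rbrakk> \<Longrightarrow> (y \<oplus>\<^bsub>S\<^esub> y') \<star> x = y \<star> x \<oplus>\<^bsub>S\<^esub> y' \<star> x"
    and "\<lbrakk>x \<in> deg S 0; x' \<in> deg S 0; y \<in> deg S j\<rbrakk> \<Longrightarrow> y \<star> (x \<oplus>\<^bsub>S\<^esub> x') = y \<star> x \<oplus>\<^bsub>S\<^esub> y \<star> x'"
  using star_add_left[of 0 j] star_add_right[of 0 j] star_add_left[of j 0] star_add_right[of j 0] assms by simp_all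

lemma star_smult_zero_degree:
  assumes "j \<in> local_degs" "x \<in> deg S 0" "y \<in> deg S j"
  shows "(s \<odot>\<^bsub>S\<^esub> x) \<star> y = s \<odot>\<^bsub>S\<^esub> (x \<star> y)" "x \<star> (s \<odot>\<^bsub>S\<^esub> y) = s \<odot>\<^bsub>S\<^esub> (x \<star> y)"
    "(s \<odot>\<^bsub>S\<^esub> y) \<star> x = s \<odot>\<^bsub>S\<^esub> (y \<star> x)" "y \<star> (s \<odot>\<^bsub>S\<^esub> x) = s \<odot>\<^bsub>S\<^esub> (y \<star> x)"
  using star_smult_left[of 0 j] star_smult_right[of 0 j] star_smult_left[of j 0] star_smult_right[of j 0] assms
  by simp_all

lemma deg_S_closed:
  assumes "i \<in> local_degs"
  shows "\<lbrakk>x \<in> deg S i; y \<in> deg S i\<rbrakk> \<Longrightarrow> x \<oplus>\<^bsub>S\<^esub> y \<in> deg S i" "x \<in> deg S i \<Longrightarrow> s \<odot>\<^bsub>S\<^esub> x \<in> deg S i"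
  using kspace.submoduleD(3,4)[OF alg_kspace deg_S_submodule[OF assms]] by (auto simp: alg_simps)

text \<open>
  The degree of \<open>y \<otimes> u\<close> for a generator \<open>y\<close> in \<open>\<bbbK> \<oplus> deg G i\<close>.
\<close>

fun gen_deg :: "int \<Rightarrow> 'k + 'g \<Rightarrow> int"
  where "gen_deg i (Inl s) = 0" | "gen_deg i (Inr x) = i"

lemma tens_linear:
  assumes i: "i \<in> {-1, 1}" and x: "x \<in> gens G i p"
  shows "linear_map U S (tens G i x)"
  using x
proof (cases rule: gens_cases)
  case (scalar s)
  then show ?thesis
    by (auto intro!: linear_mapI simp: tens_eq linear_mapD[OF inj0_linear] U.smult_add_right U.smult_smult S.smult_smult mult.commute)
next
  case (element y)
  then show ?thesis
    by (auto intro!: linear_mapI simp: tens_eq(2)[OF i] linear_mapD[OF inj_linear[OF i]] tp_props unit_int_degs[OF i])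
qed

lemma tens_deg:
  assumes i: "i \<in> {-1, 1}" and x: "x \<in> gens G i p" and u: "u \<in> carrier U"
  shows "tens G i x u \<in> deg S (gen_deg i x)"
  using x by (cases rule: gens_cases)
    (use u i in \<open>auto simp: tens_eq deg_inj tp_props unit_int_degs\<close>)

lemma gen_deg_cases: "i \<in> {-1, 1} \<Longrightarrow> gen_deg i x \<in> {0, i}"
  by (cases x) auto

lemma degs_compat:
  assumes "i \<in> {-1, 1::int}" "k \<in> {0, i}" "j \<in> {0, -i}"
  shows "k \<in> local_degs" "j \<in> local_degs" "k + j \<in> local_degs" "j + k \<in> local_degs"
  using assms by (auto simp: local_degs_def)

text \<open>
  Elements of degree \<open>0\<close> and \<open>i\<close> are treated alike, as sums of elements \<open>y \<otimes> v\<close> with \<open>y\<close> in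
  \<open>\<bbbK> \<oplus> deg G i\<close>. The only scalar needed is \<open>y = 1\<close>, as other scalars can be moved to \<open>v\<close>.
\<close>

lemma deg_S_induct [consumes 3, case_names gen add]:
  assumes i: "i \<in> {-1, 1}" and j: "j \<in> {0, i}" and w: "w \<in> deg S j"
    and gen: "\<And>y q v. \<lbrakk>y \<in> gens G i q; y = Inl 1 \<or> (\<exists>y'. y = Inr y'); gen_deg i y = j; v \<in> carrier U\<rbrakk> \<Longrightarrow> P (tens G i y v)"
    and add: "\<And>w w'. \<lbrakk>w \<in> deg S j; w' \<in> deg S j; P w; P w'\<rbrakk> \<Longrightarrow> P (w \<oplus>\<^bsub>S\<^esub> w')"
  shows "P w"
proof (cases "j = 0")
  case True
  then obtain v where "v \<in> carrier U" "w = tens G i (Inl 1) v"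
    using w by (auto simp: deg_inj tens_eq)
  then show ?thesis using True gen[of "Inl 1" 0 v] by (simp add: gens_def)
next
  case False
  with j have ji: "j = i" by simp
  then obtain t where t: "t \<in> carrier (T i)" "w = inj i t" using w deg_inj(2)[OF i] by auto
  have "P (inj i t)" using unit_int_degs(1)[OF i] t(1)
  proof (induction rule: T_induct)
    case (pure x p u)
    then show ?case using gen[of "Inr x" p u] ji by (simp add: gens_def tens_eq(2)[OF i])
  next
    case (add t t')
    then show ?case
      using assms(5)[of "inj i t" "inj i t'"] ji by (simp add: deg_inj(2)[OF i] linear_mapD(2)[OF inj_linear[OF i]])
  qed
  with t show ?thesis by simp
qed

abbreviation "sign_of p q \<equiv> parity_sign (p * q) :: 'k"

text \<open>
  The two defining equations, for arbitrary elements of the enveloping algebra. Both sides are additive in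
  these elements, and the spaces \<open>env_pow G k\<close> span.
\<close>

lemma base_eq:
  assumes i: "i \<in> {-1, 1}" and x: "x \<in> gens G i p" and y: "y \<in> gens G (-i) q" and v: "v \<in> carrier U"
  shows "tens G i x \<one>\<^bsub>U\<^esub> \<star> tens G (-i) y v = base_prod G L form a b c i p q x y v"
  using v
proof (induction rule: env_pow_induct)
  case (pow k v)
  then show ?case using Gl_prod i x y unfolding is_Gl_prod_def by blast
next
  case (add u v)
  note degs = unit_int_degs[OF i]
  note comp = degs_compat[OF i gen_deg_cases[OF i, of x] gen_deg_cases[OF degs(3), of y]]
  interpret T1: kspace "T i" by (rule T_kspace[OF degs(1)])
  interpret T2: kspace "T (-i)" by (rule T_kspace[OF degs(2)])
  have "base_prod G L form a b c i p q x y (u \<oplus>\<^bsub>U\<^esub> v)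
    = base_prod G L form a b c i p q x y u \<oplus>\<^bsub>S\<^esub> base_prod G L form a b c i p q x y v"
    using x
  proof (cases rule: gens_cases)
    case (scalar s)
    from y show ?thesis
      by (cases rule: gens_cases)
        (use add degs in \<open>simp_all add: scalar base_prod_def tens_eq(1) tens_eq(2)[OF degs(3)] U.smult_add_right
          linear_mapD(2)[OF inj0_linear] linear_mapD(2)[OF inj_linear[OF degs(3)]] tp_props deg_closed\<close>)
  next
    case (element x')
    from y show ?thesis
    proof (cases rule: gens_cases)
      case (scalar s)
      then show ?thesis using add degs element
        by (simp add: base_prod_def tens_eq(2)[OF i] linear_mapD(2)[OF inj_linear[OF i]] tp_props deg_closed)
    next
      case y: (element y')
      have "opposite_prod G L form a b c i p q x' y' \<in> carrier U"
        using opp_prod_homogeneous[OF i element(2) y(2)] opp_prod_props(1)[of i x' y'] i element y by simp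
      then show ?thesis
        using add by (simp add: base_prod_def element y tens_eq(1) U.r_distr linear_mapD(2)[OF inj0_linear])
    qed
  qed
  then show ?case
    using add star_add_right[OF comp(1,2,3) tens_deg[OF i x] tens_deg[OF degs(3) y] tens_deg[OF degs(3) y], of "\<one>\<^bsub>U\<^esub>" u v]
      linear_mapD(2)[OF tens_linear[OF degs(3) y]] by simp
qed

lemma gen_bracket_gens:
  assumes i: "i \<in> local_degs" and y: "y \<in> gens G i q" and z: "z \<in> deg G 0 \<inter> par G r"
  shows "\<exists>q'. gen_bracket G z y \<in> gens G i q'" "gen_deg i (gen_bracket G z y) = gen_deg i y"
  using y by (cases rule: gens_cases; use bracket_par[OF i z] in \<open>auto simp: gens_def gen_bracket_def\<close>)+

lemma rec_eq:
  assumes i: "i \<in> {-1, 1}" and x: "x \<in> gens G i p" and y: "y \<in> gens G (-i) q"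
    and z: "z \<in> deg G 0 \<inter> par G r" and u: "u \<in> carrier U" and v: "v \<in> carrier U"
  shows "tens G i x (u \<otimes>\<^bsub>U\<^esub> \<iota> z) \<star> tens G (-i) y v
    = tens G i x u \<star> tens G (-i) (gen_bracket G z y) v
      \<oplus>\<^bsub>S\<^esub> sign_of q r \<odot>\<^bsub>S\<^esub> (tens G i x u \<star> tens G (-i) y (\<iota> z \<otimes>\<^bsub>U\<^esub> v))"
proof -
  note degs = unit_int_degs[OF i]
  note comp = degs_compat[OF i gen_deg_cases[OF i, of x] gen_deg_cases[OF degs(3), of y]]
  obtain q' where zy: "gen_bracket G z y \<in> gens G (-i) q'" and
    zy_deg: "gen_deg (-i) (gen_bracket G z y) = gen_deg (-i) y"
    using gen_bracket_gens[OF degs(2) y z] by blast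
  note td = tens_deg[OF i x] tens_deg[OF degs(3) y] tens_deg[OF degs(3) zy, unfolded zy_deg]
  note tl = linear_mapD[OF tens_linear[OF i x]] linear_mapD[OF tens_linear[OF degs(3) y]]
    linear_mapD[OF tens_linear[OF degs(3) zy]]
  have sc: "w \<star> w' \<in> carrier S" if "w \<in> deg S (gen_deg i x)" "w' \<in> deg S (gen_deg (-i) y)" for w w'
    using star_deg[OF comp(1-3) that] deg_S_carrier comp(3) by blast
  note sc = sc[OF td(1) td(2)] sc[OF td(1) td(3)]
  note add = star_add_left[OF comp(1,2,3)] star_add_right[OF comp(1,2,3)]
  note [simp] = z[THEN IntD1]
  from u show ?thesis
  proof (induction rule: env_pow_induct)
    case (pow j u)
    then have u: "u \<in> carrier U" using env_pow_closed by blast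
    from v show ?case
    proof (induction rule: env_pow_induct)
      case (pow k v)
      then show ?case using Gl_prod i x y z \<open>u \<in> env_pow G j\<close> unfolding is_Gl_prod_def by blast
    next
      case (add v v')
      then show ?case using u
        by (simp add: tl U.r_distr star_add_right[OF comp(1,2,3)] td sc S.smult_add_right S.M.a_ac)
    qed
  next
    case (add u u')
    then show ?case using v
      by (simp add: tl U.l_distr star_add_left[OF comp(1,2,3)] td sc S.smult_add_right S.M.a_ac)
  qed
qed

lemma one_tens: "tens G i (Inl 1) u = inj0 u" if "u \<in> carrier U"
  using that by (simp add: tens_eq)

lemma Inl_gens: "Inl 1 \<in> gens G i 0"
  by (simp add: gens_def)

lemma inj0_deg: "u \<in> carrier U \<Longrightarrow> inj0 u \<in> deg S 0"
  by (simp add: deg_inj)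

lemma star_one_left:
  assumes i: "i \<in> {-1, 1}" and j: "j \<in> {0, i}" and w: "w \<in> deg S j"
  shows "inj0 \<one>\<^bsub>U\<^esub> \<star> w = w"
  using assms
proof (induction rule: deg_S_induct)
  case (gen y q v)
  note mi = unit_int_degs(3)[OF i]
  have "inj0 \<one>\<^bsub>U\<^esub> \<star> tens G i y v = base_prod G L form a b c (-i) 0 q (Inl 1) y v"
    using base_eq[OF mi Inl_gens, of y q v] gen by (simp add: one_tens)
  also have "\<dots> = tens G i y v"
    using gen(1) by (cases rule: gens_cases)
      (use gen i in \<open>auto simp: base_prod_def tens_eq deg_carrier unit_int_degs\<close>)
  finally show ?case .
next
  case (add w w')
  then show ?case
    using star_add_right[of 0 j "inj0 \<one>\<^bsub>U\<^esub>" w w'] j i by (auto simp: inj0_deg unit_int_degs)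
qed

text \<open>
  The recursive equation with \<open>x = 1\<close> and \<open>u = 1\<close>: left multiplication by \<open>z\<close> is the action of \<open>z\<close> on
  \<open>(\<bbbK> \<oplus> deg G i) \<otimes> U\<close>.
\<close>

lemma incl_star:
  assumes i: "i \<in> {-1, 1}" and y: "y \<in> gens G i q" and z: "z \<in> deg G 0 \<inter> par G r" and v: "v \<in> carrier U"
  shows "inj0 (\<iota> z) \<star> tens G i y v = tens G i (gen_bracket G z y) v \<oplus>\<^bsub>S\<^esub> sign_of q r \<odot>\<^bsub>S\<^esub> tens G i y (\<iota> z \<otimes>\<^bsub>U\<^esub> v)"
proof -
  note mi = unit_int_degs(3)[OF i]
  obtain q' where zy: "gen_bracket G z y \<in> gens G i q'"
    using gen_bracket_gens[OF unit_int_degs(1)[OF i] y z] by blast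
  have zv: "\<iota> z \<otimes>\<^bsub>U\<^esub> v \<in> carrier U" using z v by simp
  show ?thesis
    using rec_eq[OF mi Inl_gens, of y q z r "\<one>\<^bsub>U\<^esub>" v] y z v
      star_one_left[OF i gen_deg_cases[OF i] tens_deg[OF i zy v]] star_one_left[OF i gen_deg_cases[OF i] tens_deg[OF i y zv]]
    by (simp add: one_tens)
qed

text \<open>
  The recursive equation again: by \<open>incl_star\<close>, its right-hand side is \<open>(x \<otimes> u) (z w)\<close> with \<open>w = y \<otimes> v\<close>.
\<close>

lemma star_incl:
  assumes i: "i \<in> {-1, 1}" and x: "x \<in> gens G i p" and z: "z \<in> deg G 0 \<inter> par G r"
    and u: "u \<in> carrier U" and j: "j \<in> {0, -i}" and w: "w \<in> deg S j"
  shows "tens G i x (u \<otimes>\<^bsub>U\<^esub> \<iota> z) \<star> w = tens G i x u \<star> (inj0 (\<iota> z) \<star> w)"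
  using unit_int_degs(3)[OF i] j w
proof (induction rule: deg_S_induct)
  case (gen y q v)
  note degs = unit_int_degs[OF i]
  note comp = degs_compat[OF i gen_deg_cases[OF i, of x] gen_deg_cases[OF degs(3), of y]]
  obtain q' where zy: "gen_bracket G z y \<in> gens G (-i) q'" and
    zy_deg: "gen_deg (-i) (gen_bracket G z y) = gen_deg (-i) y"
    using gen_bracket_gens[OF degs(2) gen(1) z] by blast
  have zv: "\<iota> z \<otimes>\<^bsub>U\<^esub> v \<in> carrier U" using z gen by simp
  note td = tens_deg[OF i x u] tens_deg[OF degs(3) gen(1) zv] tens_deg[OF degs(3) zy gen(4), unfolded zy_deg]
  show ?case
    using rec_eq[OF i x gen(1) z u gen(4)] incl_star[OF degs(3) gen(1) z gen(4)] td
    by (simp add: star_add_right[OF comp(1-3)] star_smult_right[OF comp(1-3)] deg_S_closed comp)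
next
  case (add w w')
  note comp = degs_compat[OF i gen_deg_cases[OF i, of x] j]
  have uz: "u \<otimes>\<^bsub>U\<^esub> \<iota> z \<in> carrier U" and zc: "inj0 (\<iota> z) \<in> deg S 0" using u z by (simp_all add: inj0_deg)
  note zw = star_zero_degree(1)[OF comp(2) zc]
  show ?case
    using add zw zc by (simp add: star_add_right[OF comp(1-3)] star_add_zero_degree[OF comp(2)] tens_deg[OF i x uz] tens_deg[OF i x u])
qed

text \<open>
  Iteration of \<open>star_incl\<close> along the letters of a word \<open>v\<close>. It has to be generalized over \<open>w\<close>, because the
  letters are moved to \<open>w\<close> one by one. For \<open>x = 1\<close> it says that \<open>U\<close> acts.
\<close>

lemma star_env:
  assumes i: "i \<in> {-1, 1}" and x: "x \<in> gens G i p" and u: "u \<in> carrier U" and v: "v \<in> carrier U"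
    and j: "j \<in> {0, -i}" and w: "w \<in> deg S j"
  shows "tens G i x (u \<otimes>\<^bsub>U\<^esub> v) \<star> w = tens G i x u \<star> (inj0 v \<star> w)"
  using v w
proof (induction arbitrary: w rule: U_induct)
  case one
  then show ?case using star_one_left[OF unit_int_degs(3)[OF i] j] u by simp
next
  note comp = degs_compat[OF i gen_deg_cases[OF i, of x] j]
  note tl = linear_mapD[OF tens_linear[OF i x]] linear_mapD[OF inj0_linear]
  note td = tens_deg[OF i x] inj0_deg star_zero_degree(1)[OF comp(2)]
  {
    case (mult v z r)
    then have zw: "inj0 (\<iota> z) \<star> w \<in> deg S j" by (intro td) auto
    have "tens G i x (u \<otimes>\<^bsub>U\<^esub> (v \<otimes>\<^bsub>U\<^esub> \<iota> z)) \<star> w = tens G i x ((u \<otimes>\<^bsub>U\<^esub> v) \<otimes>\<^bsub>U\<^esub> \<iota> z) \<star> w"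
      using u mult by (simp add: U.m_assoc)
    also have "\<dots> = tens G i x (u \<otimes>\<^bsub>U\<^esub> v) \<star> (inj0 (\<iota> z) \<star> w)"
      using star_incl[OF i x mult(2) _ j mult(4)] u mult by simp
    also have "\<dots> = tens G i x u \<star> (inj0 v \<star> (inj0 (\<iota> z) \<star> w))"
      by (rule mult(3)[OF zw])
    also have "inj0 v \<star> (inj0 (\<iota> z) \<star> w) = inj0 (v \<otimes>\<^bsub>U\<^esub> \<iota> z) \<star> w"
      using star_incl[OF i Inl_gens mult(2) mult(1) j mult(4)] mult by (simp add: one_tens)
    finally show ?case .
  next
    case (smult v s)
    then show ?case using u
      by (simp add: tl td U.smult_mult_right star_smult_left[OF comp(1-3)] star_smult_right[OF comp(1-3)] star_smult_zero_degree[OF comp(2)])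
  next
    case (add v v')
    then show ?case using u
      by (simp add: tl td U.r_distr star_add_left[OF comp(1-3)] star_add_right[OF comp(1-3)] star_add_zero_degree[OF comp(2)])
  }
qed

lemma incl_star_inj0:
  assumes "z \<in> deg G 0 \<inter> par G r" "v \<in> carrier U"
  shows "inj0 (\<iota> z) \<star> inj0 v = inj0 (\<iota> z \<otimes>\<^bsub>U\<^esub> v)"
proof -
  have "inj0 (\<iota> z) \<star> inj0 v = inj0 (0 \<odot>\<^bsub>U\<^esub> v) \<oplus>\<^bsub>S\<^esub> inj0 (\<iota> z \<otimes>\<^bsub>U\<^esub> v)"
    using incl_star[of 1 "Inl 1" 0 z r v] assms
    by (simp add: Inl_gens gen_bracket_def tens_eq linear_mapD(1)[OF inj0_linear])
  also have "\<dots> = inj0 (0 \<odot>\<^bsub>U\<^esub> v \<oplus>\<^bsub>U\<^esub> \<iota> z \<otimes>\<^bsub>U\<^esub> v)"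
    using assms by (subst linear_mapD(2)[OF inj0_linear]) auto
  finally show ?thesis using assms by simp
qed

lemma inj0_star_inj0:
  assumes u: "u \<in> carrier U" and v: "v \<in> carrier U"
  shows "inj0 u \<star> inj0 v = inj0 (u \<otimes>\<^bsub>U\<^esub> v)"
  using u v
proof (induction arbitrary: v rule: U_induct)
  case one then show ?case using star_one_left[of 1 0] inj0_deg by simp
next
  case (mult u z r)
  have "inj0 (u \<otimes>\<^bsub>U\<^esub> \<iota> z) \<star> inj0 v = inj0 u \<star> (inj0 (\<iota> z) \<star> inj0 v)"
    using star_incl[of 1 "Inl 1" 0 z r u 0] mult Inl_gens inj0_deg by (simp add: one_tens)
  then show ?case using mult by (simp add: incl_star_inj0[OF mult(2)] U.m_assoc)
next
  case (smult u s)
  then show ?case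
    using star_smult_left[of 0 0] by (simp add: U.smult_mult_left inj0_deg linear_mapD(3)[OF inj0_linear])
next
  case (add u u')
  then show ?case
    using star_add_left[of 0 0] by (simp add: U.l_distr inj0_deg linear_mapD(2)[OF inj0_linear])
qed

lemma tens_star_inj0:
  assumes i: "i \<in> {-1, 1}" and x: "x \<in> gens G i p" "x = Inl 1 \<or> (\<exists>x'. x = Inr x')"
    and u: "u \<in> carrier U" and v: "v \<in> carrier U"
  shows "tens G i x u \<star> inj0 v = tens G i x (u \<otimes>\<^bsub>U\<^esub> v)"
  using x(1)
proof (cases rule: gens_cases)
  case (scalar s)
  then show ?thesis using x u v by (auto simp: one_tens inj0_star_inj0)
next
  case (element x')
  have "tens G i x u \<star> inj0 v = tens G i x \<one>\<^bsub>U\<^esub> \<star> (inj0 u \<star> inj0 v)"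
    using star_env[OF i x(1) _ u, of "\<one>\<^bsub>U\<^esub>" 0 "inj0 v"] u v inj0_deg by simp
  also have "\<dots> = tens G i x \<one>\<^bsub>U\<^esub> \<star> tens G (-i) (Inl 1) (u \<otimes>\<^bsub>U\<^esub> v)"
    using u v by (simp add: inj0_star_inj0 one_tens)
  also have "\<dots> = base_prod G L form a b c i p 0 x (Inl 1) (u \<otimes>\<^bsub>U\<^esub> v)"
    by (rule base_eq[OF i x(1) Inl_gens]) (use u v in simp)
  also have "\<dots> = tens G i x (u \<otimes>\<^bsub>U\<^esub> v)"
    using element deg_carrier[of x' i] unit_int_degs[OF i] by (simp add: base_prod_def)
  finally show ?thesis .
qed

section \<open>Focal associativity\<close>

lemma assoc_middle:
  assumes i: "i \<in> {-1, 1}" and k: "k \<in> {0, i}" and j: "j \<in> {0, -i}"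
    and A: "A \<in> deg S k" and v: "v \<in> carrier U" and w: "w \<in> deg S j"
  shows "(A \<star> inj0 v) \<star> w = A \<star> (inj0 v \<star> w)"
  using i k A
proof (induction rule: deg_S_induct)
  case (gen x p u)
  then show ?case
    using star_env[OF i gen(1) gen(4) v j w] tens_star_inj0[OF i gen(1,2,4) v] by simp
next
  case (add A A')
  note comp = degs_compat[OF i k j]
  have vw: "inj0 v \<star> w \<in> deg S j" using star_zero_degree[OF comp(2)] inj0_deg v w by simp
  have Av: "A \<star> inj0 v \<in> deg S k" "A' \<star> inj0 v \<in> deg S k"
    using add(1,2) v by (simp_all add: star_zero_degree[OF comp(1)] inj0_deg)
  show ?case
    using add vw Av v w by (simp add: star_add_left[OF comp(1-3)] star_add_zero_degree[OF comp(1)] inj0_deg)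
qed

text \<open>
  Left multiplication by \<open>z\<close> changes \<open>y \<otimes> u\<close> in the first factor or on the left of \<open>u\<close>, right
  multiplication by \<open>v\<close> on the right of \<open>u\<close>.
\<close>

lemma incl_star_right:
  assumes i: "i \<in> {-1, 1}" and j: "j \<in> {0, i}" and z: "z \<in> deg G 0 \<inter> par G r" and v: "v \<in> carrier U"
    and B: "B \<in> deg S j"
  shows "(inj0 (\<iota> z) \<star> B) \<star> inj0 v = inj0 (\<iota> z) \<star> (B \<star> inj0 v)"
  using i j B
proof (induction rule: deg_S_induct)
  case (gen y q u)
  show ?case
  proof (cases y)
    case (Inl s)
    then have "y = Inl 1" using gen by auto
    then show ?thesis using gen(4) z v by (simp add: one_tens inj0_star_inj0 U.m_assoc)
  next
    case (Inr y')
    note degs = unit_int_degs[OF i]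
    have zy: "gen_bracket G z y \<in> gens G i (r + q)" "\<exists>x. gen_bracket G z y = Inr x" "gen_deg i (gen_bracket G z y) = i"
      using gen(1) Inr bracket_par[OF degs(1) z, of y' q] by (auto simp: gen_bracket_def gens_def)
    have y: "gen_deg i y = i" using Inr by simp
    have zu: "\<iota> z \<otimes>\<^bsub>U\<^esub> u \<in> carrier U" using z gen by simp
    note td = tens_deg[OF i zy(1) gen(4), unfolded zy(3)] tens_deg[OF i gen(1) zu, unfolded y]
    have "(inj0 (\<iota> z) \<star> tens G i y u) \<star> inj0 v
      = tens G i (gen_bracket G z y) u \<star> inj0 v \<oplus>\<^bsub>S\<^esub> sign_of q r \<odot>\<^bsub>S\<^esub> (tens G i y (\<iota> z \<otimes>\<^bsub>U\<^esub> u) \<star> inj0 v)"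
      using incl_star[OF i gen(1) z gen(4)] td degs(1) v
      by (simp add: inj0_deg deg_S_closed star_add_zero_degree star_smult_zero_degree)
    also have "\<dots> = tens G i (gen_bracket G z y) (u \<otimes>\<^bsub>U\<^esub> v) \<oplus>\<^bsub>S\<^esub> sign_of q r \<odot>\<^bsub>S\<^esub> tens G i y (\<iota> z \<otimes>\<^bsub>U\<^esub> (u \<otimes>\<^bsub>U\<^esub> v))"
    proof -
      have "(\<iota> z \<otimes>\<^bsub>U\<^esub> u) \<otimes>\<^bsub>U\<^esub> v = \<iota> z \<otimes>\<^bsub>U\<^esub> (u \<otimes>\<^bsub>U\<^esub> v)"
        by (rule U.m_assoc) (use gen(4) v z in auto)
      then show ?thesis
        by (simp only: tens_star_inj0[OF i zy(1) disjI2[OF zy(2)] gen(4) v] tens_star_inj0[OF i gen(1) gen(2) zu v])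
    qed
    also have "\<dots> = inj0 (\<iota> z) \<star> tens G i y (u \<otimes>\<^bsub>U\<^esub> v)"
      by (rule incl_star[OF i gen(1) z, symmetric]) (use gen(4) v in simp)
    also have "\<dots> = inj0 (\<iota> z) \<star> (tens G i y u \<star> inj0 v)"
      using tens_star_inj0[OF i gen(1,2,4) v] by simp
    finally show ?thesis .
  qed
next
  case (add B B')
  have degs: "j \<in> local_degs" using i j by (auto simp: local_degs_def)
  have zi: "inj0 (\<iota> z) \<in> deg S 0" using z by (simp add: inj0_deg)
  have Bv: "B \<star> inj0 v \<in> deg S j" "B' \<star> inj0 v \<in> deg S j" "inj0 (\<iota> z) \<star> B \<in> deg S j" "inj0 (\<iota> z) \<star> B' \<in> deg S j"
    using add(1,2) v zi by (simp_all add: star_zero_degree[OF degs] inj0_deg)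
  show ?case
    using add Bv v zi by (simp add: star_add_zero_degree[OF degs] inj0_deg)
qed

lemma tens_star_tens:
  assumes i: "i \<in> {-1, 1}" and x: "x \<in> deg G i \<inter> par G p" and y: "y \<in> deg G (-i) \<inter> par G q"
    and v: "v \<in> carrier U"
  shows "tens G i (Inr x) \<one>\<^bsub>U\<^esub> \<star> tens G (-i) (Inr y) v = inj0 (opp_prod i x y \<otimes>\<^bsub>U\<^esub> v)"
proof -
  have "opp_prod i x y \<in> carrier U" using opp_prod_props(1)[of i x y] i x y by simp
  moreover have "Inr x \<in> gens G i p" "Inr y \<in> gens G (-i) q" using x y by (simp_all add: gens_def)
  ultimately show ?thesis
    using base_eq[OF i _ _ v, of "Inr x" p "Inr y" q] v
    by (simp add: base_prod_def opp_prod_homogeneous[OF i x y] one_tens)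
qed

text \<open>
  For \<open>A = x \<otimes> 1\<close> this is the associativity of \<open>U\<close>, applied to \<open>(x y) w v\<close>. A word \<open>u\<close> in \<open>A = x \<otimes> u\<close> is
  moved to \<open>B\<close> letter by letter, where it commutes with the right multiplication by \<open>incl_star_right\<close>.
\<close>

lemma assoc_right:
  assumes i: "i \<in> {-1, 1}" and k: "k \<in> {0, i}"
    and A: "A \<in> deg S k" and B: "B \<in> deg S (-i)" and v: "v \<in> carrier U"
  shows "(A \<star> B) \<star> inj0 v = A \<star> (B \<star> inj0 v)"
proof -
  note degs = unit_int_degs[OF i]
  have mi: "- i \<in> {0, - i}" by simp
  note comp = degs_compat[OF i k mi]
  define n where "n = k + - i"
  have n: "n \<in> local_degs" using comp(3) by (simp add: n_def)
  have star_n: "w \<star> w' \<in> deg S n" if "w \<in> deg S k" "w' \<in> deg S (-i)" for w w'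
    using star_deg[OF comp(1-3) that] by (simp add: n_def)
  note closed = star_n star_zero_degree(2)[OF degs(2)] star_zero_degree(1)[OF degs(2)] inj0_deg[OF v]
  note distr = star_add_left[OF comp(1-3)] star_add_right[OF comp(1-3)] star_smult_left[OF comp(1-3)]
    star_add_zero_degree(3)[OF n] star_smult_zero_degree(3)[OF n] star_add_zero_degree(3)[OF degs(2)]
  from i k A show ?thesis
  proof (induction rule: deg_S_induct)
    case (gen x p u)
    note x = gen(1)
    note tl = linear_mapD[OF tens_linear[OF i x]] and td = tens_deg[OF i x, unfolded gen(3)]
    have one_assoc: "(tens G i x \<one>\<^bsub>U\<^esub> \<star> B) \<star> inj0 v = tens G i x \<one>\<^bsub>U\<^esub> \<star> (B \<star> inj0 v)"
      if "B \<in> deg S (-i)" for B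
      using degs(3) mi that
    proof (induction rule: deg_S_induct)
      case y: (gen y q w)
      obtain y' where y': "y = Inr y'" "y' \<in> deg G (-i) \<inter> par G q"
        using y(1,3) i by (cases rule: gens_cases) auto
      have yv: "tens G (-i) y w \<star> inj0 v = tens G (-i) y (w \<otimes>\<^bsub>U\<^esub> v)"
        by (rule tens_star_inj0[OF degs(3) y(1,2,4) v])
      have wv: "w \<otimes>\<^bsub>U\<^esub> v \<in> carrier U" using y(4) v by simp
      note base = base_eq[OF i x y(1) y(4)] base_eq[OF i x y(1) wv]
      from x show ?case
      proof (cases rule: gens_cases)
        case (scalar s)
        then have "x = Inl 1" using gen(2) by auto
        then show ?thesis
          using base yv y' degs(2) deg_carrier[of y' "-i"] by (simp add: base_prod_def)
      next
        case (element x')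
        have "opp_prod i x' y' \<in> carrier U" using opp_prod_props(1)[of i x' y'] i element y' by simp
        then show ?thesis
          using tens_star_tens[OF i element(2) y'(2) y(4)] tens_star_tens[OF i element(2) y'(2) wv] yv y(4) v
          by (simp add: element(1) y'(1) inj0_star_inj0 U.m_assoc)
      qed
    next
      case (add B B')
      then show ?case using td by (simp add: closed distr)
    qed
    from gen(4) B show ?case
    proof (induction arbitrary: B rule: U_induct)
      case one
      then show ?case by (rule one_assoc)
    next
      case (mult u z r)
      have z: "inj0 (\<iota> z) \<in> deg S 0" using mult(2) by (simp add: inj0_deg)
      have zB: "inj0 (\<iota> z) \<star> B \<in> deg S (-i)" "B \<star> inj0 v \<in> deg S (-i)"
        using mult(4) z by (simp_all add: closed)
      have "(tens G i x (u \<otimes>\<^bsub>U\<^esub> \<iota> z) \<star> B) \<star> inj0 v = (tens G i x u \<star> (inj0 (\<iota> z) \<star> B)) \<star> inj0 v"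
        using star_incl[OF i x mult(2,1) mi mult(4)] by simp
      also have "\<dots> = tens G i x u \<star> ((inj0 (\<iota> z) \<star> B) \<star> inj0 v)"
        by (rule mult(3)[OF zB(1)])
      also have "\<dots> = tens G i x u \<star> (inj0 (\<iota> z) \<star> (B \<star> inj0 v))"
        using incl_star_right[OF degs(3) mi mult(2) v mult(4)] by simp
      also have "\<dots> = tens G i x (u \<otimes>\<^bsub>U\<^esub> \<iota> z) \<star> (B \<star> inj0 v)"
        using star_incl[OF i x mult(2,1) mi zB(2)] by simp
      finally show ?case .
    next
      case (smult u s)
      then show ?case by (simp add: tl td closed distr)
    next
      case (add u u')
      then show ?case by (simp add: tl td closed distr)
    qed
  next
    case (add A A')
    then show ?case using B by (simp add: closed distr)
  qed
qed

text \<open>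
  For \<open>A = x \<otimes> 1\<close> and \<open>W = y \<otimes> v\<close> this is \<open>opp_prod_derivation\<close>, multiplied by \<open>v\<close> from the right. The
  general case \<open>A = x \<otimes> u\<close> follows from \<open>(x \<otimes> u) W = x (u W)\<close>, since
  \<open>z (x \<otimes> u) = [z, x] \<otimes> u + (-1)^(xz) x \<otimes> z u\<close>.
\<close>

lemma incl_derivation:
  assumes i: "i \<in> {-1, 1}" and z: "z \<in> deg G 0 \<inter> par G r"
    and A: "A \<in> deg S i" and W: "W \<in> deg S (-i)"
  shows "inj0 (\<iota> z) \<star> (A \<star> W) = (inj0 (\<iota> z) \<star> A) \<star> W"
proof -
  note degs = unit_int_degs[OF i]
  have ii: "i \<in> {0, i}" and mi: "- i \<in> {0, - i}" by simp_all
  note comp = degs_compat[OF i ii mi]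
  have star0: "w \<star> w' \<in> deg S 0" if "w \<in> deg S i" "w' \<in> deg S (-i)" for w w'
    using star_deg[OF comp(1-3) that] by simp
  have deg0: "0 \<in> local_degs" by simp
  have zd: "inj0 (\<iota> z) \<in> deg S 0" using z by (simp add: inj0_deg)
  note closed = star0 zd star_zero_degree(1)[OF degs(1)] star_zero_degree(1)[OF degs(2)] 
    star_zero_degree(1)[OF deg0] deg_S_closed[OF degs(1)] deg_S_closed[OF degs(2)] deg_S_closed[OF deg0]
  note distr = star_add_left[OF comp(1-3)] star_add_right[OF comp(1-3)] star_smult_left[OF comp(1-3)]
    star_smult_right[OF comp(1-3)] star_add_zero_degree(2)[OF degs(1)] star_add_zero_degree(2)[OF degs(2)]
    star_add_zero_degree(2)[OF deg0]
  from i ii A show ?thesis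
  proof (induction rule: deg_S_induct)
    case (gen x p u)
    obtain x' where x': "x = Inr x'" "x' \<in> deg G i \<inter> par G p"
      using gen(1,3) i by (cases rule: gens_cases) auto
    note x = gen(1)
    let ?zx = "gen_bracket G z x"
    have zx': "?zx = Inr (z \<otimes> x')" "z \<otimes> x' \<in> deg G i \<inter> par G (r + p)"
      using bracket_par[OF degs(1) z x'(2)] by (simp_all add: gen_bracket_def x')
    have zx: "?zx \<in> gens G i (r + p)" using zx' by (simp add: gens_def)
    note td = tens_deg[OF i x, unfolded gen(3)] tens_deg[OF i zx, unfolded zx'(1) gen_deg.simps, folded zx'(1)]
    have gen_derivation: "inj0 (\<iota> z) \<star> (tens G i x \<one>\<^bsub>U\<^esub> \<star> W) = tens G i ?zx \<one>\<^bsub>U\<^esub> \<star> W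
        \<oplus>\<^bsub>S\<^esub> sign_of p r \<odot>\<^bsub>S\<^esub> (tens G i x \<one>\<^bsub>U\<^esub> \<star> (inj0 (\<iota> z) \<star> W))" if "W \<in> deg S (-i)" for W
      using degs(3) mi that
    proof (induction rule: deg_S_induct)
      case y: (gen y q v)
      obtain y' where y': "y = Inr y'" "y' \<in> deg G (-i) \<inter> par G q"
        using y(1,3) i by (cases rule: gens_cases) auto
      let ?zy = "gen_bracket G z y"
      have zy': "?zy = Inr (z \<otimes> y')" "z \<otimes> y' \<in> deg G (-i) \<inter> par G (r + q)"
        using bracket_par[OF degs(2) z y'(2)] by (simp_all add: gen_bracket_def y')
      have zy: "?zy \<in> gens G (-i) (r + q)" using zy' by (simp add: gens_def)
      have zv: "\<iota> z \<otimes>\<^bsub>U\<^esub> v \<in> carrier U" using z y(4) by simp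
      note v = y(4)
      note tdy = tens_deg[OF degs(3) zy v, unfolded zy'(1) gen_deg.simps, folded zy'(1)]
        tens_deg[OF degs(3) y(1) zv, unfolded y(3)]
      have o: "opp_prod i x' y' \<in> carrier U" "opp_prod i (z \<otimes> x') y' \<in> carrier U" "opp_prod i x' (z \<otimes> y') \<in> carrier U"
        using opp_prod_props(1)[of i x' y'] opp_prod_props(1)[of i "z \<otimes> x'" y'] opp_prod_props(1)[of i x' "z \<otimes> y'"]
          i x' y' zx' zy' by simp_all
      have base: "tens G i x \<one>\<^bsub>U\<^esub> \<star> tens G (-i) y v = inj0 (opp_prod i x' y' \<otimes>\<^bsub>U\<^esub> v)"
        "tens G i x \<one>\<^bsub>U\<^esub> \<star> tens G (-i) y (\<iota> z \<otimes>\<^bsub>U\<^esub> v) = inj0 (opp_prod i x' y' \<otimes>\<^bsub>U\<^esub> (\<iota> z \<otimes>\<^bsub>U\<^esub> v))"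
        "tens G i ?zx \<one>\<^bsub>U\<^esub> \<star> tens G (-i) y v = inj0 (opp_prod i (z \<otimes> x') y' \<otimes>\<^bsub>U\<^esub> v)"
        "tens G i x \<one>\<^bsub>U\<^esub> \<star> tens G (-i) ?zy v = inj0 (opp_prod i x' (z \<otimes> y') \<otimes>\<^bsub>U\<^esub> v)"
        using tens_star_tens[OF i x'(2) y'(2) v] tens_star_tens[OF i x'(2) y'(2) zv]
          tens_star_tens[OF i zx'(2) y'(2) v] tens_star_tens[OF i x'(2) zy'(2) v]
        by (simp_all only: x'(1)[symmetric] y'(1)[symmetric] zx'(1)[symmetric] zy'(1)[symmetric])
      have "inj0 (\<iota> z) \<star> (tens G i x \<one>\<^bsub>U\<^esub> \<star> tens G (-i) y v) = inj0 ((\<iota> z \<otimes>\<^bsub>U\<^esub> opp_prod i x' y') \<otimes>\<^bsub>U\<^esub> v)"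
        using z o v by (simp add: base incl_star_inj0[OF z] U.m_assoc)
      also have "\<dots> = inj0 (opp_prod i (z \<otimes> x') y' \<otimes>\<^bsub>U\<^esub> v) \<oplus>\<^bsub>S\<^esub> sign_of p r \<odot>\<^bsub>S\<^esub> (inj0 (opp_prod i x' (z \<otimes> y') \<otimes>\<^bsub>U\<^esub> v)
          \<oplus>\<^bsub>S\<^esub> sign_of q r \<odot>\<^bsub>S\<^esub> inj0 (opp_prod i x' y' \<otimes>\<^bsub>U\<^esub> (\<iota> z \<otimes>\<^bsub>U\<^esub> v)))"
        using o v z
        by (simp add: opp_prod_derivation[OF i x'(2) y'(2) z] U.l_distr U.smult_mult_left linear_mapD[OF inj0_linear]
            S.smult_add_right S.smult_smult U.m_assoc mult.commute[of r])
      also have "\<dots> = tens G i ?zx \<one>\<^bsub>U\<^esub> \<star> tens G (-i) y v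
        \<oplus>\<^bsub>S\<^esub> sign_of p r \<odot>\<^bsub>S\<^esub> (tens G i x \<one>\<^bsub>U\<^esub> \<star> (inj0 (\<iota> z) \<star> tens G (-i) y v))"
        using td(1)[OF U.one_closed] tdy by (simp add: incl_star[OF degs(3) y(1) z v] distr closed base)
      finally show ?case .
    next
      case (add W W')
      note s = star0[THEN deg_S_carrier[OF deg0]]
      show ?case
        using add td U.one_closed by (simp add: closed distr s S.smult_add_right S.M.a_ac S.M.a_closed)
    qed
    have uW: "inj0 u \<star> W \<in> deg S (-i)" using W gen(4) by (simp add: closed inj0_deg)
    have zu: "\<iota> z \<otimes>\<^bsub>U\<^esub> u \<in> carrier U" using z gen(4) by simp
    have split: "tens G i y w \<star> W = tens G i y \<one>\<^bsub>U\<^esub> \<star> (inj0 w \<star> W)" if "y \<in> gens G i q" "w \<in> carrier U" for y w q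
      using star_env[OF i that(1) U.one_closed that(2) mi W] that by simp
    have zuW: "inj0 (\<iota> z \<otimes>\<^bsub>U\<^esub> u) \<star> W = inj0 (\<iota> z) \<star> (inj0 u \<star> W)"
      using star_env[OF i Inl_gens _ gen(4) mi W, of "\<iota> z"] z gen(4) by (simp add: one_tens)
    have "inj0 (\<iota> z) \<star> (tens G i x u \<star> W) = tens G i ?zx u \<star> W \<oplus>\<^bsub>S\<^esub> sign_of p r \<odot>\<^bsub>S\<^esub> (tens G i x (\<iota> z \<otimes>\<^bsub>U\<^esub> u) \<star> W)"
      using gen_derivation[OF uW] split[OF x gen(4)] split[OF zx gen(4)] split[OF x zu] zuW by simp
    also have "\<dots> = (inj0 (\<iota> z) \<star> tens G i x u) \<star> W"
      using td(1)[OF zu] td(2)[OF gen(4)] W by (simp add: incl_star[OF i x z gen(4)] distr closed)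
    finally show ?case .
  next
    case (add A A')
    then show ?case using W by (simp add: closed distr)
  qed
qed

text \<open>
  As \<open>(uz) A = u (z A)\<close>, the claim follows from the one for single letters, \<open>incl_derivation\<close>.
\<close>

lemma assoc_left:
  assumes i: "i \<in> {-1, 1}" and u: "u \<in> carrier U"
    and A: "A \<in> deg S i" and W: "W \<in> deg S (-i)"
  shows "(inj0 u \<star> A) \<star> W = inj0 u \<star> (A \<star> W)"
proof -
  note degs = unit_int_degs[OF i]
  have ii: "i \<in> {0, i}" "i \<in> {0, - (- i)}" and mi: "- i \<in> {0, - i}" by simp_all
  note comp = degs_compat[OF i ii(1) mi]
  have star0: "w \<star> w' \<in> deg S 0" if "w \<in> deg S i" "w' \<in> deg S (-i)" for w w'
    using star_deg[OF comp(1-3) that] by simp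
  have deg0: "0 \<in> local_degs" by simp
  note closed = star0 star_zero_degree(1)[OF degs(1)] star_zero_degree(1)[OF deg0] inj0_deg
  note distr = star_add_left[OF comp(1-3)] star_smult_left[OF comp(1-3)] star_add_zero_degree(1)[OF degs(1)]
    star_add_zero_degree(1)[OF deg0] star_smult_zero_degree(1)[OF degs(1)] star_smult_zero_degree(1)[OF deg0]
  from u A show ?thesis
  proof (induction arbitrary: A rule: U_induct)
    case one
    then show ?case
      using star_one_left[OF i ii(1)] star_one_left[OF i _ star0[OF one W]] W by simp
  next
    case (mult u z r)
    have z: "inj0 (\<iota> z) \<in> deg S 0" using mult(2) by (simp add: inj0_deg)
    have zA: "inj0 (\<iota> z) \<star> A \<in> deg S i" using z mult(4) by (simp add: closed)
    have "(inj0 (u \<otimes>\<^bsub>U\<^esub> \<iota> z) \<star> A) \<star> W = (inj0 u \<star> (inj0 (\<iota> z) \<star> A)) \<star> W"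
      using star_incl[OF degs(3) Inl_gens mult(2,1) ii(2) mult(4)] mult(1,2) by (simp add: one_tens)
    also have "\<dots> = inj0 u \<star> ((inj0 (\<iota> z) \<star> A) \<star> W)" by (rule mult(3)[OF zA])
    also have "\<dots> = inj0 u \<star> (inj0 (\<iota> z) \<star> (A \<star> W))"
      by (simp add: incl_derivation[OF i mult(2) mult(4) W])
    also have "\<dots> = inj0 (u \<otimes>\<^bsub>U\<^esub> \<iota> z) \<star> (A \<star> W)"
      using star_incl[OF i Inl_gens mult(2,1) _ star0[OF mult(4) W]] mult(1,2) by (simp add: one_tens)
    finally show ?case .
  next
    case (smult u s)
    then show ?case using W by (simp add: linear_mapD[OF inj0_linear] closed distr)
  next
    case (add u u')
    then show ?case using W by (simp add: linear_mapD[OF inj0_linear] closed distr)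
  qed
qed

text \<open>
  At least one degree is \<open>0\<close>. If neither the middle nor the right one is, then the left one is, and the other
  two are opposite because \<open>j + k\<close> is a local degree. In the middle case, the degrees of the outer factors
  are \<open>0\<close> or opposite; \<open>l\<close> is chosen such that \<open>i\<close> is \<open>0\<close> or \<open>l\<close>, and \<open>k\<close> is \<open>0\<close> or \<open>-l\<close>.
\<close>

theorem focally_associative_alg: "focally_associative (alg m)"
proof (intro focally_associative.intro focally_associative_axioms.intro alg_m, unfold alg_simps)
  fix i j k x y w
  assume d: "i \<in> local_degs" "j \<in> local_degs" "k \<in> local_degs" "i + j \<in> local_degs" "j + k \<in> local_degs"
      "i + j + k \<in> local_degs" "i = 0 \<or> j = 0 \<or> k = 0"
    and x: "x \<in> deg S i" and y: "y \<in> deg S j" and w: "w \<in> deg S k"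
  note d' = d[unfolded local_degs_def insert_iff empty_iff]
  have "j = 0 \<or> (j \<noteq> 0 \<and> k = 0) \<or> (j \<noteq> 0 \<and> k = - j \<and> i = 0)"
    using d' by presburger
  then consider "j = 0" | "j \<noteq> 0" "k = 0" | "j \<noteq> 0" "k = - j" "i = 0" by blast
  then show "(x \<star> y) \<star> w = x \<star> (y \<star> w)"
  proof cases
    case 1
    then obtain v where v: "v \<in> carrier U" "y = inj0 v" using y by (auto simp: deg_inj)
    define l where "l = (if i \<noteq> 0 then i else if k \<noteq> 0 then - k else 1)"
    have "l \<in> {-1, 1} \<and> i \<in> {0, l} \<and> k \<in> {0, - l}"
      using d' 1 unfolding l_def insert_iff empty_iff by presburger
    then show ?thesis using assoc_middle[of l i k x v w] x v w by simp
  next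
    case 2
    then obtain v where v: "v \<in> carrier U" "w = inj0 v" using w by (auto simp: deg_inj)
    have "- j \<in> {-1, 1} \<and> i \<in> {0, - j}" using d' 2 unfolding insert_iff empty_iff by presburger
    then show ?thesis using assoc_right[of "-j" i x y v] x y v by simp
  next
    case 3
    then obtain u where u: "u \<in> carrier U" "x = inj0 u" using x by (auto simp: deg_inj)
    have "j \<in> {-1, 1}" using d' 3 unfolding insert_iff empty_iff by presburger
    then show ?thesis using assoc_left[of j u y w] y w u 3 by simp
  qed
qed

end

theorem corollary2p5:
  fixes G :: "('k::{alg_closed_field, field_char_0}, 'g) local_superalgebra"
    and L :: 'g and form :: "'g \<Rightarrow> 'g \<Rightarrow> 'k" and a b c :: 'k
  assumes "contragredient G L form"
  shows "focally_associative (Gl G L form a b c)"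
proof -
  interpret contragredient G L form by fact
  interpret Gl_construction G L form a b c
    by (intro Gl_construction.intro local_Lie.intro contragredient_axioms local_Lie_superalgebra_axioms)
  have "is_Gl_prod G L form a b c (SOME m. is_Gl_prod G L form a b c m)"
    by (rule someI[of "is_Gl_prod G L form a b c", OF gl_mult_is_Gl_prod])
  then interpret Gl_product G L form a b c "SOME m. is_Gl_prod G L form a b c m"
    by unfold_locales
  show ?thesis
    unfolding Gl_def by (rule focally_associative_alg)
qed

end
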